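(* Let $\mathcal{C}=[-1,1]^n$ and let $\mu_+,\mu_-$ be Borel probability measures on $\mathbb{R}^n$ with supports contained in $\mathcal{C}$. Let $(S,a,b)$ be a city with $S\subset\mathcal{C}$ such that $b$ is bounded away from $0$ on $S$ and such that the function $\mathbb{R}^n\to[0,\infty]$ which maps $x$ to $b(x)$ if $x\in S$ and to $a$ if $x\notin S$ is lower semi-continuous. Then $$W_{d_{S,a,b}}(\mu_+,\mu_-)=\sup_{\varphi}\int_{\mathcal{C}}\varphi\,\mathrm{d}(\mu_+-\mu_-),$$ where the supremum is taken over all functions $\varphi\in C^1(\mathcal{C})$ with $|\nabla\varphi|\leq b$ on $S$ and $|\nabla\varphi|\leq a$ in $\mathcal{C}\setminus S$.
   Context: A set $S\subset\mathbb{R}^n$ is countably $1$-rectifiable if $S=\bigcup_{i=1}^\infty f_i(A_i)$ with $A_i\subset\mathbb{R}$ bounded and $f_i:A_i\to\mathbb{R}^n$ Lipschitz. A city is a triple $(S,a,b)$ where $S\subset\mathbb{R}^n$ is countably $1$-rectifiable and Borel measurable, $b:S\to[0,\infty)$ is lower semi-continuous (the friction coefficient), and $a\in[0,\infty]$ satisfies $b\leq a$ on $S$. The generalized urban metric (a pseudo-metric, possibly with value $\infty$) is $$d_{S,a,b}(x,y)=\inf_{\gamma}\int_{\gamma([0,1])\cap S}b\,\mathrm{d}\mathcal{H}^1+a\,\mathcal{H}^1(\gamma([0,1])\setminus S),$$ where the infimum is over Lipschitz paths $\gamma:[0,1]\to\mathbb{R}^n$ with $\gamma(0)=x$, $\gamma(1)=y$,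 $\mathcal{H}^1$ is the one-dimensional Hausdorff measure, and $\infty\cdot 0=0$. The Wasserstein distance is $W_{d_{S,a,b}}(\mu_+,\mu_-)=\inf_\pi\int_{\mathbb{R}^n\times\mathbb{R}^n}d_{S,a,b}\,\mathrm{d}\pi\in[0,\infty]$, the infimum being over probability measures $\pi$ on $\mathbb{R}^n\times\mathbb{R}^n$ with $\pi(B\times\mathbb{R}^n)=\mu_+(B)$ and $\pi(\mathbb{R}^n\times B)=\mu_-(B)$ for all Borel sets $B\subset\mathbb{R}^n$. $C^1(\mathcal{C})$ is the space of continuous functions $f:\mathcal{C}\to\mathbb{R}$ that are continuously differentiable on $(-1,1)^n$ and whose derivative extends continuously to $\mathcal{C}$; $\nabla f$ denotes this extension on $\mathcal{C}$. *)

theory Defs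
  imports "HOL-Probability.Probability"
begin

text \<open>Boundedness of the covering sets is required because \<^const>\<open>diameter\<close> is real-valued and
  hence meaningless on unbounded sets. With this normalization segments have measure equal to
  their length.\<close>

definition hausdorff1_pre :: "real \<Rightarrow> 'a::metric_space set \<Rightarrow> ennreal" where
  "hausdorff1_pre \<delta> A =
     (INF U \<in> {U :: nat \<Rightarrow> 'a set. A \<subseteq> (\<Union>i. U i) \<and> (\<forall>i. bounded (U i) \<and> diameter (U i) \<le> \<delta>)}.
        (\<Sum>i. ennreal (diameter (U i))))"

definition hausdorff1_outer :: "'a::metric_space set \<Rightarrow> ennreal" where
  "hausdorff1_outer A = (SUP \<delta> \<in> {0<..}. hausdorff1_pre \<delta> A)"

definition hausdorff1 :: "'a::metric_space measure" where
  "hausdorff1 = measure_of UNIV (sets borel) hausdorff1_outer"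

text \<open>\<^const>\<open>measure_of\<close> silently yields the zero measure when its argument is not a measure on
  the given sets. The following lemmas, ending in \<open>emeasure_hausdorff1\<close>, exclude this.\<close>

lemma hausdorff1_pre_leI:
  assumes "A \<subseteq> (\<Union>i. U i)" "\<And>i. bounded (U i)" "\<And>i. diameter (U i) \<le> \<delta>"
  shows "hausdorff1_pre \<delta> A \<le> (\<Sum>i. ennreal (diameter (U (i::nat))))"
  unfolding hausdorff1_pre_def using assms by (intro INF_lower) auto

lemma hausdorff1_pre_lessE:
  assumes "hausdorff1_pre \<delta> A < c"
  obtains U where "A \<subseteq> (\<Union>i. U i)" "\<And>i::nat. bounded (U i)" "\<And>i. diameter (U i) \<le> \<delta>"
    "(\<Sum>i. ennreal (diameter (U i))) < c"
  using assms unfolding hausdorff1_pre_def INF_less_iff by auto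

lemma hausdorff1_pre_mono: "A \<subseteq> B \<Longrightarrow> hausdorff1_pre \<delta> A \<le> hausdorff1_pre \<delta> B"
  unfolding hausdorff1_pre_def by (intro INF_superset_mono) auto

lemma hausdorff1_pre_antimono: "\<delta> \<le> \<epsilon> \<Longrightarrow> hausdorff1_pre \<epsilon> A \<le> hausdorff1_pre \<delta> A"
  unfolding hausdorff1_pre_def by (intro INF_superset_mono) (auto intro: order_trans)

lemma hausdorff1_pre_UN:
  "hausdorff1_pre \<delta> (\<Union>i::nat. A i) \<le> (\<Sum>i. hausdorff1_pre \<delta> (A i))"
proof (rule ennreal_le_epsilon)
  fix e :: real
  assume fin: "(\<Sum>i. hausdorff1_pre \<delta> (A i)) < top" and e: "0 < e"
  have "\<exists>U. A i \<subseteq> (\<Union>j. U j) \<and> (\<forall>j::nat. bounded (U j) \<and> diameter (U j) \<le> \<delta>) \<and>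
          (\<Sum>j. ennreal (diameter (U j))) < hausdorff1_pre \<delta> (A i) + ennreal (e * (1/2)^Suc i)" for i
  proof -
    have "hausdorff1_pre \<delta> (A i) < top"
      using fin by (rule ennreal_suminf_lessD)
    then have lt: "hausdorff1_pre \<delta> (A i) + 0 < hausdorff1_pre \<delta> (A i) + ennreal (e * (1/2)^Suc i)"
      using e by (subst ennreal_add_left_cancel_less) auto
    show ?thesis
      using lt unfolding add_0_right by (rule hausdorff1_pre_lessE) blast
  qed
  then obtain U where U: "\<And>i. A i \<subseteq> (\<Union>j. U i j)" "\<And>i j::nat. bounded (U i j)"
      "\<And>i j. diameter (U i j) \<le> \<delta>"
      "\<And>i. (\<Sum>j. ennreal (diameter (U i j))) < hausdorff1_pre \<delta> (A i) + ennreal (e * (1/2)^Suc i)"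
    by metis
  have "hausdorff1_pre \<delta> (\<Union>i. A i)
      \<le> (\<Sum>k. ennreal (diameter (case prod_decode k of (i, j) \<Rightarrow> U i j)))"
  proof (rule hausdorff1_pre_leI)
    show "(\<Union>i. A i) \<subseteq> (\<Union>k. case prod_decode k of (i, j) \<Rightarrow> U i j)"
    proof
      fix x assume "x \<in> (\<Union>i. A i)"
      then obtain i j where "x \<in> U i j" using U(1) by blast
      then show "x \<in> (\<Union>k. case prod_decode k of (i, j) \<Rightarrow> U i j)"
        by (intro UN_I[of "prod_encode (i, j)"]) auto
    qed
  qed (use U in \<open>auto split: prod.splits\<close>)
  also have "\<dots> = (\<Sum>k. (\<lambda>(i, j). ennreal (diameter (U i j))) (prod_decode k))"
    by (simp add: case_prod_unfold)
  also have "\<dots> = (\<Sum>i. \<Sum>j. ennreal (diameter (U i j)))"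
    by (rule suminf_ennreal_2dimen) simp
  also have "\<dots> \<le> (\<Sum>i. hausdorff1_pre \<delta> (A i) + ennreal (e * (1/2)^Suc i))"
    using U(4) by (intro suminf_le summableI) (auto intro: less_imp_le)
  also have "\<dots> = (\<Sum>i. hausdorff1_pre \<delta> (A i)) + (\<Sum>i. ennreal (e * (1/2)^Suc i))"
    by (intro suminf_add[symmetric] summableI)
  also have "(\<Sum>i. ennreal (e * (1/2)^Suc i)) = ennreal e"
  proof -
    have "(\<lambda>i. e * (1/2)^Suc i) sums (e * 1)"
      by (intro sums_mult power_half_series)
    then show ?thesis
      using e by (intro sums_unique[symmetric]) simp
  qed
  finally show "hausdorff1_pre \<delta> (\<Union>i. A i) \<le> (\<Sum>i. hausdorff1_pre \<delta> (A i)) + ennreal e" .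
qed

lemma hausdorff1_pre_le_outer: "0 < \<delta> \<Longrightarrow> hausdorff1_pre \<delta> A \<le> hausdorff1_outer A"
  unfolding hausdorff1_outer_def by (intro SUP_upper) auto

lemma hausdorff1_outer_UN: "hausdorff1_outer (\<Union>i::nat. A i) \<le> (\<Sum>i. hausdorff1_outer (A i))"
  unfolding hausdorff1_outer_def[of "\<Union>i. A i"]
proof (rule SUP_least)
  fix \<delta> :: real assume "\<delta> \<in> {0<..}"
  then show "hausdorff1_pre \<delta> (\<Union>i. A i) \<le> (\<Sum>i. hausdorff1_outer (A i))"
    by (intro order_trans[OF hausdorff1_pre_UN] suminf_le summableI hausdorff1_pre_le_outer) auto
qed

lemma outer_measure_space_hausdorff1:
  "outer_measure_space (Pow UNIV) (hausdorff1_outer :: 'a::metric_space set \<Rightarrow> ennreal)"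
  unfolding outer_measure_space_def
proof (intro conjI)
  have "hausdorff1_pre \<delta> ({} :: 'a set) = 0" if "\<delta> > 0" for \<delta>
    using that hausdorff1_pre_leI[of "{} :: 'a set" "\<lambda>_. {}" \<delta>] by simp
  then show "positive (Pow UNIV) (hausdorff1_outer :: 'a set \<Rightarrow> ennreal)"
    by (simp add: positive_def hausdorff1_outer_def cong: SUP_cong_simp)
  show "increasing (Pow UNIV) (hausdorff1_outer :: 'a set \<Rightarrow> ennreal)"
    by (auto simp: increasing_def hausdorff1_outer_def intro!: SUP_mono hausdorff1_pre_mono)
  show "countably_subadditive (Pow UNIV) (hausdorff1_outer :: 'a set \<Rightarrow> ennreal)"
    by (auto simp: countably_subadditive_def intro: hausdorff1_outer_UN)
qed

lemma hausdorff1_outer_separated: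
  assumes e: "0 < e" and AB: "\<And>x y. x \<in> A \<Longrightarrow> y \<in> B \<Longrightarrow> e \<le> dist x y"
  shows "hausdorff1_outer A + hausdorff1_outer B \<le> hausdorff1_outer (A \<union> B)"
proof -
  have pre: "hausdorff1_pre \<delta> A + hausdorff1_pre \<delta> B \<le> hausdorff1_pre \<delta> (A \<union> B)"
    if \<delta>: "0 < \<delta>" "\<delta> < e" for \<delta>
    unfolding hausdorff1_pre_def[of \<delta> "A \<union> B"]
  proof (rule INF_greatest, clarsimp)
    fix U :: "nat \<Rightarrow> 'a set"
    assume U: "A \<subseteq> (\<Union>i. U i)" "B \<subseteq> (\<Union>i. U i)" "\<forall>i. bounded (U i) \<and> diameter (U i) \<le> \<delta>"
    define V where "V = (\<lambda>C i. if U i \<inter> C = {} then {} else U i)"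
    have V: "hausdorff1_pre \<delta> C \<le> (\<Sum>i. ennreal (diameter (V C i)))" if "C \<subseteq> (\<Union>i. U i)" for C
      using that U(3) \<delta> by (intro hausdorff1_pre_leI) (fastforce simp: V_def)+
    have "ennreal (diameter (V A i)) + ennreal (diameter (V B i)) \<le> ennreal (diameter (U i))" for i
    proof -
      have "U i \<inter> A = {} \<or> U i \<inter> B = {}"
      proof (rule ccontr)
        assume "\<not> ?thesis"
        then obtain x y where "x \<in> U i" "x \<in> A" "y \<in> U i" "y \<in> B" by auto
        then have "e \<le> dist x y" "dist x y \<le> diameter (U i)"
          using AB U(3) diameter_bounded_bound by blast+
        then show False using U(3) \<delta> by (smt (verit))
      qed
      then show ?thesis by (auto simp: V_def)
    qed
    then have "(\<Sum>i. ennreal (diameter (V A i))) + (\<Sum>i. ennreal (diameter (V B i)))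
        \<le> (\<Sum>i. ennreal (diameter (U i)))"
      by (subst suminf_add) (auto intro!: suminf_le summableI)
    then show "hausdorff1_pre \<delta> A + hausdorff1_pre \<delta> B \<le> (\<Sum>i. ennreal (diameter (U i)))"
      using V[OF U(1)] V[OF U(2)] by (meson add_mono order_trans)
  qed
  have lim: "hausdorff1_outer C = (SUP \<delta> \<in> {0<..<e}. hausdorff1_pre \<delta> C)" for C :: "'a set"
    unfolding hausdorff1_outer_def
  proof (rule antisym)
    show "(SUP \<delta> \<in> {0<..}. hausdorff1_pre \<delta> C) \<le> (SUP \<delta> \<in> {0<..<e}. hausdorff1_pre \<delta> C)"
    proof (rule SUP_mono)
      fix \<delta> :: real assume "\<delta> \<in> {0<..}"
      then show "\<exists>m\<in>{0<..<e}. hausdorff1_pre \<delta> C \<le> hausdorff1_pre m C"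
        using e by (intro bexI[of _ "min \<delta> (e/2)"] hausdorff1_pre_antimono) auto
    qed
  qed (auto intro: SUP_subset_mono)
  have "hausdorff1_outer A + hausdorff1_outer B
      = (SUP \<delta> \<in> {0<..<e}. hausdorff1_pre \<delta> A + hausdorff1_pre \<delta> B)"
    unfolding lim
  proof (rule SUP_add_directed_ennreal[symmetric])
    fix \<delta> \<epsilon> assume "\<delta> \<in> {0<..<e}" "\<epsilon> \<in> {0<..<e}"
    then show "\<exists>k\<in>{0<..<e}. hausdorff1_pre \<delta> A + hausdorff1_pre \<epsilon> B
        \<le> hausdorff1_pre k A + hausdorff1_pre k B"
      by (intro bexI[of _ "min \<delta> \<epsilon>"] add_mono hausdorff1_pre_antimono) auto
  qed
  also have "\<dots> \<le> hausdorff1_outer (A \<union> B)"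
    using pre by (intro SUP_least order_trans[OF _ hausdorff1_pre_le_outer]) auto
  finally show ?thesis .
qed

lemma hausdorff1_outer_mono: "A \<subseteq> B \<Longrightarrow> hausdorff1_outer A \<le> hausdorff1_outer B"
  using outer_measure_space_hausdorff1 by (auto simp: outer_measure_space_def increasing_def)

lemma hausdorff1_outer_empty: "hausdorff1_outer {} = 0"
  using outer_measure_space_hausdorff1 by (auto simp: outer_measure_space_def positive_def)

lemma hausdorff1_outer_Un: "hausdorff1_outer (A \<union> B) \<le> hausdorff1_outer A + hausdorff1_outer B"
proof -
  have "hausdorff1_outer (\<Union>i. binaryset A B i) \<le> (\<Sum>i. hausdorff1_outer (binaryset A B i))"
    by (rule hausdorff1_outer_UN)
  then show ?thesis
    by (simp add: UN_binaryset_eq suminf_binaryset_eq[of hausdorff1_outer, OF hausdorff1_outer_empty])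
qed

lemma hausdorff1_outer_sum_separated:
  assumes "\<And>i j x y. i < j \<Longrightarrow> x \<in> R i \<Longrightarrow> y \<in> R j \<Longrightarrow> e j \<le> dist x y" "\<And>j::nat. 0 < e j"
  shows "(\<Sum>i<n. hausdorff1_outer (R i)) \<le> hausdorff1_outer (\<Union>i<n. R i)"
proof (induction n)
  case (Suc n)
  have "(\<Sum>i<Suc n. hausdorff1_outer (R i))
      \<le> hausdorff1_outer (\<Union>i<n. R i) + hausdorff1_outer (R n)"
    using Suc by (simp add: add_right_mono)
  also have "\<dots> \<le> hausdorff1_outer ((\<Union>i<n. R i) \<union> R n)"
    using assms by (intro hausdorff1_outer_separated[of "e n"]) auto
  also have "(\<Union>i<n. R i) \<union> R n = (\<Union>i<Suc n. R i)"
    by (auto simp: lessThan_Suc)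
  finally show ?case .
qed simp

lemma hausdorff1_outer_closed:
  fixes F T :: "'a::metric_space set"
  assumes F: "closed F" "F \<noteq> {}"
  shows "hausdorff1_outer (T \<inter> F) + hausdorff1_outer (T - F) \<le> hausdorff1_outer T"
proof (cases "hausdorff1_outer T = top")
  case False
  define r where "r = (\<lambda>k. 1 / real (Suc k))"
  have r: "0 < r k" "r (Suc k) < r k" for k
    by (auto simp: r_def field_simps)
  have r_le: "r j \<le> r i" if "i \<le> j" for i j
    using that by (auto simp: r_def field_simps)
  define A where "A = (\<lambda>k. {x\<in>T. r k \<le> infdist x F})"
  define R where "R = (\<lambda>k. {x\<in>T. r (Suc k) \<le> infdist x F \<and> infdist x F < r k})"
  have RT: "(\<Sum>i<n. hausdorff1_outer (R (2 * i + c))) \<le> hausdorff1_outer T" for c n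
  proof -
    have "(\<Sum>i<n. hausdorff1_outer (R (2 * i + c))) \<le> hausdorff1_outer (\<Union>i<n. R (2 * i + c))"
    proof (rule hausdorff1_outer_sum_separated)
      fix i j x y assume ij: "i < j" and xy: "x \<in> R (2 * i + c)" "y \<in> R (2 * j + c)"
      have "infdist x F \<le> infdist y F + dist x y"
        by (rule infdist_triangle)
      moreover have "r (2 * j + c - 1) \<le> r (Suc (2 * i + c))"
        using ij by (intro r_le) linarith
      moreover have "r (Suc (2 * i + c)) \<le> infdist x F"
        using xy(1) by (auto simp: R_def)
      moreover have "infdist y F < r (2 * j + c)"
        using xy(2) by (auto simp: R_def)
      ultimately show "r (2 * j + c - 1) - r (2 * j + c) + (if j = 0 then 1 else 0) \<le> dist x y"
        using ij by simp
    next
      fix j :: nat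
      show "0 < r (2 * j + c - 1) - r (2 * j + c) + (if j = 0 then 1 else 0)"
        using r(2)[of "2 * j + c - 1"] r_le[of "c - 1" c] by (cases j) auto
    qed
    also have "\<dots> \<le> hausdorff1_outer T"
      by (intro hausdorff1_outer_mono) (auto simp: R_def)
    finally show ?thesis .
  qed
  have fin: "(\<Sum>i. hausdorff1_outer (R i)) \<noteq> top"
  proof -
    have "(\<Sum>i<2 * n. hausdorff1_outer (R i))
        = (\<Sum>i<n. hausdorff1_outer (R (2 * i + 0))) + (\<Sum>i<n. hausdorff1_outer (R (2 * i + 1)))" for n
      by (induction n) (auto simp: algebra_simps)
    then have le: "(\<Sum>i<2 * n. hausdorff1_outer (R i)) \<le> hausdorff1_outer T + hausdorff1_outer T" for n
      using add_mono[OF RT[of 0 n] RT[of 1 n]] by simp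
    have "(\<Sum>i. hausdorff1_outer (R i)) \<le> hausdorff1_outer T + hausdorff1_outer T"
    proof (rule suminf_le_const)
      show "(\<Sum>i<n. hausdorff1_outer (R i)) \<le> hausdorff1_outer T + hausdorff1_outer T" for n
        by (rule order_trans[OF sum_mono2 le[of n]]) auto
    qed (rule summableI)
    also have "\<dots> < top"
      using False by (simp add: less_top)
    finally show ?thesis by simp
  qed
  have step: "hausdorff1_outer (T \<inter> F) + hausdorff1_outer (T - F)
      \<le> hausdorff1_outer T + (\<Sum>i. hausdorff1_outer (R (i + k)))" for k
  proof -
    have "T - F \<subseteq> A k \<union> (\<Union>i. R (i + k))"
    proof
      fix x assume x: "x \<in> T - F"
      then have pos: "0 < infdist x F"
        using F in_closed_iff_infdist_zero[OF F] infdist_nonneg[of x F] by (auto simp: less_le)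
      show "x \<in> A k \<union> (\<Union>i. R (i + k))"
      proof (cases "r k \<le> infdist x F")
        case True
        then show ?thesis using x by (auto simp: A_def)
      next
        case False
        obtain m where m: "r m < infdist x F"
          using reals_Archimedean[OF pos] by (auto simp: r_def inverse_eq_divide)
        define n where "n = (LEAST n. r n \<le> infdist x F)"
        have n: "r n \<le> infdist x F"
          unfolding n_def by (rule LeastI[of _ m]) (use m in simp)
        have "k < n"
          using n False r_le[of n k] by (cases "k < n") auto
        then obtain l where l: "n = Suc l" "k \<le> l" by (cases n) auto
        have "infdist x F < r l"
          using not_less_Least[of l "\<lambda>n. r n \<le> infdist x F"] l(1) by (auto simp: n_def)
        then have "x \<in> R (l - k + k)"
          using x n l by (auto simp: R_def)
        then show ?thesis by blast
      qed
    qed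
    then have "hausdorff1_outer (T - F) \<le> hausdorff1_outer (A k) + hausdorff1_outer (\<Union>i. R (i + k))"
      by (meson hausdorff1_outer_Un hausdorff1_outer_mono order_trans)
    then have "hausdorff1_outer (T - F) \<le> hausdorff1_outer (A k) + (\<Sum>i. hausdorff1_outer (R (i + k)))"
      by (rule order_trans) (intro add_left_mono hausdorff1_outer_UN)
    then have "hausdorff1_outer (T \<inter> F) + hausdorff1_outer (T - F)
        \<le> (hausdorff1_outer (T \<inter> F) + hausdorff1_outer (A k)) + (\<Sum>i. hausdorff1_outer (R (i + k)))"
      by (simp add: add.assoc add_left_mono)
    also have "hausdorff1_outer (T \<inter> F) + hausdorff1_outer (A k) \<le> hausdorff1_outer ((T \<inter> F) \<union> A k)"
    proof (rule hausdorff1_outer_separated[of "r k"])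
      fix x y assume "x \<in> T \<inter> F" "y \<in> A k"
      then show "r k \<le> dist x y"
        using infdist_le[of x F y] by (auto simp: A_def dist_commute)
    qed (rule r)
    also have "\<dots> \<le> hausdorff1_outer T"
      by (rule hausdorff1_outer_mono) (auto simp: A_def)
    finally show ?thesis by (simp add: add_right_mono)
  qed
  have "(\<lambda>k. \<Sum>i. hausdorff1_outer (R (i + k))) \<longlonglongrightarrow> 0"
  proof -
    have lt: "hausdorff1_outer (R i) < top" for i
      using fin by (intro ennreal_suminf_lessD[of "\<lambda>i. hausdorff1_outer (R i)"]) (simp add: less_top)
    define h where "h = (\<lambda>i. enn2real (hausdorff1_outer (R i)))"
    have h: "hausdorff1_outer (R i) = ennreal (h i)" "0 \<le> h i" for i
      using lt by (auto simp: h_def less_top)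
    have sm: "summable h"
      using fin unfolding h(1) by (intro summable_suminf_not_top h(2))
    have "(\<Sum>i. ennreal (h (i + k))) = ennreal (\<Sum>i. h (i + k))" for k
      using summable_ignore_initial_segment[OF sm] h(2) by (intro suminf_ennreal2) auto
    moreover have "(\<lambda>k. ennreal (\<Sum>i. h (i + k))) \<longlonglongrightarrow> ennreal 0"
      by (intro tendsto_ennrealI suminf_exist_split2 sm)
    ultimately show ?thesis by (simp add: h(1))
  qed
  then have "(\<lambda>k. hausdorff1_outer T + (\<Sum>i. hausdorff1_outer (R (i + k))))
      \<longlonglongrightarrow> hausdorff1_outer T + 0"
    by (intro tendsto_add tendsto_const)
  then show ?thesis
    using step by (intro LIMSEQ_le_const[of _ "hausdorff1_outer T"]) auto
qed (simp add: top_unique)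

lemma borel_subset_lambda_system:
  "sets (borel :: 'a::metric_space measure) \<subseteq> lambda_system UNIV (Pow UNIV) hausdorff1_outer"
proof -
  interpret sigma_algebra "UNIV :: 'a set" "Pow UNIV" by (rule sigma_algebra_Pow)
  interpret L: sigma_algebra UNIV "lambda_system (UNIV :: 'a set) (Pow UNIV) hausdorff1_outer"
    using caratheodory_lemma[OF outer_measure_space_hausdorff1] by (simp add: measure_space_def)
  have "F \<in> lambda_system UNIV (Pow UNIV) hausdorff1_outer" if "closed F" for F :: "'a set"
  proof (cases "F = {}")
    case False
    have "hausdorff1_outer (T \<inter> F) + hausdorff1_outer (T - F) = hausdorff1_outer T" for T
    proof (rule antisym)
      have "hausdorff1_outer T = hausdorff1_outer ((T \<inter> F) \<union> (T - F))"
        by (simp add: Int_Diff_Un)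
      then show "hausdorff1_outer T \<le> hausdorff1_outer (T \<inter> F) + hausdorff1_outer (T - F)"
        by (simp add: hausdorff1_outer_Un)
    qed (rule hausdorff1_outer_closed[OF that False])
    then show ?thesis by (simp add: lambda_system_eq del: Pow_UNIV)
  next
    case True
    then show ?thesis using L.empty_sets by simp
  qed
  then have "sigma_sets UNIV (Collect closed) \<subseteq> lambda_system (UNIV :: 'a set) (Pow UNIV) hausdorff1_outer"
    by (intro L.sigma_sets_subset) blast
  then show ?thesis
    unfolding borel_eq_closed by (subst sets_measure_of) simp_all
qed

lemma measure_space_hausdorff1:
  "measure_space (UNIV :: 'a::metric_space set) (sets borel) hausdorff1_outer"
proof -
  interpret sigma_algebra "UNIV :: 'a set" "Pow UNIV" by (rule sigma_algebra_Pow)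
  have "measure_space (UNIV :: 'a set) (lambda_system UNIV (Pow UNIV) hausdorff1_outer) hausdorff1_outer"
    by (rule caratheodory_lemma[OF outer_measure_space_hausdorff1])
  then show ?thesis
    using borel_subset_lambda_system[where 'a='a] sets.sigma_algebra_axioms[of "borel :: 'a measure"]
    by (auto simp: measure_space_def positive_def countably_additive_def)
qed

lemma space_hausdorff1 [simp]: "space hausdorff1 = UNIV"
  by (simp add: hausdorff1_def space_measure_of_conv)

lemma sets_hausdorff1 [simp, measurable_cong]: "sets hausdorff1 = sets borel"
  using sets.sigma_sets_eq[of borel] by (simp add: hausdorff1_def)

lemma emeasure_hausdorff1: "A \<in> sets borel \<Longrightarrow> emeasure hausdorff1 A = hausdorff1_outer A"
  using measure_space_hausdorff1
  by (intro emeasure_measure_of[OF hausdorff1_def]) (auto simp: measure_space_def)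

definition countably_1_rectifiable :: "'a::metric_space set \<Rightarrow> bool" where
  "countably_1_rectifiable S \<longleftrightarrow>
     (\<exists>(A :: nat \<Rightarrow> real set) f. (\<forall>i. bounded (A i) \<and> (\<exists>L. L-lipschitz_on (A i) (f i))) \<and>
        S = (\<Union>i. f i ` A i))"

definition lower_semicontinuous_on ::
    "'a::topological_space set \<Rightarrow> ('a \<Rightarrow> 'b::linorder) \<Rightarrow> bool" where
  "lower_semicontinuous_on S f \<longleftrightarrow>
     (\<forall>x\<in>S. \<forall>t<f x. eventually (\<lambda>y. t < f y) (at x within S))"

text \<open>The friction coefficient \<open>b\<close> is a total function of which only the values on \<open>S\<close> matter.\<close>

definition city :: "'a::euclidean_space set \<Rightarrow> ennreal \<Rightarrow> ('a \<Rightarrow> real) \<Rightarrow> bool" where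
  "city S a b \<longleftrightarrow>
     countably_1_rectifiable S \<and> S \<in> sets borel \<and>
     (\<forall>x\<in>S. 0 \<le> b x) \<and> lower_semicontinuous_on S b \<and> (\<forall>x\<in>S. ennreal (b x) \<le> a)"

definition friction :: "'a set \<Rightarrow> ennreal \<Rightarrow> ('a \<Rightarrow> real) \<Rightarrow> 'a \<Rightarrow> ennreal" where
  "friction S a b x = (if x \<in> S then ennreal (b x) else a)"

definition lipschitz_paths :: "'a::metric_space \<Rightarrow> 'a \<Rightarrow> (real \<Rightarrow> 'a) set" where
  "lipschitz_paths x y = {\<gamma>. (\<exists>L. L-lipschitz_on {0..1} \<gamma>) \<and> \<gamma> 0 = x \<and> \<gamma> 1 = y}"

definition urban_metric ::
    "'a::euclidean_space set \<Rightarrow> ennreal \<Rightarrow> ('a \<Rightarrow> real) \<Rightarrow> 'a \<Rightarrow> 'a \<Rightarrow> ennreal" where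
  "urban_metric S a b x y =
     (INF \<gamma> \<in> lipschitz_paths x y.
        (\<integral>\<^sup>+z\<in>\<gamma> ` {0..1} \<inter> S. ennreal (b z) \<partial>hausdorff1) + a * emeasure hausdorff1 (\<gamma> ` {0..1} - S))"

definition borel_prob :: "'a::topological_space measure \<Rightarrow> bool" where
  "borel_prob \<mu> \<longleftrightarrow> sets \<mu> = sets borel \<and> prob_space \<mu>"

definition measure_support :: "'a::topological_space measure \<Rightarrow> 'a set" where
  "measure_support \<mu> = {x. \<forall>U. open U \<and> x \<in> U \<longrightarrow> emeasure \<mu> U > 0}"

definition couplings ::
    "'a::topological_space measure \<Rightarrow> 'a measure \<Rightarrow> ('a \<times> 'a) measure set" where
  "couplings \<mu> \<nu> =
     {\<pi>. borel_prob \<pi> \<and>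
        (\<forall>B\<in>sets borel. emeasure \<pi> (B \<times> UNIV) = emeasure \<mu> B \<and> emeasure \<pi> (UNIV \<times> B) = emeasure \<nu> B)}"

definition wasserstein ::
    "('a::topological_space \<Rightarrow> 'a \<Rightarrow> ennreal) \<Rightarrow> 'a measure \<Rightarrow> 'a measure \<Rightarrow> ennreal" where
  "wasserstein d \<mu> \<nu> = (INF \<pi> \<in> couplings \<mu> \<nu>. \<integral>\<^sup>+z. d (fst z) (snd z) \<partial>\<pi>)"

definition cube :: "(real ^ 'n) set" where
  "cube = {x. \<forall>i. x $ i \<in> {-1..1}}"

definition open_cube :: "(real ^ 'n) set" where
  "open_cube = {x. \<forall>i. x $ i \<in> {-1<..<1}}"

definition is_gradient_on_cube :: "(real ^ 'n \<Rightarrow> real) \<Rightarrow> (real ^ 'n \<Rightarrow> real ^ 'n) \<Rightarrow> bool" where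
  "is_gradient_on_cube f g \<longleftrightarrow> continuous_on cube g \<and> (\<forall>x\<in>open_cube. GDERIV f x :> g x)"

definition C1_cube :: "(real ^ 'n \<Rightarrow> real) set" where
  "C1_cube = {f. continuous_on cube f \<and> (\<exists>g. is_gradient_on_cube f g)}"

definition cube_gradient :: "(real ^ 'n \<Rightarrow> real) \<Rightarrow> real ^ 'n \<Rightarrow> real ^ 'n" where
  "cube_gradient f = (SOME g. is_gradient_on_cube f g)"

text \<open>The choice is immaterial, since the gradient is determined on the whole closed cube:\<close>

lemma cube_eq_cbox: "cube = cbox (\<chi> i. -1) (\<chi> i. 1)"
  by (auto simp: cube_def mem_box_cart)

lemma open_cube_eq_box: "open_cube = box (\<chi> i. -1) (\<chi> i. 1)"
  by (auto simp: open_cube_def mem_box_cart)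

lemma closure_open_cube: "closure open_cube = (cube :: (real ^ 'n) set)"
proof -
  have "(0 :: real ^ 'n) \<in> box (\<chi> i. -1) (\<chi> i. 1)"
    by (simp add: mem_box_cart)
  then show ?thesis
    unfolding cube_eq_cbox open_cube_eq_box by (intro closure_box) auto
qed

lemma is_gradient_on_cube_unique:
  assumes g: "is_gradient_on_cube f g" and h: "is_gradient_on_cube f h" and x: "x \<in> cube"
  shows "g x = h x"
proof -
  have eq: "g y = h y" if "y \<in> open_cube" for y
  proof -
    have "(\<lambda>v. inner v (g y)) = (\<lambda>v. inner v (h y))"
      using g h that unfolding is_gradient_on_cube_def gderiv_def
      by (intro has_derivative_unique[of f _ y]) auto
    then show ?thesis
      by (metis vector_eq_rdot inner_commute)
  qed
  have "g x - h x = 0"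
  proof (rule continuous_constant_on_closure[of open_cube "\<lambda>x. g x - h x"])
    show "continuous_on (closure open_cube) (\<lambda>x. g x - h x)"
      using g h by (auto simp: closure_open_cube is_gradient_on_cube_def intro: continuous_on_diff)
  qed (use eq x closure_open_cube in auto)
  then show ?thesis by simp
qed

lemma cube_gradient_eq:
  assumes "is_gradient_on_cube f g" "x \<in> cube"
  shows "cube_gradient f x = g x"
  using assms unfolding cube_gradient_def by (metis is_gradient_on_cube_unique someI_ex)

end

theory Submission
  imports Defs "HOL-Combinatorics.Cycles"
begin

text \<open>
  Let \<open>c\<close> be the friction, \<open>b\<close> on \<open>S\<close> and \<open>a\<close> elsewhere. The cost of a path is the integral of \<open>c\<close> over its image with
  respect to the one-dimensional Hausdorff measure, so the urban metric is the length distance of weight \<open>c\<close>.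

  Admissible potentials stay below the transport cost. The image of a path from \<open>x\<close> to \<open>y\<close> under \<open>\<phi>\<close> contains the
  interval between \<open>\<phi> x\<close> and \<open>\<phi> y\<close>, hence \<open>\<bar>\<phi> x - \<phi> y\<bar>\<close> is at most the measure of that image, which is at most the
  integral of the gradient norm over the path (\<open>increment_le_hausdorff1_integral\<close>). Integration against a
  coupling gives one inequality.

  For the other one, let \<open>M\<close> be the supremum over the admissible potentials, assumed finite. It suffices to find
  one coupling of cost at most \<open>M\<close>. Approximate \<open>c\<close> from below by Lipschitz functions \<open>c k\<close> increasing to \<open>c\<close>, which is
  possible because \<open>c\<close> is lower semicontinuous, and let \<open>d k\<close> be the distance obtained from chains of small jumps
  weighted by \<open>c k\<close>. Three facts are combined.

  \<^item> The supremum of the \<open>d k\<close> dominates the urban metric (\<open>urban_metric_le_limit\<close>). This supremum has midpoints,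
    by compactness, hence geodesics, and the path cost of a geodesic is bounded by its length.

  \<^item> For each \<open>k\<close> there are couplings of sampled versions of the two measures whose \<open>d k\<close>-cost is at most \<open>M\<close> up to a
    small error (\<open>discrete_coupling\<close>). An optimal matching of equally many points has a dual potential that is
    1-Lipschitz for \<open>d k\<close>; its slope is locally at most \<open>c k\<close>, so that after mollification and a slight rescaling it
    is admissible.

  \<^item> Sequences of empirical measures on a bounded set have weak limit points (\<open>empirical_measures_compact\<close>). A
    space-filling curve reduces this to Helly's theorem on the line.

  A weak limit of the discrete couplings couples the two measures. It has cost at most \<open>M\<close> for every \<open>d j\<close>,
  because \<open>d j\<close> is continuous and \<open>d j \<le> d k\<close> for \<open>j \<le> k\<close>, hence also for the supremum, by monotone convergence.

  Chain distances need \<open>c\<close> bounded below by a positive constant. This fails only if \<open>a = 0\<close>; then \<open>S\<close> is empty, the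
  urban metric vanishes and any coupling will do.
\<close>

section \<open>Hausdorff measure of curves and intervals\<close>

text \<open>Integrals over \<open>K\<close> are estimated on finitely many disjoint pieces on which a uniformly continuous
  function is nearly constant. Pieces may be empty, so the point \<open>p i\<close> is only asked to lie in \<open>K\<close>.\<close>

lemma compact_borel_partition:
  fixes K :: "'a::metric_space set"
  assumes K: "compact K" and d: "0 < \<delta>"
  obtains n :: nat and A p where "K = (\<Union>i<n. A i)" "disjoint_family_on A {..<n}"
    "\<And>i. A i \<in> sets borel" "\<And>i. i < n \<Longrightarrow> p i \<in> K" "\<And>i z. z \<in> A i \<Longrightarrow> dist (p i) z < \<delta>"
proof -
  obtain X where X: "X \<subseteq> K" "finite X" "K \<subseteq> (\<Union>x\<in>X. ball x \<delta>)"
    using compactE_image[OF K, of K "\<lambda>x. ball x \<delta>"] d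
    by (metis (no_types, lifting) UN_I centre_in_ball open_ball subsetI)
  obtain xs where xs: "set xs = X" using finite_list[OF X(2)] by blast
  define n where "n = length xs"
  define A where "A i = K \<inter> (ball (xs ! i) \<delta> - (\<Union>j<i. ball (xs ! j) \<delta>))" for i
  have "K \<in> sets borel" using K by (rule borel_compact)
  then have Ab: "A i \<in> sets borel" for i unfolding A_def by measurable
  have "K \<subseteq> (\<Union>i<n. A i)"
  proof
    fix z assume z: "z \<in> K"
    then obtain i where i: "i < n" "z \<in> ball (xs ! i) \<delta>"
      using X(3) xs unfolding n_def by (metis (no_types, lifting) UN_E in_set_conv_nth subsetD)
    define k where "k = (LEAST i. i < n \<and> z \<in> ball (xs ! i) \<delta>)"
    have k: "k < n \<and> z \<in> ball (xs ! k) \<delta>"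
      unfolding k_def by (rule LeastI[of _ i]) (use i in auto)
    have "z \<notin> ball (xs ! j) \<delta>" if "j < k" for j
      using not_less_Least[of j "\<lambda>i. i < n \<and> z \<in> ball (xs ! i) \<delta>"] that k unfolding k_def[symmetric] by auto
    then have "z \<in> A k" using z k by (auto simp: A_def)
    then show "z \<in> (\<Union>i<n. A i)" using k by blast
  qed
  then have KA: "K = (\<Union>i<n. A i)" by (auto simp: A_def)
  have "A i \<inter> A j = {}" if "i < j" for i j using that by (auto simp: A_def)
  then have dj: "disjoint_family_on A {..<n}"
    unfolding disjoint_family_on_def by (metis Int_commute linorder_neqE_nat)
  have "xs ! i \<in> K" if "i < n" for i
    using that xs X(1) nth_mem[of i xs] unfolding n_def by blast
  then show ?thesis by (rule that[OF KA dj Ab]) (auto simp: A_def)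
qed

text \<open>Images of the sets of a cover form a cover of the image, and their diameters grow by at most the
  factor \<open>L\<close>. The sets are first cut down to \<open>A\<close>, since \<open>f\<close> is controlled only there.\<close>

lemma hausdorff1_outer_lipschitz_image:
  fixes f :: "'a::metric_space \<Rightarrow> 'b::metric_space"
  assumes L: "0 < L" and lip: "\<And>x y. x \<in> A \<Longrightarrow> y \<in> A \<Longrightarrow> dist (f x) (f y) \<le> L * dist x y"
  shows "hausdorff1_outer (f ` A) \<le> ennreal L * hausdorff1_outer A"
  unfolding hausdorff1_outer_def[of "f ` A"]
proof (rule SUP_least)
  fix \<delta> :: real assume "\<delta> \<in> {0<..}"
  then have d: "0 < \<delta> / L" using L by simp
  have "hausdorff1_pre \<delta> (f ` A) \<le> ennreal L * (\<Sum>i. ennreal (diameter (U i)))"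
    if U: "A \<subseteq> (\<Union>i::nat. U i)" "\<forall>i. bounded (U i) \<and> diameter (U i) \<le> \<delta> / L" for U
  proof -
    have lip': "dist (f x) (f y) \<le> L * diameter (U i)" if "x \<in> U i \<inter> A" "y \<in> U i \<inter> A" for x y i
      using lip[of x y] that U(2) diameter_bounded_bound[of "U i" x y] L
      by (smt (verit) IntD1 IntD2 mult_left_mono)
    have diam: "diameter (f ` (U i \<inter> A)) \<le> L * diameter (U i)" for i
    proof (cases "U i \<inter> A = {}")
      case True
      then show ?thesis using U(2) L diameter_ge_0[of "U i"] by simp
    next
      case False
      then show ?thesis unfolding diameter_def[of "f ` _"]
        using lip' by (auto intro!: cSUP_least)
    qed
    have bdd: "bounded (f ` (U i \<inter> A))" for i
      unfolding bounded_two_points using lip' by blast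
    have "hausdorff1_pre \<delta> (f ` A) \<le> (\<Sum>i. ennreal (diameter (f ` (U i \<inter> A))))"
    proof (rule hausdorff1_pre_leI)
      show "f ` A \<subseteq> (\<Union>i. f ` (U i \<inter> A))" using U(1) by blast
      fix i
      have "L * diameter (U i) \<le> \<delta>" using U(2) L by (simp add: field_simps)
      then show "diameter (f ` (U i \<inter> A)) \<le> \<delta>" using diam[of i] by linarith
    qed (rule bdd)
    also have "\<dots> \<le> (\<Sum>i. ennreal L * ennreal (diameter (U i)))"
      using diam L by (intro suminf_le summableI) (auto simp: ennreal_mult'[symmetric] intro!: ennreal_leI)
    finally show ?thesis by simp
  qed
  then have "hausdorff1_pre \<delta> (f ` A) / ennreal L \<le> hausdorff1_pre (\<delta> / L) A"
    unfolding hausdorff1_pre_def[of _ A] using L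
    by (intro INF_greatest divide_le_posI_ennreal) (auto simp: mult.commute)
  then have "ennreal L * (hausdorff1_pre \<delta> (f ` A) / ennreal L) \<le> ennreal L * hausdorff1_pre (\<delta> / L) A"
    by (rule mult_left_mono) simp
  then have "hausdorff1_pre \<delta> (f ` A) \<le> ennreal L * hausdorff1_pre (\<delta> / L) A"
    using L by (simp add: ennreal_times_divide ennreal_mult_divide_eq mult.commute[of "ennreal L" "hausdorff1_pre \<delta> _"])
  also have "\<dots> \<le> ennreal L * hausdorff1_outer A"
    using d by (intro mult_left_mono hausdorff1_pre_le_outer) auto
  finally show "hausdorff1_pre \<delta> (f ` A) \<le> ennreal L * hausdorff1_outer A" .
qed


lemma hausdorff1_outer_interval_le:
  fixes s t :: real assumes "s \<le> t"
  shows "hausdorff1_outer {s..t} \<le> ennreal (t - s)"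
  unfolding hausdorff1_outer_def
proof (rule SUP_least)
  fix \<delta> :: real assume "\<delta> \<in> {0<..}"
  then have d: "0 < \<delta>" by simp
  obtain N :: nat where N: "(t - s) / \<delta> < N" using reals_Archimedean2 by blast
  have N0: "0 < N" using N assms d by (cases N) (auto simp: divide_less_0_iff)
  define e where "e = (t - s) / N"
  have e: "0 \<le> e" "e \<le> \<delta>" "N * e = t - s"
    using N N0 assms d by (auto simp: e_def field_simps)
  define U where "U i = (if i < N then {s + i * e .. s + (real i + 1) * e} else {})" for i :: nat
  have "hausdorff1_pre \<delta> {s..t} \<le> (\<Sum>i. ennreal (diameter (U i)))"
  proof (rule hausdorff1_pre_leI)
    show "{s..t} \<subseteq> (\<Union>i. U i)"
    proof
      fix x assume x: "x \<in> {s..t}"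
      show "x \<in> (\<Union>i. U i)"
      proof (cases "x = t")
        case True
        have "x \<in> U (N - 1)" using N0 e x True by (auto simp: U_def of_nat_diff algebra_simps)
        then show ?thesis by blast
      next
        case False
        then have st: "x < t" using x by auto
        then have e0: "0 < e" using x N0 by (auto simp: e_def)
        define i where "i = nat \<lfloor>(x - s) / e\<rfloor>"
        have i: "real i \<le> (x - s) / e" "(x - s) / e < real i + 1"
          using x e0 unfolding i_def by (auto simp: of_nat_nat)
        have "(x - s) / e < N" using st e e0 by (auto simp: field_simps)
        then have "i < N" using i by linarith
        then have "x \<in> U i" using i e0 by (auto simp: U_def field_simps)
        then show ?thesis by blast
      qed
    qed
    show "bounded (U i)" for i by (simp add: U_def)
    show "diameter (U i) \<le> \<delta>" for i using e d by (auto simp: U_def algebra_simps)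
  qed
  also have "\<dots> = (\<Sum>i<N. ennreal (diameter (U i)))"
    by (rule suminf_finite) (auto simp: U_def)
  also have "\<dots> = (\<Sum>i<N. ennreal e)"
    using e by (intro sum.cong) (auto simp: U_def algebra_simps)
  also have "\<dots> = ennreal (t - s)"
    using e by (simp add: ennreal_of_nat_eq_real_of_nat ennreal_mult'[symmetric])
  finally show "hausdorff1_pre \<delta> {s..t} \<le> ennreal (t - s)" .
qed

text \<open>A bounded set of reals lies in the interval between its infimum and its supremum, whose length is the diameter
  of the set; so every cover of \<open>{s..t}\<close> has total diameter at least the Lebesgue measure \<open>t - s\<close>.\<close>

lemma hausdorff1_outer_interval_ge:
  fixes s t :: real
  shows "ennreal (t - s) \<le> hausdorff1_outer {s..t}"
proof -
  have "ennreal (t - s) \<le> (\<Sum>i. ennreal (diameter (U i)))"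
    if U: "{s..t} \<subseteq> (\<Union>i::nat. U i)" "\<forall>i. bounded (U i)" for U :: "nat \<Rightarrow> real set"
  proof -
    define V where "V i = (if U i = {} then {} else {Inf (U i)..Sup (U i)})" for i
    have bb: "bdd_above (U i)" "bdd_below (U i)" for i using U(2) by (auto simp: bounded_imp_bdd_above bounded_imp_bdd_below)
    have UV: "U i \<subseteq> V i" for i
      using bb[of i] by (auto simp: V_def intro: cInf_lower cSup_upper)
    have "emeasure lborel (V i) \<le> ennreal (diameter (U i))" for i
    proof (cases "U i = {}")
      case False
      have "Sup (U i) \<le> x + diameter (U i)" if "x \<in> U i" for x
        using False
      proof (rule cSup_least)
        fix y assume "y \<in> U i"
        then show "y \<le> x + diameter (U i)"
          using diameter_bounded_bound[of "U i" y x] that U(2) by (auto simp: dist_real_def)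
      qed
      then have "Sup (U i) - diameter (U i) \<le> Inf (U i)"
        using False by (intro cInf_greatest) (auto simp: algebra_simps)
      moreover have "Inf (U i) \<le> Sup (U i)" using False bb[of i] by (metis cInf_le_cSup)
      ultimately show ?thesis using False by (auto simp: V_def intro!: ennreal_leI)
    qed (simp add: V_def)
    then have "(\<Sum>i. emeasure lborel (V i)) \<le> (\<Sum>i. ennreal (diameter (U i)))"
      by (intro suminf_le summableI)
    moreover have "{s..t} \<subseteq> (\<Union>i. V i)" using U(1) UV by blast
    then have "emeasure lborel {s..t} \<le> emeasure lborel (\<Union>i. V i)"
      by (intro emeasure_mono) (auto simp: V_def)
    moreover have "emeasure lborel (\<Union>i. V i) \<le> (\<Sum>i. emeasure lborel (V i))"
      by (intro emeasure_subadditive_countably) (auto simp: V_def)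
    moreover have "ennreal (t - s) = emeasure lborel {s..t}"
      by (cases "s \<le> t") (auto simp: ennreal_neg)
    ultimately show ?thesis by simp
  qed
  then have "ennreal (t - s) \<le> hausdorff1_pre 1 {s..t}"
    unfolding hausdorff1_pre_def by (intro INF_greatest) auto
  then show ?thesis using hausdorff1_pre_le_outer[of 1] by (meson order_trans zero_less_one)
qed

section \<open>Potentials bound the cost of paths\<close>

lemma hausdorff1_outer_UN_lessThan:
  fixes n :: nat
  shows "hausdorff1_outer (\<Union>i<n. A i) \<le> (\<Sum>i<n. hausdorff1_outer (A i))"
proof (induction n)
  case (Suc n)
  have "hausdorff1_outer (\<Union>i<Suc n. A i) \<le> hausdorff1_outer (\<Union>i<n. A i) + hausdorff1_outer (A n)"
    using hausdorff1_outer_Un[of "\<Union>i<n. A i" "A n"] by (simp add: lessThan_Suc Un_commute)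
  with Suc show ?case by (simp add: add_right_mono order_trans)
qed (simp add: hausdorff1_outer_empty)

lemma hausdorff1_lipschitz_curve:
  fixes \<gamma> :: "real \<Rightarrow> 'a::metric_space"
  assumes L: "0 < L" "s \<le> t" and lip: "\<And>x y. s \<le> x \<Longrightarrow> x \<le> y \<Longrightarrow> y \<le> t \<Longrightarrow> dist (\<gamma> x) (\<gamma> y) \<le> L * (y - x)"
  shows "emeasure hausdorff1 (\<gamma> ` {s..t}) \<le> ennreal (L * (t - s))" "\<gamma> ` {s..t} \<in> sets borel"
proof -
  have lip': "dist (\<gamma> x) (\<gamma> y) \<le> L * dist x y" if "x \<in> {s..t}" "y \<in> {s..t}" for x y
  proof (cases "x \<le> y")
    case True
    then show ?thesis using lip[of x y] that by (simp add: dist_real_def)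
  next
    case False
    then show ?thesis using lip[of y x] that by (simp add: dist_real_def dist_commute)
  qed
  then have "L-lipschitz_on {s..t} \<gamma>" using L by (intro lipschitz_onI) auto
  then have "compact (\<gamma> ` {s..t})"
    by (intro compact_continuous_image lipschitz_on_continuous_on) auto
  then show *: "\<gamma> ` {s..t} \<in> sets borel" by (simp add: borel_compact)
  have "emeasure hausdorff1 (\<gamma> ` {s..t}) \<le> ennreal L * hausdorff1_outer {s..t}"
    unfolding emeasure_hausdorff1[OF *]
    using L lip' by (intro hausdorff1_outer_lipschitz_image) auto
  also have "\<dots> \<le> ennreal L * ennreal (t - s)"
    using L by (intro mult_left_mono hausdorff1_outer_interval_le) auto
  finally show "emeasure hausdorff1 (\<gamma> ` {s..t}) \<le> ennreal (L * (t - s))"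
    using L by (simp add: ennreal_mult'[symmetric])
qed

text \<open>The image of the connected set \<open>\<gamma> ` {0..1}\<close> under \<open>F\<close> contains the whole interval between the two end
  values, so the increment is at most the Hausdorff measure of that image. On a small piece of the curve
  \<open>F\<close> is Lipschitz with constant close to \<open>G\<close>, and the pieces are disjoint in space. Working with the image
  rather than with the parametrisation means that a path may retrace itself: multiplicities cannot
  increase the right-hand side. In the application \<open>G\<close> is the norm of a gradient.\<close>

lemma increment_le_hausdorff1_integral:
  fixes \<gamma> :: "real \<Rightarrow> 'a::euclidean_space" and F G :: "'a \<Rightarrow> real"
  assumes lip: "L-lipschitz_on {0..1} \<gamma>"
    and G [measurable]: "G \<in> borel_measurable borel" and G0: "\<And>x. 0 \<le> G x"
    and loc: "\<And>\<epsilon>. 0 < \<epsilon> \<Longrightarrow> \<exists>\<delta>>0. \<forall>x y. dist x y < \<delta> \<longrightarrow> \<bar>F x - F y\<bar> \<le> (G x + \<epsilon>) * dist x y \<and> \<bar>G x - G y\<bar> \<le> \<epsilon>"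
  shows "ennreal \<bar>F (\<gamma> 1) - F (\<gamma> 0)\<bar> \<le> (\<integral>\<^sup>+z\<in>\<gamma> ` {0..1}. ennreal (G z) \<partial>hausdorff1)"
proof (rule ennreal_le_epsilon)
  fix e :: real assume e: "0 < e"
  define K where "K = \<gamma> ` {0..1}"
  have L0: "0 \<le> L" using lip by (rule lipschitz_on_nonneg)
  have contg: "continuous_on {0..1} \<gamma>" using lip by (rule lipschitz_on_continuous_on)
  then have K: "compact K" unfolding K_def by (intro compact_continuous_image) auto
  then have Kb [measurable]: "K \<in> sets borel" by (rule borel_compact)
  have HK: "emeasure hausdorff1 K \<le> ennreal (L + 1)"
  proof -
    have "dist (\<gamma> x) (\<gamma> y) \<le> (L + 1) * (y - x)" if "0 \<le> x" "x \<le> y" "y \<le> 1" for x y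
      using lipschitz_onD[OF lip, of x y] that by (simp add: dist_real_def algebra_simps)
    then show ?thesis using hausdorff1_lipschitz_curve(1)[of "L + 1" 0 1 \<gamma>] L0 by (simp add: K_def)
  qed
  \<comment> \<open>Each of the three approximation errors below costs \<open>\<epsilon>\<close> per unit of measure, and the curve has measure at most \<open>L + 1\<close>.\<close>
  define \<epsilon> where "\<epsilon> = e / (3 * (L + 1))"
  have eps: "0 < \<epsilon>" "3 * \<epsilon> * (L + 1) = e" using e L0 by (auto simp: \<epsilon>_def field_simps)
  from loc[OF eps(1)] obtain \<delta> where d: "0 < \<delta>"
    and dF: "\<And>x y. dist x y < \<delta> \<Longrightarrow> \<bar>F x - F y\<bar> \<le> (G x + \<epsilon>) * dist x y"
    and dG: "\<And>x y. dist x y < \<delta> \<Longrightarrow> \<bar>G x - G y\<bar> \<le> \<epsilon>" by blast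
  have half: "0 < \<delta> / 2" using d by simp
  obtain n :: nat and A p where KA: "K = (\<Union>i<n. A i)" and disj: "disjoint_family_on A {..<n}"
    and Ab [measurable]: "\<And>i. A i \<in> sets borel" and pd: "\<And>i z. z \<in> A i \<Longrightarrow> dist (p i) z < \<delta> / 2"
    using compact_borel_partition[OF K half] by metis
  have diamA: "dist y z < \<delta>" if "y \<in> A i" "z \<in> A i" for y z i
    using pd[OF that(1)] pd[OF that(2)] by (rule dist_triangle_half_r)
  define M where "M = density hausdorff1 (\<lambda>z. ennreal (G z + 3 * \<epsilon>))"
  have M: "emeasure M B = (\<integral>\<^sup>+z\<in>B. ennreal (G z + 3 * \<epsilon>) \<partial>hausdorff1)" if "B \<in> sets borel" for B
    unfolding M_def using that by (intro emeasure_density) auto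
  have piece: "hausdorff1_outer (F ` A i) \<le> emeasure M (A i)" for i
  proof (cases "A i = {}")
    case False
    then obtain p where p: "p \<in> A i" by blast
    have "hausdorff1_outer (F ` A i) \<le> ennreal (G p + 2 * \<epsilon>) * hausdorff1_outer (A i)"
    proof (rule hausdorff1_outer_lipschitz_image)
      show "0 < G p + 2 * \<epsilon>" using G0[of p] eps by linarith
      fix y z assume yz: "y \<in> A i" "z \<in> A i"
      have "\<bar>F y - F z\<bar> \<le> (G y + \<epsilon>) * dist y z" using dF diamA yz by blast
      also have "\<dots> \<le> (G p + 2 * \<epsilon>) * dist y z"
        using dG[OF diamA[OF yz(1) p]] by (intro mult_right_mono) auto
      finally show "dist (F y) (F z) \<le> (G p + 2 * \<epsilon>) * dist y z" by (simp add: dist_real_def)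
    qed
    also have "\<dots> = (\<integral>\<^sup>+z. ennreal (G p + 2 * \<epsilon>) * indicator (A i) z \<partial>hausdorff1)"
      by (simp add: nn_integral_cmult_indicator emeasure_hausdorff1)
    also have "\<dots> \<le> (\<integral>\<^sup>+z\<in>A i. ennreal (G z + 3 * \<epsilon>) \<partial>hausdorff1)"
    proof (rule nn_integral_mono)
      fix z
      have "G p + 2 * \<epsilon> \<le> G z + 3 * \<epsilon>" if "z \<in> A i"
        using dG[OF diamA[OF that p]] by linarith
      then show "ennreal (G p + 2 * \<epsilon>) * indicator (A i) z \<le> ennreal (G z + 3 * \<epsilon>) * indicator (A i) z"
        by (auto simp: indicator_def intro!: ennreal_leI)
    qed
    finally show ?thesis by (simp add: M)
  qed (simp add: hausdorff1_outer_empty)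
  have "continuous_on UNIV F"
  proof -
    have "\<exists>d>0. \<forall>y. dist y x < d \<longrightarrow> dist (F y) (F x) < r" if r: "0 < r" for x r
    proof (intro exI[of _ "min \<delta> (r / (G x + \<epsilon>))"] conjI allI impI)
      have pos: "0 < G x + \<epsilon>" using G0[of x] eps by linarith
      then show "0 < min \<delta> (r / (G x + \<epsilon>))" using d r by simp
      fix y assume "dist y x < min \<delta> (r / (G x + \<epsilon>))"
      then have "dist x y < \<delta>" "(G x + \<epsilon>) * dist x y < r" using pos by (auto simp: dist_commute field_simps)
      then show "dist (F y) (F x) < r" using dF[of x y] by (simp add: dist_real_def)
    qed
    then show ?thesis by (auto simp: continuous_on_iff)
  qed
  then have "continuous_on {0..1} (\<lambda>t. F (\<gamma> t))"
    using contg by (auto intro: continuous_on_compose2)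
  then have "connected ((\<lambda>t. F (\<gamma> t)) ` {0..1})" by (intro connected_continuous_image) auto
  moreover have "(\<lambda>t. F (\<gamma> t)) ` {0..1} = F ` K" by (auto simp: K_def)
  ultimately have conn: "connected (F ` K)" by simp
  have ends: "F (\<gamma> 0) \<in> F ` K" "F (\<gamma> 1) \<in> F ` K" by (auto simp: K_def)
  define p q where "p = min (F (\<gamma> 0)) (F (\<gamma> 1))" and "q = max (F (\<gamma> 0)) (F (\<gamma> 1))"
  have "{p..q} \<subseteq> F ` K"
    using connected_contains_Icc[OF conn] ends by (auto simp: p_def q_def min_def max_def)
  then have "hausdorff1_outer {p..q} \<le> hausdorff1_outer (F ` K)" by (rule hausdorff1_outer_mono)
  then have "ennreal (q - p) \<le> hausdorff1_outer (F ` K)" using hausdorff1_outer_interval_ge order_trans by blast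
  moreover have "q - p = \<bar>F (\<gamma> 1) - F (\<gamma> 0)\<bar>" by (auto simp: p_def q_def)
  ultimately have "ennreal \<bar>F (\<gamma> 1) - F (\<gamma> 0)\<bar> \<le> hausdorff1_outer (\<Union>i<n. F ` A i)"
    unfolding KA image_UN by simp
  also have "\<dots> \<le> (\<Sum>i<n. hausdorff1_outer (F ` A i))" by (rule hausdorff1_outer_UN_lessThan)
  also have "\<dots> \<le> (\<Sum>i<n. emeasure M (A i))" by (intro sum_mono piece)
  also have "\<dots> = emeasure M (\<Union>i<n. A i)"
    using disj by (intro sum_emeasure) (auto simp: M_def)
  also have "\<dots> = (\<integral>\<^sup>+z\<in>K. ennreal (G z + 3 * \<epsilon>) \<partial>hausdorff1)" using M[OF Kb] KA by simp
  also have "\<dots> = (\<integral>\<^sup>+z. ennreal (G z) * indicator K z + ennreal (3 * \<epsilon>) * indicator K z \<partial>hausdorff1)"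
    using G0 eps by (intro nn_integral_cong) (auto simp: indicator_def)
  also have "\<dots> = (\<integral>\<^sup>+z\<in>K. ennreal (G z) \<partial>hausdorff1) + ennreal (3 * \<epsilon>) * emeasure hausdorff1 K"
    by (subst nn_integral_add) (auto simp: nn_integral_cmult_indicator)
  also have "\<dots> \<le> (\<integral>\<^sup>+z\<in>K. ennreal (G z) \<partial>hausdorff1) + ennreal (3 * \<epsilon>) * ennreal (L + 1)"
    using HK by (intro add_left_mono mult_left_mono) auto
  also have "ennreal (3 * \<epsilon>) * ennreal (L + 1) = ennreal e"
    using eps L0 by (subst ennreal_mult[symmetric]) auto
  finally show "ennreal \<bar>F (\<gamma> 1) - F (\<gamma> 0)\<bar> \<le> (\<integral>\<^sup>+z\<in>\<gamma> ` {0..1}. ennreal (G z) \<partial>hausdorff1) + ennreal e"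
    unfolding K_def .
qed

lemma convex_cube: "convex (cube :: (real ^ 'n) set)"
  unfolding cube_eq_cbox by (rule convex_box)

lemma compact_cube: "compact (cube :: (real ^ 'n) set)"
  unfolding cube_eq_cbox by (rule compact_cbox)

lemma zero_in_cube: "0 \<in> (cube :: (real ^ 'n) set)"
  by (simp add: cube_def)

text \<open>Differentiability is only given in the open cube, so the mean value inequality is applied to the points
  \<open>t x\<close> and \<open>t y\<close> with \<open>t < 1\<close>, which are interior, and \<open>t\<close> tends to \<open>1\<close>.\<close>

lemma C1_cube_local_lipschitz:
  fixes f :: "real ^ 'n \<Rightarrow> real"
  assumes f: "continuous_on cube f" and g: "is_gradient_on_cube f g" and \<epsilon>: "0 < \<epsilon>"
  shows "\<exists>\<delta>>0. \<forall>x\<in>cube. \<forall>y\<in>cube. dist x y < \<delta> \<longrightarrow>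
    \<bar>f x - f y\<bar> \<le> (norm (g x) + \<epsilon>) * dist x y \<and> \<bar>norm (g x) - norm (g y)\<bar> \<le> \<epsilon>"
proof -
  have gc: "continuous_on cube g" and gd: "\<And>x. x \<in> open_cube \<Longrightarrow> GDERIV f x :> g x"
    using g by (auto simp: is_gradient_on_cube_def)
  have "uniformly_continuous_on cube g" by (rule compact_uniformly_continuous[OF gc compact_cube])
  then obtain \<delta> where d: "0 < \<delta>" "\<And>x y. x \<in> cube \<Longrightarrow> y \<in> cube \<Longrightarrow> dist y x < \<delta> \<Longrightarrow> dist (g y) (g x) < \<epsilon>"
    using \<epsilon> unfolding uniformly_continuous_on_def by blast
  have oc: "open_cube \<subseteq> (cube :: (real ^ 'n) set)" by (auto simp: open_cube_def cube_def less_imp_le)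
  have "\<bar>f x - f y\<bar> \<le> (norm (g x) + \<epsilon>) * dist x y" if xy: "x \<in> cube" "y \<in> cube" "dist x y < \<delta>" for x y
  proof -
    define t where "t n = 1 - 1 / (real n + 2)" for n :: nat
    have t: "0 < t n" "t n < 1" for n by (auto simp: t_def field_simps)
    have tlim: "t \<longlonglongrightarrow> 1"
    proof -
      have "(\<lambda>n. 1 - 1 / (real (n + 2))) \<longlonglongrightarrow> 1 - 0"
        by (intro tendsto_diff tendsto_const LIMSEQ_ignore_initial_segment lim_1_over_n)
      moreover have "t = (\<lambda>n. 1 - 1 / (real (n + 2)))" by (auto simp: t_def)
      ultimately show ?thesis by simp
    qed
    have in_oc: "t n *\<^sub>R z \<in> open_cube" if "z \<in> cube" for n z
    proof -
      have "\<bar>t n * z $ i\<bar> < 1" for i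
      proof -
        have "\<bar>z $ i\<bar> \<le> 1" using that unfolding cube_def by (auto intro: abs_leI dest!: spec[of _ i])
        then have "\<bar>t n * z $ i\<bar> \<le> t n * 1" unfolding abs_mult using t[of n] by (intro mult_mono) auto
        with t[of n] show ?thesis by simp
      qed
      then have "- 1 < (t n *\<^sub>R z) $ i \<and> (t n *\<^sub>R z) $ i < 1" for i by (metis abs_less_iff minus_less_iff real_scaleR_def vector_scaleR_component)
      then show ?thesis by (simp add: open_cube_def)
    qed
    have lim: "(\<lambda>n. t n *\<^sub>R z) \<longlonglongrightarrow> z" for z :: "real ^ 'n"
      using tendsto_scaleR[OF tlim tendsto_const[of z]] by simp
    have flim: "(\<lambda>n. f (t n *\<^sub>R z)) \<longlonglongrightarrow> f z" if "z \<in> cube" for z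
    proof (rule continuous_on_tendsto_compose[OF f lim[of z] that])
      show "eventually (\<lambda>n. t n *\<^sub>R z \<in> cube) sequentially"
        using in_oc[OF that] oc by (intro always_eventually) blast
    qed
    define S where "S = open_cube \<inter> ball x \<delta>"
    have S: "convex S" unfolding S_def open_cube_eq_box by (intro convex_Int convex_box convex_ball)
    have lipS: "norm (f u - f v) \<le> (norm (g x) + \<epsilon>) * norm (u - v)" if uv: "u \<in> S" "v \<in> S" for u v
    proof (rule differentiable_bound[OF S _ _ uv(1) uv(2)])
      fix z assume z: "z \<in> S"
      show "(f has_derivative (\<lambda>h. inner h (g z))) (at z within S)"
        using gd[of z] z by (auto simp: S_def gderiv_def intro: has_derivative_at_withinI)
      have "dist (g z) (g x) < \<epsilon>" using d(2)[of x z] z xy(1) oc by (auto simp: S_def dist_commute)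
      then have "norm (g z) \<le> norm (g x) + \<epsilon>"
        using norm_triangle_sub[of "g z" "g x"] by (simp add: dist_norm)
      moreover have "onorm (\<lambda>h. inner h (g z)) \<le> norm (g z)"
      proof (rule onorm_bound)
        show "norm (inner h (g z)) \<le> norm (g z) * norm h" for h
          using Cauchy_Schwarz_ineq2[of h "g z"] by (simp add: mult.commute)
      qed simp
      ultimately show "onorm (\<lambda>h. inner h (g z)) \<le> norm (g x) + \<epsilon>" by linarith
    qed
    have evS: "eventually (\<lambda>n. t n *\<^sub>R z \<in> S) sequentially" if "z \<in> cube" "z \<in> ball x \<delta>" for z
    proof -
      have "eventually (\<lambda>n. t n *\<^sub>R z \<in> ball x \<delta>) sequentially"
        by (rule topological_tendstoD[OF lim open_ball that(2)])
      then show ?thesis using in_oc[OF that(1)] by (simp add: S_def)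
    qed
    have "eventually (\<lambda>n. t n *\<^sub>R x \<in> S \<and> t n *\<^sub>R y \<in> S) sequentially"
      using evS[of x] evS[of y] xy d(1) by (intro eventually_conj) auto
    then have "eventually (\<lambda>n. \<bar>f (t n *\<^sub>R x) - f (t n *\<^sub>R y)\<bar> \<le> (norm (g x) + \<epsilon>) * norm (t n *\<^sub>R x - t n *\<^sub>R y)) sequentially"
      by eventually_elim (use lipS in auto)
    moreover have "(\<lambda>n. \<bar>f (t n *\<^sub>R x) - f (t n *\<^sub>R y)\<bar>) \<longlonglongrightarrow> \<bar>f x - f y\<bar>"
      using flim xy by (intro tendsto_intros) auto
    moreover have "(\<lambda>n. (norm (g x) + \<epsilon>) * norm (t n *\<^sub>R x - t n *\<^sub>R y)) \<longlonglongrightarrow> (norm (g x) + \<epsilon>) * norm (x - y)"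
      by (intro tendsto_intros lim)
    ultimately show ?thesis
      unfolding dist_norm by (intro tendsto_le[OF trivial_limit_sequentially])
  qed
  moreover have "\<bar>norm (g x) - norm (g y)\<bar> \<le> \<epsilon>" if "x \<in> cube" "y \<in> cube" "dist x y < \<delta>" for x y
    using d(2)[OF that(2,1,3)] norm_triangle_ineq3[of "g x" "g y"] by (simp add: dist_norm)
  ultimately show ?thesis using d(1) by blast
qed

lemma lower_semicontinuous_borel_measurable:
  fixes f :: "'a::euclidean_space \<Rightarrow> ennreal"
  assumes "lower_semicontinuous_on UNIV f"
  shows "f \<in> borel_measurable borel"
proof (rule borel_measurableI_greater)
  fix y
  have "open {x. y < f x}"
    unfolding open_subopen[of "{x. y < f x}"]
  proof clarify
    fix x assume "y < f x"
    then have "eventually (\<lambda>z. y < f z) (at x)"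
      using assms by (auto simp: lower_semicontinuous_on_def)
    with \<open>y < f x\<close> have "eventually (\<lambda>z. y < f z) (nhds x)"
      by (simp add: eventually_nhds_conv_at)
    then show "\<exists>T. open T \<and> x \<in> T \<and> T \<subseteq> {x. y < f x}"
      by (auto simp: eventually_nhds)
  qed
  then show "{x \<in> space borel. y < f x} \<in> sets borel" by simp
qed

lemma urban_cost_eq_friction_integral:
  assumes S: "S \<in> sets borel" and f: "friction S a b \<in> borel_measurable borel" and K: "K \<in> sets borel"
  shows "(\<integral>\<^sup>+z\<in>K \<inter> S. ennreal (b z) \<partial>hausdorff1) + a * emeasure hausdorff1 (K - S) =
    (\<integral>\<^sup>+z\<in>K. friction S a b z \<partial>hausdorff1)"
proof -
  have "(\<integral>\<^sup>+z\<in>K. friction S a b z \<partial>hausdorff1) =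
     (\<integral>\<^sup>+z. friction S a b z * indicator (K \<inter> S) z + a * indicator (K - S) z \<partial>hausdorff1)"
    by (intro nn_integral_cong) (auto simp: friction_def indicator_def)
  also have "\<dots> = (\<integral>\<^sup>+z. friction S a b z * indicator (K \<inter> S) z \<partial>hausdorff1) + (\<integral>\<^sup>+z. a * indicator (K - S) z \<partial>hausdorff1)"
    using assms by (intro nn_integral_add) (auto intro!: borel_measurable_times)
  also have "(\<integral>\<^sup>+z. a * indicator (K - S) z \<partial>hausdorff1) = a * emeasure hausdorff1 (K - S)"
    using assms by (intro nn_integral_cmult_indicator) auto
  also have "(\<integral>\<^sup>+z. friction S a b z * indicator (K \<inter> S) z \<partial>hausdorff1) = (\<integral>\<^sup>+z\<in>K \<inter> S. ennreal (b z) \<partial>hausdorff1)"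
    by (intro nn_integral_cong) (auto simp: friction_def indicator_def)
  finally show ?thesis by simp
qed

text \<open>A competing path may leave the cube, where \<open>\<phi>\<close> says nothing. Hence \<open>\<phi>\<close> and its gradient are composed with the
  nearest-point projection \<open>P\<close>, which is a contraction. The gradient bound survives: outside the cube the
  friction is \<open>a\<close>, and at \<open>P z\<close> it is at most \<open>a\<close> whether or not \<open>P z\<close> lies in the city.\<close>

lemma increment_le_urban_metric:
  fixes \<phi> :: "real ^ 'n \<Rightarrow> real"
  assumes S: "S \<in> sets borel" "S \<subseteq> cube" "\<And>x. x \<in> S \<Longrightarrow> ennreal (b x) \<le> a"
    and fm: "friction S a b \<in> borel_measurable borel"
    and \<phi>: "\<phi> \<in> C1_cube" "\<And>x. x \<in> S \<Longrightarrow> norm (cube_gradient \<phi> x) \<le> b x"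
      "\<And>x. x \<in> cube - S \<Longrightarrow> ennreal (norm (cube_gradient \<phi> x)) \<le> a"
    and xy: "x \<in> cube" "y \<in> cube"
  shows "ennreal (\<phi> x - \<phi> y) \<le> urban_metric S a b x y"
  unfolding urban_metric_def
proof (rule INF_greatest)
  fix \<gamma> assume "\<gamma> \<in> lipschitz_paths x y"
  then obtain L where lip: "L-lipschitz_on {0..1} \<gamma>" and ends: "\<gamma> 0 = x" "\<gamma> 1 = y"
    by (auto simp: lipschitz_paths_def)
  obtain g where g: "is_gradient_on_cube \<phi> g" and cont: "continuous_on cube \<phi>"
    using \<phi>(1) by (auto simp: C1_cube_def)
  define P where "P = closest_point (cube :: (real ^ 'n) set)"
  have cl: "closed (cube :: (real ^ 'n) set)" "(cube :: (real ^ 'n) set) \<noteq> {}"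
    using compact_cube zero_in_cube compact_imp_closed by auto
  have Pin: "P z \<in> cube" for z unfolding P_def using cl by (rule closest_point_in_set)
  have Plip: "dist (P z) (P w) \<le> dist z w" for z w
    unfolding P_def using closest_point_lipschitz[OF convex_cube cl] .
  have Pid: "P z = z" if "z \<in> cube" for z unfolding P_def using that by (rule closest_point_self)
  define F G where "F z = \<phi> (P z)" and "G z = norm (g (P z))" for z
  have K: "\<gamma> ` {0..1} \<in> sets borel"
    using lip by (intro borel_compact compact_continuous_image lipschitz_on_continuous_on) auto
  have "continuous_on UNIV P" unfolding P_def by (rule continuous_on_closest_point[OF convex_cube cl])
  moreover have "continuous_on cube g" using g by (simp add: is_gradient_on_cube_def)
  moreover have "range P \<subseteq> cube" using Pin by blast
  ultimately have "continuous_on UNIV (\<lambda>z. g (P z))" by (metis continuous_on_compose2)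
  then have "continuous_on UNIV G" unfolding G_def by (rule continuous_on_norm)
  then have Gm: "G \<in> borel_measurable borel" by (rule borel_measurable_continuous_onI)
  have "ennreal \<bar>F (\<gamma> 1) - F (\<gamma> 0)\<bar> \<le> (\<integral>\<^sup>+z\<in>\<gamma> ` {0..1}. ennreal (G z) \<partial>hausdorff1)"
  proof (rule increment_le_hausdorff1_integral[OF lip Gm])
    show "0 \<le> G z" for z by (simp add: G_def)
    fix \<epsilon> :: real assume "0 < \<epsilon>"
    from C1_cube_local_lipschitz[OF cont g this] obtain \<delta> where d: "0 < \<delta>"
      and dd: "\<And>x y. x \<in> cube \<Longrightarrow> y \<in> cube \<Longrightarrow> dist x y < \<delta> \<Longrightarrow>
        \<bar>\<phi> x - \<phi> y\<bar> \<le> (norm (g x) + \<epsilon>) * dist x y \<and> \<bar>norm (g x) - norm (g y)\<bar> \<le> \<epsilon>" by blast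
    have "\<bar>F z - F w\<bar> \<le> (G z + \<epsilon>) * dist z w \<and> \<bar>G z - G w\<bar> \<le> \<epsilon>" if "dist z w < \<delta>" for z w
    proof -
      have "dist (P z) (P w) < \<delta>" using Plip[of z w] that by linarith
      note * = dd[OF Pin Pin this]
      have "(norm (g (P z)) + \<epsilon>) * dist (P z) (P w) \<le> (norm (g (P z)) + \<epsilon>) * dist z w"
        using Plip \<open>0 < \<epsilon>\<close> by (intro mult_left_mono) auto
      with * show ?thesis by (auto simp: F_def G_def)
    qed
    with d show "\<exists>\<delta>>0. \<forall>z w. dist z w < \<delta> \<longrightarrow> \<bar>F z - F w\<bar> \<le> (G z + \<epsilon>) * dist z w \<and> \<bar>G z - G w\<bar> \<le> \<epsilon>"
      by blast
  qed
  also have "\<dots> \<le> (\<integral>\<^sup>+z\<in>\<gamma> ` {0..1}. friction S a b z \<partial>hausdorff1)"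
  proof (intro nn_integral_mono mult_right_mono)
    fix z
    have geq: "cube_gradient \<phi> (P z) = g (P z)" by (rule cube_gradient_eq[OF g Pin])
    show "ennreal (G z) \<le> friction S a b z"
    proof (cases "z \<in> S")
      case True
      then show ?thesis using \<phi>(2)[of z] Pid[of z] S(2) geq by (auto simp: G_def friction_def intro!: ennreal_leI)
    next
      case False
      have "ennreal (norm (g (P z))) \<le> a"
      proof (cases "P z \<in> S")
        case True
        then show ?thesis using \<phi>(2)[OF True] S(3)[OF True] geq by (metis ennreal_leI order_trans)
      next
        case False
        then show ?thesis using \<phi>(3)[of "P z"] Pin[of z] geq by simp
      qed
      then show ?thesis using False by (simp add: G_def friction_def)
    qed
  qed simp
  also have "\<dots> = (\<integral>\<^sup>+z\<in>\<gamma> ` {0..1} \<inter> S. ennreal (b z) \<partial>hausdorff1) + a * emeasure hausdorff1 (\<gamma> ` {0..1} - S)"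
    by (rule urban_cost_eq_friction_integral[OF S(1) fm K, symmetric])
  finally have *: "ennreal \<bar>F (\<gamma> 1) - F (\<gamma> 0)\<bar> \<le> \<dots>" .
  have "ennreal (\<phi> x - \<phi> y) \<le> ennreal \<bar>F (\<gamma> 1) - F (\<gamma> 0)\<bar>"
    using ends xy Pid by (intro ennreal_leI) (auto simp: F_def)
  with * show "ennreal (\<phi> x - \<phi> y) \<le> (\<integral>\<^sup>+z\<in>\<gamma> ` {0..1} \<inter> S. ennreal (b z) \<partial>hausdorff1) + a * emeasure hausdorff1 (\<gamma> ` {0..1} - S)"
    by (rule order_trans[rotated])
qed

section \<open>Lipschitz approximation of the friction from below\<close>

text \<open>The Pasch-Hausdorff envelope of the truncation of \<open>f\<close> at height \<open>k + 1\<close>, with slope \<open>k + 1\<close>. Truncation makes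
  it real-valued even where \<open>f\<close> is infinite.\<close>

definition lipschitz_envelope :: "('a::metric_space \<Rightarrow> ennreal) \<Rightarrow> nat \<Rightarrow> 'a \<Rightarrow> real" where
  "lipschitz_envelope f k x = (INF y. enn2real (min (f y) (of_nat (Suc k))) + real (Suc k) * dist x y)"

lemma enn2real_min_of_nat:
  "ennreal (enn2real (min a (of_nat (Suc k)))) = min a (of_nat (Suc k))"
proof -
  have "min a (of_nat (Suc k)) < top" by (metis min.strict_coboundedI2 of_nat_less_top)
  then show ?thesis by simp
qed

lemma lipschitz_envelope_lower: "lipschitz_envelope f k x \<le> enn2real (min (f y) (of_nat (Suc k))) + real (Suc k) * dist x y"
  unfolding lipschitz_envelope_def by (intro cINF_lower bdd_belowI[of _ 0]) auto

lemma lipschitz_envelope_greatest: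
  "(\<And>y. m \<le> enn2real (min (f y) (of_nat (Suc k))) + real (Suc k) * dist x y) \<Longrightarrow> m \<le> lipschitz_envelope f k x"
  unfolding lipschitz_envelope_def by (intro cINF_greatest) auto

lemma lipschitz_envelope_le_self: "ennreal (lipschitz_envelope f k x) \<le> f x"
proof -
  have "ennreal (lipschitz_envelope f k x) \<le> ennreal (enn2real (min (f x) (of_nat (Suc k))))"
    using lipschitz_envelope_lower[of f k x x] by (intro ennreal_leI) simp
  then show ?thesis unfolding enn2real_min_of_nat by simp
qed

lemma lipschitz_envelope_le_Suc: "lipschitz_envelope f k x \<le> real (Suc k)"
proof -
  have "ennreal (enn2real (min (f x) (of_nat (Suc k)))) \<le> ennreal (real (Suc k))"
    unfolding enn2real_min_of_nat by (simp add: ennreal_of_nat_eq_real_of_nat del: of_nat_Suc)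
  then have "enn2real (min (f x) (of_nat (Suc k))) \<le> real (Suc k)" by (simp del: of_nat_Suc)
  then show ?thesis using lipschitz_envelope_lower[of f k x x] by simp
qed

lemma lipschitz_envelope_lipschitz: "\<bar>lipschitz_envelope f k x - lipschitz_envelope f k y\<bar> \<le> real (Suc k) * dist x y"
proof -
  have *: "lipschitz_envelope f k x - real (Suc k) * dist x y \<le> lipschitz_envelope f k y" for x y
  proof (rule lipschitz_envelope_greatest)
    fix z
    have "real (Suc k) * dist x z \<le> real (Suc k) * (dist x y + dist y z)"
      by (intro mult_left_mono dist_triangle) auto
    then show "lipschitz_envelope f k x - real (Suc k) * dist x y \<le> enn2real (min (f z) (of_nat (Suc k))) + real (Suc k) * dist y z"
      using lipschitz_envelope_lower[of f k x z] by (simp only: distrib_left)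
  qed
  show ?thesis using *[of x y] *[of y x] by (simp add: dist_commute del: of_nat_Suc)
qed

lemma lipschitz_envelope_ge:
  assumes "\<And>y. ennreal c \<le> f y" "0 \<le> c" "c \<le> 1"
  shows "c \<le> lipschitz_envelope f k x"
proof (rule lipschitz_envelope_greatest)
  fix y
  have "ennreal c \<le> of_nat (Suc k)"
    using assms by (simp add: ennreal_of_nat_eq_real_of_nat del: of_nat_Suc) 
  then have "ennreal c \<le> ennreal (enn2real (min (f y) (of_nat (Suc k))))"
    unfolding enn2real_min_of_nat using assms(1)[of y] by simp
  then have "c \<le> enn2real (min (f y) (of_nat (Suc k)))" by simp
  then show "c \<le> enn2real (min (f y) (of_nat (Suc k))) + real (Suc k) * dist x y"
    by (simp add: add_increasing2 del: of_nat_Suc)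
qed

lemma lipschitz_envelope_mono:
  assumes "j \<le> k" shows "lipschitz_envelope f j x \<le> lipschitz_envelope f k x"
proof (rule lipschitz_envelope_greatest)
  fix y
  have "ennreal (enn2real (min (f y) (of_nat (Suc j)))) \<le> ennreal (enn2real (min (f y) (of_nat (Suc k))))"
    unfolding enn2real_min_of_nat using assms by (intro min.mono) (auto simp del: of_nat_Suc)
  then have "enn2real (min (f y) (of_nat (Suc j))) \<le> enn2real (min (f y) (of_nat (Suc k)))" by simp
  moreover have "real (Suc j) * dist x y \<le> real (Suc k) * dist x y"
    using assms by (intro mult_right_mono) auto
  ultimately show "lipschitz_envelope f j x \<le> enn2real (min (f y) (of_nat (Suc k))) + real (Suc k) * dist x y"
    using lipschitz_envelope_lower[of f j x y] by linarith
qed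

text \<open>Near \<open>x\<close>, lower semicontinuity keeps \<open>f\<close> above any level below \<open>f x\<close>; far from \<open>x\<close> the term
  \<open>(k + 1) * dist x y\<close> exceeds that level once \<open>k\<close> is large.\<close>

lemma SUP_lipschitz_envelope:
  fixes f :: "'a::metric_space \<Rightarrow> ennreal"
  assumes lsc: "lower_semicontinuous_on UNIV f"
  shows "(SUP k. ennreal (lipschitz_envelope f k x)) = f x"
proof (rule antisym)
  show "(SUP k. ennreal (lipschitz_envelope f k x)) \<le> f x" by (intro SUP_least lipschitz_envelope_le_self)
  show "f x \<le> (SUP k. ennreal (lipschitz_envelope f k x))"
  proof (rule dense_le)
    fix t assume t: "t < f x"
    obtain s' where s': "t < s'" "s' < f x" using dense[OF t] by blast
    define s where "s = enn2real s'"
    have s: "s' = ennreal s" "0 \<le> s"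
      using s' by (auto simp: s_def less_top[symmetric] top_unique dest: less_le_trans[OF _ top_greatest])
    have "eventually (\<lambda>y. s' < f y) (at x)"
      using lsc s'(2) by (auto simp: lower_semicontinuous_on_def)
    then obtain \<delta> where d: "0 < \<delta>" "\<And>y. y \<noteq> x \<Longrightarrow> dist y x < \<delta> \<Longrightarrow> s' < f y"
      by (auto simp: eventually_at)
    obtain k :: nat where k: "s + s / \<delta> < k" using reals_Archimedean2 by blast
    have "0 \<le> s / \<delta>" using s(2) d(1) by simp
    then have ks: "s \<le> real (Suc k)" "s / \<delta> \<le> real (Suc k)" using k s(2) by simp_all
    have "s \<le> lipschitz_envelope f k x"
    proof (rule lipschitz_envelope_greatest)
      fix y
      show "s \<le> enn2real (min (f y) (of_nat (Suc k))) + real (Suc k) * dist x y"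
      proof (cases "dist y x < \<delta>")
        case True
        then have "ennreal s \<le> f y" using d(2)[of y] s'(2) s by (cases "y = x") auto
        moreover have "ennreal s \<le> of_nat (Suc k)" using ks(1)
          unfolding ennreal_of_nat_eq_real_of_nat by (rule ennreal_leI)
        ultimately have "ennreal s \<le> ennreal (enn2real (min (f y) (of_nat (Suc k))))"
          unfolding enn2real_min_of_nat by simp
        then have "s \<le> enn2real (min (f y) (of_nat (Suc k)))" by simp
        then show ?thesis by (simp add: add_increasing2 del: of_nat_Suc)
      next
        case False
        have "s = s / \<delta> * \<delta>" using d(1) by simp
        also have "\<dots> \<le> real (Suc k) * dist x y"
          using ks(2) False d(1) s(2) by (intro mult_mono) (auto simp: dist_commute)
        finally show ?thesis by (simp add: add_increasing del: of_nat_Suc)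
      qed
    qed
    then have "ennreal s \<le> ennreal (lipschitz_envelope f k x)" by (rule ennreal_leI)
    also have "\<dots> \<le> (SUP k. ennreal (lipschitz_envelope f k x))" by (rule SUP_upper) simp
    finally show "t \<le> (SUP k. ennreal (lipschitz_envelope f k x))" using s' s by auto
  qed
qed

section \<open>Chain distances\<close>

text \<open>Chains of small jumps replace paths: they need no parametrisation and their costs are finite sums. A jump
  costs its length times the weight at its starting point; the last argument is the total cost.\<close>

inductive chain :: "('a::metric_space \<Rightarrow> real) \<Rightarrow> real \<Rightarrow> 'a \<Rightarrow> 'a \<Rightarrow> real \<Rightarrow> bool" for c h where
  chain_refl: "chain c h x x 0"
| chain_step: "chain c h x y T \<Longrightarrow> dist y z \<le> h \<Longrightarrow> chain c h x z (T + c y * dist y z)"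

text \<open>Not symmetric in general, because a jump is weighted at its start.\<close>

definition chain_dist :: "('a::metric_space \<Rightarrow> real) \<Rightarrow> real \<Rightarrow> 'a \<Rightarrow> 'a \<Rightarrow> real" where
  "chain_dist c h x y = Inf {T. chain c h x y T}"

lemma chain_trans: "chain c h y z U \<Longrightarrow> chain c h x y T \<Longrightarrow> chain c h x z (T + U)"
proof (induction rule: chain.induct)
  case (chain_step x' y' T' z')
  then show ?case using chain.chain_step[of c h x y' "T + T'" z'] by (simp add: add.assoc)
qed simp

lemma chain_mono:
  assumes "\<And>x. c x \<le> c' x" "h' \<le> h"
  shows "chain c' h' x y T \<Longrightarrow> \<exists>T'\<le>T. chain c h x y T'"
proof (induction rule: chain.induct)
  case (chain_step x y T z)
  then obtain T' where T': "T' \<le> T" "chain c h x y T'" by blast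
  have "c y * dist y z \<le> c' y * dist y z" using assms(1) by (intro mult_right_mono) auto
  then show ?case
    using chain.chain_step[OF T'(2), of z] T'(1) chain_step.hyps assms(2) by (meson add_mono order_trans)
qed (auto intro: chain_refl)

locale chain_cost =
  fixes c :: "'a::real_normed_vector \<Rightarrow> real" and h c0 B L :: real
  assumes h: "0 < h" and c0: "0 < c0" and c_ge: "\<And>x. c0 \<le> c x" and c_le: "\<And>x. c x \<le> B"
    and L: "0 \<le> L" and c_lip: "\<And>x y. \<bar>c x - c y\<bar> \<le> L * dist x y"
begin

lemma B_pos: "0 < B" using c0 c_ge[of 0] c_le[of 0] by linarith

lemma chain_ge: "chain c h x y T \<Longrightarrow> c0 * dist x y \<le> T"
proof (induction rule: chain.induct)
  case (chain_step x y T z)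
  have "c0 * dist x z \<le> c0 * dist x y + c0 * dist y z"
    using c0 by (simp add: distrib_left[symmetric] dist_triangle)
  also have "c0 * dist y z \<le> c y * dist y z" by (intro mult_right_mono c_ge) auto
  finally show ?case using chain_step.IH by linarith
qed simp

lemma chain_nonneg: "chain c h x y T \<Longrightarrow> 0 \<le> T"
  using chain_ge[of x y T] c0 by (meson order_trans zero_le_dist zero_le_mult_iff less_imp_le)

text \<open>Walking along the straight segment in equal jumps gives a chain.\<close>

lemma chain_exists: "\<exists>T. chain c h x y T \<and> T \<le> B * dist x y"
proof -
  obtain n :: nat where n: "dist x y / h < n" using reals_Archimedean2 by blast
  then have n0: "0 < n" using h by (cases n) (auto simp: divide_less_0_iff not_less[symmetric])
  define p where "p i = x + (real i / n) *\<^sub>R (y - x)" for i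
  have pd: "dist (p i) (p (Suc i)) = dist x y / n" for i
  proof -
    have "p (Suc i) - p i = (1 / n) *\<^sub>R (y - x)"
      by (simp add: p_def scaleR_diff_left[symmetric] diff_divide_distrib[symmetric])
    then have "norm (p (Suc i) - p i) = norm (y - x) / n" by simp
    then show ?thesis by (simp add: dist_norm norm_minus_commute)
  qed
  have "dist x y / n \<le> h" using n n0 h by (simp add: field_simps)
  have "\<exists>T. chain c h x (p i) T \<and> T \<le> B * (i * (dist x y / n))" for i
  proof (induction i)
    case 0
    then show ?case using chain_refl[of c h x] by (intro exI[of _ 0]) (simp add: p_def)
  next
    case (Suc i)
    then obtain T where T: "chain c h x (p i) T" "T \<le> B * (i * (dist x y / n))" by blast
    have "chain c h x (p (Suc i)) (T + c (p i) * dist (p i) (p (Suc i)))"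
      using pd[of i] \<open>dist x y / n \<le> h\<close> by (intro chain_step T) simp
    moreover have "c (p i) * dist (p i) (p (Suc i)) \<le> B * (dist x y / n)"
      unfolding pd by (intro mult_right_mono c_le) auto
    moreover have "B * (real (Suc i) * (dist x y / n)) = B * (i * (dist x y / n)) + B * (dist x y / n)"
      by (simp add: algebra_simps add_divide_distrib)
    ultimately show ?case using T(2) by (intro exI conjI) auto
  qed
  from this[of n] show ?thesis using n0 by (simp add: p_def)
qed

lemma chain_dist_le: "chain c h x y T \<Longrightarrow> chain_dist c h x y \<le> T"
  unfolding chain_dist_def by (intro cInf_lower bdd_belowI[of _ 0]) (auto intro: chain_nonneg)

lemma chain_dist_greatest: "(\<And>T. chain c h x y T \<Longrightarrow> m \<le> T) \<Longrightarrow> m \<le> chain_dist c h x y"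
  unfolding chain_dist_def using chain_exists[of x y] by (intro cInf_greatest) auto

lemma chain_dist_lessE:
  assumes "chain_dist c h x y < M" obtains T where "chain c h x y T" "T < M"
  using chain_dist_greatest[of x y M] assms by (meson not_le)

lemma chain_dist_ge: "c0 * dist x y \<le> chain_dist c h x y"
  by (intro chain_dist_greatest chain_ge)

lemma chain_dist_nonneg: "0 \<le> chain_dist c h x y"
  by (intro chain_dist_greatest chain_nonneg)

lemma chain_dist_le_dist: "chain_dist c h x y \<le> B * dist x y"
  using chain_exists[of x y] chain_dist_le by force

text \<open>The reason for admitting jumps up to length \<open>h\<close>: a function that is 1-Lipschitz for the chain distance has
  slope at most \<open>c\<close> locally, without any limit.\<close>

lemma chain_dist_le_local:
  assumes "dist x y \<le> h" shows "chain_dist c h x y \<le> c x * dist x y"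
  using chain_dist_le[OF chain_step[OF chain_refl assms]] by simp

lemma chain_dist_triangle: "chain_dist c h x z \<le> chain_dist c h x y + chain_dist c h y z"
proof (rule field_le_epsilon)
  fix e :: real assume "0 < e"
  then have lt: "chain_dist c h x y < chain_dist c h x y + e / 2" "chain_dist c h y z < chain_dist c h y z + e / 2" by auto
  from chain_dist_lessE[OF lt(1)] obtain T where T: "chain c h x y T" "T < chain_dist c h x y + e / 2" .
  from chain_dist_lessE[OF lt(2)] obtain U where U: "chain c h y z U" "U < chain_dist c h y z + e / 2" .
  have "chain_dist c h x z \<le> T + U" using chain_trans[OF U(1) T(1)] by (rule chain_dist_le)
  then show "chain_dist c h x z \<le> chain_dist c h x y + chain_dist c h y z + e" using T U by linarith
qed

lemma chain_dist_lipschitz: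
  "\<bar>chain_dist c h x y - chain_dist c h x' y'\<bar> \<le> B * (dist x x' + dist y y')"
proof -
  have *: "chain_dist c h x y \<le> chain_dist c h x' y' + B * (dist x x' + dist y y')" for x y x' y'
    using chain_dist_triangle[of x y x'] chain_dist_triangle[of x' y y']
      chain_dist_le_dist[of x x'] chain_dist_le_dist[of y' y] by (simp add: distrib_left dist_commute)
  show ?thesis using *[of x y x' y'] *[of x' y' x y] by (simp add: dist_commute)
qed

text \<open>A chain of cost at most \<open>M\<close> stays within distance \<open>M / c0\<close> of its start, where \<open>c\<close> has dropped by at most
  \<open>L * M / c0\<close>. The bound \<open>M\<close> is kept fixed while the chain grows, which lets the induction go through.\<close>

lemma chain_lower_bound: "chain c h x y T \<Longrightarrow> T \<le> M \<Longrightarrow> (c x - L / c0 * M) * dist x y \<le> T"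
proof (induction rule: chain.induct)
  case (chain_step x y T z)
  have nn: "0 \<le> c y * dist y z" using c_ge[of y] c0 by simp
  have IH: "(c x - L / c0 * M) * dist x y \<le> T" using chain_step nn by simp
  have T0: "0 \<le> T" by (rule chain_nonneg[OF chain_step.hyps(1)])
  show ?case
  proof (cases "0 \<le> c x - L / c0 * M")
    case True
    have "c x - L * dist x y \<le> c y" using c_lip[of x y] by linarith
    moreover have "L * dist x y \<le> L / c0 * M"
    proof -
      have "c0 * dist x y \<le> M" using chain_ge[OF chain_step.hyps(1)] chain_step.prems nn by linarith
      then have "dist x y \<le> M / c0" using c0 by (simp add: field_simps)
      then show ?thesis using mult_left_mono[OF _ L] by fastforce
    qed
    ultimately have "c x - L / c0 * M \<le> c y" by linarith
    then have "(c x - L / c0 * M) * dist y z \<le> c y * dist y z" by (intro mult_right_mono) auto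
    moreover have "(c x - L / c0 * M) * dist x z \<le> (c x - L / c0 * M) * (dist x y + dist y z)"
      using True by (intro mult_left_mono dist_triangle) auto
    ultimately show ?thesis using IH by (simp add: distrib_left)
  next
    case False
    then have "(c x - L / c0 * M) * dist x z \<le> 0" by (intro mult_nonpos_nonneg) auto
    then show ?thesis using T0 nn by linarith
  qed
qed simp

lemma chain_dist_lower_bound:
  assumes "chain_dist c h x y \<le> M"
  shows "(c x - L / c0 * M) * dist x y \<le> M"
proof -
  have ev: "(c x - L / c0 * (M + e)) * dist x y \<le> M + e" if "0 < e" for e
  proof -
    have lt: "chain_dist c h x y < M + e" using assms that by simp
    from chain_dist_lessE[OF lt] obtain T where T: "chain c h x y T" "T < M + e" .
    then show ?thesis using chain_lower_bound[OF T(1), of "M + e"] by simp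
  qed
  have "((\<lambda>e. (c x - L / c0 * (M + e)) * dist x y) \<longlongrightarrow> (c x - L / c0 * (M + 0)) * dist x y) (at_right 0)"
    "((\<lambda>e. M + e) \<longlongrightarrow> M + 0) (at_right 0)"
    by (intro tendsto_intros)+
  moreover have "eventually (\<lambda>e. (c x - L / c0 * (M + e)) * dist x y \<le> M + e) (at_right 0)"
    using ev by (auto simp: eventually_at_right_less intro: eventually_mono[OF eventually_at_right_less])
  ultimately show ?thesis using tendsto_le[of "at_right (0::real)"] by fastforce
qed

text \<open>Stop at the last point that is reached at cost at most \<open>\<tau>\<close>. The next jump overshoots by at most its own cost,
  which is at most \<open>B * h\<close>.\<close>

lemma chain_split:
  assumes "0 \<le> \<tau>"
  shows "chain c h x y T \<Longrightarrow> \<exists>m T1 T2. chain c h x m T1 \<and> T1 \<le> \<tau> \<and> chain c h m y T2 \<and> T2 \<le> max 0 (T - \<tau>) + B * h"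
proof (induction rule: chain.induct)
  case (chain_refl x)
  have "0 \<le> B * h" using B_pos h by simp
  then show ?case using assms chain.chain_refl[of c h x] by (intro exI[of _ x] exI[of _ 0]) auto
next
  case (chain_step x y T z)
  have st: "0 \<le> c y * dist y z" using c_ge[of y] c0 by simp
  show ?case
  proof (cases "T \<le> \<tau>")
    case True
    have "chain c h y z (0 + c y * dist y z)" by (rule chain.chain_step[OF chain_refl chain_step.hyps(2)])
    moreover have "c y * dist y z \<le> B * h"
      using c_le[of y] c_ge[of y] c0 chain_step.hyps(2) B_pos by (intro mult_mono) auto
    ultimately show ?thesis using True chain_step.hyps(1) by (intro exI[of _ y] exI[of _ T] exI[of _ "c y * dist y z"]) auto
  next
    case False
    from chain_step.IH obtain m T1 T2 where m: "chain c h x m T1" "T1 \<le> \<tau>" "chain c h m y T2" "T2 \<le> max 0 (T - \<tau>) + B * h"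
      by blast
    have "chain c h m z (T2 + c y * dist y z)" by (rule chain.chain_step[OF m(3) chain_step.hyps(2)])
    with m st False show ?thesis by (intro exI[of _ m] exI[of _ T1] exI[of _ "T2 + c y * dist y z"]) auto
  qed
qed

lemma chain_dist_midpoint:
  assumes "chain_dist c h x y \<le> D" "0 < e"
  shows "\<exists>m. chain_dist c h x m \<le> D / 2 \<and> chain_dist c h m y \<le> D / 2 + e + B * h"
proof -
  have lt: "chain_dist c h x y < D + e" using assms by simp
  from chain_dist_lessE[OF lt] obtain T where T: "chain c h x y T" "T < D + e" .
  have D: "0 \<le> D / 2" using assms(1) chain_dist_nonneg[of x y] by simp
  obtain m T1 T2 where m: "chain c h x m T1" "T1 \<le> D / 2" "chain c h m y T2" "T2 \<le> max 0 (T - D / 2) + B * h"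
    using chain_split[OF D T(1)] by blast
  show ?thesis
    using chain_dist_le[OF m(1)] chain_dist_le[OF m(3)] m(2,4) T(2) D assms(2) by (intro exI[of _ m]) auto
qed

end

text \<open>Refining the jumps and increasing the weight can only increase the distance. So the distances for
  \<open>c k\<close> and \<open>h k\<close> increase with \<open>k\<close>.\<close>

lemma chain_dist_mono:
  assumes "chain_cost c h c0 B L" "chain_cost c' h' c0' B' L'" "\<And>x. c x \<le> c' x" "h' \<le> h"
  shows "chain_dist c h x y \<le> chain_dist c' h' x y"
proof -
  interpret A: chain_cost c h c0 B L by fact
  interpret B: chain_cost c' h' c0' B' L' by fact
  show ?thesis
  proof (rule B.chain_dist_greatest)
    fix T assume "chain c' h' x y T"
    from chain_mono[OF assms(3,4) this] obtain T' where "T' \<le> T" "chain c h x y T'" by blast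
    then show "chain_dist c h x y \<le> T" using A.chain_dist_le[of x y T'] by linarith
  qed
qed

section \<open>Geodesics of the limiting chain distance\<close>

text \<open>Approximate midpoints for the single distances lie in a fixed ball. A limit point of them is an exact
  midpoint for every \<open>d j\<close> at once: \<open>d j \<le> d k\<close> transfers the estimate from index \<open>k\<close>, and \<open>d j\<close> is continuous.\<close>

lemma midpoint_of_limit:
  fixes d :: "nat \<Rightarrow> 'a::euclidean_space \<Rightarrow> 'a \<Rightarrow> real"
  assumes c0: "0 < c0" "\<And>k x y. c0 * dist x y \<le> d k x y"
    and cont: "\<And>k x y x' y'. \<bar>d k x y - d k x' y'\<bar> \<le> B k * (dist x x' + dist y y')"
    and mono: "\<And>j k x y. j \<le> k \<Longrightarrow> d j x y \<le> d k x y"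
    and mid: "\<And>k x y D. d k x y \<le> D \<Longrightarrow> \<exists>m. d k x m \<le> D / 2 \<and> d k m y \<le> D / 2 + e k"
    and e: "e \<longlonglongrightarrow> 0"
    and D: "\<And>k. d k x y \<le> D"
  shows "\<exists>m. \<forall>k. d k x m \<le> D / 2 \<and> d k m y \<le> D / 2"
proof -
  obtain m where m: "\<And>k. d k x (m k) \<le> D / 2" "\<And>k. d k (m k) y \<le> D / 2 + e k"
    using mid[OF D] by metis
  have "dist x (m k) \<le> D / 2 / c0" for k
    using order_trans[OF c0(2) m(1)[of k]] c0(1) unfolding pos_le_divide_eq[OF c0(1)] by (simp add: mult.commute)
  then have "\<forall>k. m k \<in> cball x (D / 2 / c0)" by simp
  then obtain z r where r: "strict_mono r" "(m \<circ> r) \<longlonglongrightarrow> z"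
    using compact_cball[of x "D / 2 / c0"] unfolding compact_def by blast
  have tail: "\<forall>\<^sub>F n in sequentially. k \<le> r n" for k
    using seq_suble[OF r(1)] by (auto simp: eventually_sequentially intro: order_trans)
  have lim: "(\<lambda>n. dist (m (r n)) z) \<longlonglongrightarrow> 0"
    using tendsto_dist_iff[THEN iffD1, OF r(2)] by (simp add: o_def)
  have e': "(\<lambda>n. e (r n)) \<longlonglongrightarrow> 0"
    using LIMSEQ_subseq_LIMSEQ[OF e r(1)] by (simp add: o_def)
  have "d k x z \<le> D / 2" for k
  proof (rule tendsto_lowerbound)
    show "(\<lambda>n. D / 2 + B k * dist (m (r n)) z) \<longlonglongrightarrow> D / 2"
      using tendsto_add[OF tendsto_const tendsto_mult[OF tendsto_const lim], of "D / 2" "B k"] by simp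
    show "\<forall>\<^sub>F n in sequentially. d k x z \<le> D / 2 + B k * dist (m (r n)) z"
      using tail[of k]
    proof eventually_elim
      case (elim n)
      show ?case using mono[OF elim, of x "m (r n)"] m(1)[of "r n"] cont[of k x z x "m (r n)"]
        by (simp add: dist_commute)
    qed
  qed simp
  moreover have "d k z y \<le> D / 2" for k
  proof (rule tendsto_lowerbound)
    show "(\<lambda>n. D / 2 + e (r n) + B k * dist (m (r n)) z) \<longlonglongrightarrow> D / 2"
      using tendsto_add[OF tendsto_add[OF tendsto_const e'] tendsto_mult[OF tendsto_const lim], of "D / 2" "B k"] by simp
    show "\<forall>\<^sub>F n in sequentially. d k z y \<le> D / 2 + e (r n) + B k * dist (m (r n)) z"
      using tail[of k]
    proof eventually_elim
      case (elim n)
      show ?case using mono[OF elim, of "m (r n)" y] m(2)[of "r n"] cont[of k z y "m (r n)" y]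
        by (simp add: dist_commute)
    qed
  qed simp
  ultimately show ?thesis by blast
qed

lemma floor_double_cases:
  fixes t :: real assumes "0 \<le> t"
  shows "nat \<lfloor>2 ^ Suc n * t\<rfloor> = 2 * nat \<lfloor>2 ^ n * t\<rfloor> \<or> nat \<lfloor>2 ^ Suc n * t\<rfloor> = Suc (2 * nat \<lfloor>2 ^ n * t\<rfloor>)"
proof -
  define u where "u = 2 ^ n * t"
  have u: "0 \<le> u" "2 ^ Suc n * t = 2 * u" using assms by (auto simp: u_def)
  have "\<lfloor>2 * u\<rfloor> = 2 * \<lfloor>u\<rfloor> \<or> \<lfloor>2 * u\<rfloor> = 2 * \<lfloor>u\<rfloor> + 1"
    by linarith
  then show ?thesis unfolding u(2) u_def[symmetric] using u(1) by (auto simp: nat_mult_distrib nat_add_distrib)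
qed

text \<open>Repeated halving yields points \<open>P n i\<close> for the dyadic times \<open>i / 2 ^ n\<close>, consecutive ones being at distance at
  most \<open>D / 2 ^ n\<close>. The curve is defined at every time directly, as the limit along the dyadic times below it,
  and inherits the estimate since each \<open>d k\<close> is continuous.\<close>

lemma geodesic_from_midpoints:
  fixes d :: "nat \<Rightarrow> 'a::euclidean_space \<Rightarrow> 'a \<Rightarrow> real"
  assumes c0: "0 < c0" "\<And>k x y. c0 * dist x y \<le> d k x y"
    and cont: "\<And>k x y x' y'. \<bar>d k x y - d k x' y'\<bar> \<le> B k * (dist x x' + dist y y')"
    and tri: "\<And>k x y z. d k x z \<le> d k x y + d k y z"
    and refl: "\<And>k x. d k x x = 0"
    and mid: "\<And>x y D. (\<And>k. d k x y \<le> D) \<Longrightarrow> \<exists>m. \<forall>k. d k x m \<le> D / 2 \<and> d k m y \<le> D / 2"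
    and D: "\<And>k. d k x y \<le> D"
  obtains \<gamma> where "\<gamma> 0 = x" "\<gamma> 1 = y" "\<And>k s t. 0 \<le> s \<Longrightarrow> s \<le> t \<Longrightarrow> t \<le> 1 \<Longrightarrow> d k (\<gamma> s) (\<gamma> t) \<le> D * (t - s)"
proof -
  have D0: "0 \<le> D" using D[of 0] c0(2)[of x y 0] c0(1) by (meson mult_nonneg_nonneg order_trans less_imp_le zero_le_dist)
  obtain M where M: "\<And>x y D k. (\<And>k. d k x y \<le> D) \<Longrightarrow> d k x (M x y D) \<le> D / 2 \<and> d k (M x y D) y \<le> D / 2"
    using mid by metis
  \<comment> \<open>\<open>P n i\<close> is the point at time \<open>i / 2 ^ n\<close>; odd indices are new midpoints.\<close>
  define P where "P = rec_nat (\<lambda>i. if i = 0 then x else y) (\<lambda>n p i. if even i then p (i div 2) else M (p (i div 2)) (p (Suc (i div 2))) (D / 2 ^ n))"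
  have P0: "P 0 i = (if i = 0 then x else y)" for i by (simp add: P_def)
  have PS: "P (Suc n) i = (if even i then P n (i div 2) else M (P n (i div 2)) (P n (Suc (i div 2))) (D / 2 ^ n))" for n i
    by (simp add: P_def)
  have Pe: "P (Suc n) (2 * i) = P n i" for n i by (simp add: PS)
  have Pl: "P n 0 = x" for n by (induction n) (auto simp: P0 PS)
  have Pr: "P n (2 ^ n) = y" for n by (induction n) (auto simp: P0 Pe)
  have step: "d k (P n i) (P n (Suc i)) \<le> D / 2 ^ n" if "i < 2 ^ n" for n i k
    using that
  proof (induction n arbitrary: i k)
    case 0
    then show ?case using D by (simp add: P0)
  next
    case (Suc n)
    define j where "j = i div 2"
    have j: "j < 2 ^ n" using Suc.prems by (auto simp: j_def)
    have mm: "d k (P n j) (M (P n j) (P n (Suc j)) (D / 2 ^ n)) \<le> D / 2 ^ n / 2"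
         "d k (M (P n j) (P n (Suc j)) (D / 2 ^ n)) (P n (Suc j)) \<le> D / 2 ^ n / 2"
      using M[of "P n j" "P n (Suc j)" "D / 2 ^ n" k] Suc.IH[OF j] by auto
    show ?case
    proof (cases "even i")
      case True
      then show ?thesis using mm(1) by (simp add: PS j_def mult.commute)
    next
      case False
      then have "Suc i div 2 = Suc j" by (auto simp: j_def)
      then show ?thesis using False mm(2) by (simp add: PS j_def mult.commute)
    qed
  qed
  have steps: "d k (P n i) (P n (i + l)) \<le> real l * (D / 2 ^ n)" if "i + l \<le> 2 ^ n" for n i l k
    using that
  proof (induction l)
    case (Suc l)
    have "d k (P n i) (P n (i + Suc l)) \<le> d k (P n i) (P n (i + l)) + d k (P n (i + l)) (P n (Suc (i + l)))"
      using tri by simp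
    moreover have "d k (P n (i + l)) (P n (Suc (i + l))) \<le> D / 2 ^ n" using Suc.prems by (intro step) simp
    moreover have "d k (P n i) (P n (i + l)) \<le> real l * (D / 2 ^ n)" using Suc by simp
    moreover have "real (Suc l) * (D / 2 ^ n) = real l * (D / 2 ^ n) + D / 2 ^ n" by (simp add: distrib_right add_divide_distrib)
    ultimately show ?case by linarith
  qed (simp add: refl)
  define a where "a t n = P n (nat \<lfloor>2 ^ n * t\<rfloor>)" for t :: real and n
  have fl: "real (nat \<lfloor>2 ^ n * t\<rfloor>) \<le> 2 ^ n * t" "2 ^ n * t < real (nat \<lfloor>2 ^ n * t\<rfloor>) + 1" if "0 \<le> t" for n and t :: real
    using that by (auto simp: of_nat_nat)
  have fl1: "nat \<lfloor>2 ^ n * t\<rfloor> \<le> 2 ^ n" if "0 \<le> t" "t \<le> 1" for n and t :: real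
  proof -
    have "2 ^ n * t \<le> 2 ^ n * 1" using that by (intro mult_left_mono) auto
    then have "real (nat \<lfloor>2 ^ n * t\<rfloor>) \<le> real (2 ^ n)" using fl(1)[OF that(1), of n]
      unfolding of_nat_power of_nat_numeral by linarith
    then show ?thesis by (simp only: of_nat_le_iff)
  qed
  have conv: "convergent (a t)" if t: "0 \<le> t" "t \<le> 1" for t
  proof -
    have diff: "norm (a t (Suc n) - a t n) \<le> D / c0 * (1 / 2) ^ n" for n
    proof -
      define i where "i = nat \<lfloor>2 ^ n * t\<rfloor>"
      have an: "a t n = P (Suc n) (2 * i)" by (simp add: a_def i_def Pe)
      have "nat \<lfloor>2 ^ Suc n * t\<rfloor> = 2 * i \<or> nat \<lfloor>2 ^ Suc n * t\<rfloor> = Suc (2 * i)"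
        unfolding i_def by (rule floor_double_cases[OF t(1)])
      then show ?thesis
      proof
        assume "nat \<lfloor>2 ^ Suc n * t\<rfloor> = 2 * i"
        then show ?thesis using an D0 c0(1) unfolding a_def by simp
      next
        assume *: "nat \<lfloor>2 ^ Suc n * t\<rfloor> = Suc (2 * i)"
        then have "Suc (2 * i) \<le> 2 ^ Suc n" using fl1[OF t, of "Suc n"] by simp
        then have "d 0 (P (Suc n) (2 * i)) (P (Suc n) (Suc (2 * i))) \<le> D / 2 ^ Suc n" by (intro step) simp
        moreover have "a t (Suc n) = P (Suc n) (Suc (2 * i))" unfolding a_def * ..
        ultimately have "c0 * dist (a t n) (a t (Suc n)) \<le> D / 2 ^ Suc n"
          using c0(2)[of "a t n" "a t (Suc n)" 0] an by simp
        also have "\<dots> \<le> D * (1 / 2) ^ n" using D0 by (simp add: power_one_over field_simps)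
        finally have "dist (a t n) (a t (Suc n)) \<le> D * (1 / 2) ^ n / c0"
          using c0(1) by (simp add: pos_le_divide_eq mult.commute)
        then show ?thesis by (simp add: dist_norm norm_minus_commute)
      qed
    qed
    have "summable (\<lambda>n. a t (Suc n) - a t n)"
    proof (rule summable_comparison_test'[of "\<lambda>n. D / c0 * (1 / 2) ^ n" 0])
      show "summable (\<lambda>n. D / c0 * (1 / 2) ^ n)" by (intro summable_mult summable_geometric) simp
    qed (use diff in auto)
    then have "convergent (\<lambda>n. \<Sum>i<n. (a t (Suc i) - a t i))"
      using summable_iff_convergent by blast
    then have "convergent (\<lambda>n. a t n - a t 0)" by (simp add: sum_lessThan_telescope)
    then show ?thesis by (simp add: convergent_diff_const_right_iff)
  qed
  define \<gamma> where "\<gamma> t = lim (a t)" for t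
  have lim: "a t \<longlonglongrightarrow> \<gamma> t" if "0 \<le> t" "t \<le> 1" for t
    using conv[OF that] by (simp add: \<gamma>_def convergent_LIMSEQ_iff)
  have "a 0 n = x" for n by (simp add: a_def Pl)
  then have "a 0 \<longlonglongrightarrow> x" by (simp add: tendsto_eventually)
  then have g0: "\<gamma> 0 = x" using lim[of 0] LIMSEQ_unique by auto
  have "nat \<lfloor>2 ^ n :: real\<rfloor> = 2 ^ n" for n
    by (metis floor_of_nat nat_int of_nat_numeral of_nat_power)
  then have "a 1 n = y" for n unfolding a_def mult_1_right by (simp only: Pr)
  then have "a 1 \<longlonglongrightarrow> y" by (simp add: tendsto_eventually)
  then have g1: "\<gamma> 1 = y" using lim[of 1] LIMSEQ_unique by auto
  have "d k (\<gamma> s) (\<gamma> t) \<le> D * (t - s)" if st: "0 \<le> s" "s \<le> t" "t \<le> 1" for k s t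
  proof (rule tendsto_lowerbound)
    have t0: "0 \<le> t" using st by auto
    have z: "(\<lambda>n. dist (\<gamma> s) (a s n)) \<longlonglongrightarrow> 0" "(\<lambda>n. dist (\<gamma> t) (a t n)) \<longlonglongrightarrow> 0"
      using tendsto_dist[OF tendsto_const[of "\<gamma> s"] lim[of s]] tendsto_dist[OF tendsto_const[of "\<gamma> t"] lim[of t]] st by auto
    have p: "(\<lambda>n. (1 / 2 :: real) ^ n) \<longlonglongrightarrow> 0" by (rule LIMSEQ_power_zero) simp
    have "(\<lambda>n. D * (t - s + (1 / 2) ^ n) + B k * (dist (\<gamma> s) (a s n) + dist (\<gamma> t) (a t n)))
        \<longlonglongrightarrow> D * (t - s + 0) + B k * (0 + 0)"
      by (intro tendsto_intros z p)
    then show "(\<lambda>n. D * (t - s + (1 / 2) ^ n) + B k * (dist (\<gamma> s) (a s n) + dist (\<gamma> t) (a t n)))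
        \<longlonglongrightarrow> D * (t - s)" by simp
    have "d k (\<gamma> s) (\<gamma> t) \<le> D * (t - s + (1 / 2) ^ n) + B k * (dist (\<gamma> s) (a s n) + dist (\<gamma> t) (a t n))" for n
    proof -
      define i j where "i = nat \<lfloor>2 ^ n * s\<rfloor>" and "j = nat \<lfloor>2 ^ n * t\<rfloor>"
      have ij: "i \<le> j" unfolding i_def j_def using st by (intro nat_mono floor_mono mult_left_mono) auto
      have j: "j \<le> 2 ^ n" unfolding j_def using fl1[OF t0 st(3)] .
      have "d k (a s n) (a t n) \<le> real (j - i) * (D / 2 ^ n)"
        using steps[of i "j - i" n k] ij j by (simp add: a_def i_def j_def)
      also have "\<dots> \<le> (2 ^ n * (t - s) + 1) * (D / 2 ^ n)"
        using fl(1)[OF t0, of n] fl(2)[OF st(1), of n] ij D0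
        by (intro mult_right_mono) (auto simp: i_def j_def of_nat_diff algebra_simps)
      also have "\<dots> = D * (t - s + (1 / 2) ^ n)" by (simp add: field_simps power_one_over)
      finally show ?thesis using cont[of k "\<gamma> s" "\<gamma> t" "a s n" "a t n"] by linarith
    qed
    then show "\<forall>\<^sub>F n in sequentially. d k (\<gamma> s) (\<gamma> t) \<le> D * (t - s + (1 / 2) ^ n) + B k * (dist (\<gamma> s) (a s n) + dist (\<gamma> t) (a t n))"
      by simp
  qed simp
  with g0 g1 show ?thesis by (rule that)
qed

text \<open>Measured in the weight \<open>c\<close>, the curve has speed at most \<open>D\<close>. On a short parameter interval \<open>c\<close> is nearly a
  constant \<open>C\<close>, so the curve is Lipschitz there with constant about \<open>D / C\<close>; the piece has Hausdorff measure
  at most \<open>D / C\<close> times the length of the interval and contributes about \<open>D\<close> times that length to the integral.\<close>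

lemma hausdorff1_integral_le_length:
  fixes \<gamma> :: "real \<Rightarrow> 'a::euclidean_space" and c :: "'a \<Rightarrow> real"
  assumes D: "0 < D" and c0: "0 < c0" "\<And>x. c0 \<le> c x" and K: "0 \<le> K"
    and lip: "\<And>x y. \<bar>c x - c y\<bar> \<le> K * dist x y"
    and loc: "\<And>s t. 0 \<le> s \<Longrightarrow> s \<le> t \<Longrightarrow> t \<le> 1 \<Longrightarrow> (c (\<gamma> s) - K' * (D * (t - s))) * dist (\<gamma> s) (\<gamma> t) \<le> D * (t - s)"
    and gl: "\<And>s t. 0 \<le> s \<Longrightarrow> s \<le> t \<Longrightarrow> t \<le> 1 \<Longrightarrow> c0 * dist (\<gamma> s) (\<gamma> t) \<le> D * (t - s)"
    and K': "0 \<le> K'"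
  shows "(\<integral>\<^sup>+z\<in>\<gamma> ` {0..1}. ennreal (c z) \<partial>hausdorff1) \<le> ennreal D"
proof -
  have cm [measurable]: "c \<in> borel_measurable borel"
  proof -
    have "K-lipschitz_on UNIV c" using K lip by (intro lipschitz_onI) (auto simp: dist_real_def)
    then show ?thesis by (intro borel_measurable_continuous_onI lipschitz_on_continuous_on)
  qed
  have approx: "(\<integral>\<^sup>+z\<in>\<gamma> ` {0..1}. ennreal (c z) \<partial>hausdorff1) \<le> ennreal ((1 + \<eta>) / (1 - \<eta>) * D)"
    if \<eta>: "0 < \<eta>" "\<eta> < 1" for \<eta>
  proof -
    \<comment> \<open>On a parameter interval of length \<open>1 / N\<close> both the oscillation of \<open>c\<close> and the correction in \<open>loc\<close> are at most \<open>A / N\<close>.\<close>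
    define A where "A = K * D / c0 + K' * D"
    have A0: "0 \<le> A" using K K' D c0 by (simp add: A_def)
    obtain N :: nat where N: "2 * A / (\<eta> * c0) < N" using reals_Archimedean2 by blast
    have N0: "0 < N" using N A0 \<eta> c0 by (cases N) (auto simp: divide_less_0_iff mult_less_0_iff)
    have AN: "2 * (A / N) \<le> \<eta> * c0" using N N0 \<eta> c0 by (simp add: field_simps)
    define J where "J r = {real r / N .. real (Suc r) / N}" for r
    define C where "C r = c (\<gamma> (real r / N))" for r
    have Jlen: "real (Suc r) / N - real r / N = 1 / N" for r by (simp add: diff_divide_distrib[symmetric])
    have J1: "0 \<le> s \<and> s \<le> 1" if "r < N" "s \<in> J r" for s r
    proof -
      have "real (Suc r) / N \<le> 1" using that(1) N0 by (simp add: field_simps)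
      moreover have "0 \<le> real r / N" by simp
      ultimately show ?thesis using that(2) unfolding J_def atLeastAtMost_iff by linarith
    qed
    have osc: "\<bar>c (\<gamma> s) - C r\<bar> \<le> A / N" if "r < N" "s \<in> J r" for s r
    proof -
      have "c0 * dist (\<gamma> (real r / N)) (\<gamma> s) \<le> D * (s - real r / N)"
        using that J1[OF that] by (intro gl) (auto simp: J_def)
      also have "\<dots> \<le> D * (1 / N)"
        using that Jlen[of r] D by (intro mult_left_mono) (auto simp: J_def)
      finally have "dist (\<gamma> s) (\<gamma> (real r / N)) \<le> D / N / c0"
        unfolding pos_le_divide_eq[OF c0(1)] by (simp add: mult.commute dist_commute)
      then have "K * dist (\<gamma> s) (\<gamma> (real r / N)) \<le> K * (D / N / c0)" using K by (rule mult_left_mono)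
      also have "\<dots> \<le> A / N" using K' D N0 by (simp add: A_def field_simps)
      finally show ?thesis unfolding C_def using lip order_trans by blast
    qed
    have Cc0: "c0 \<le> C r" for r by (simp add: C_def c0)
    have AC: "2 * (A / N) \<le> \<eta> * C r" for r
      using AN mult_left_mono[OF Cc0[of r], of \<eta>] \<eta> by linarith
    have Cpos: "0 < (1 - \<eta>) * C r" for r using \<eta> c0(1) Cc0[of r] by simp
    define M where "M = density hausdorff1 (\<lambda>z. ennreal (c z))"
    have M: "emeasure M X = (\<integral>\<^sup>+z\<in>X. ennreal (c z) \<partial>hausdorff1)" if "X \<in> sets borel" for X
      unfolding M_def using that by (intro emeasure_density) auto
    have curve: "emeasure hausdorff1 (\<gamma> ` J r) \<le> ennreal (D / ((1 - \<eta>) * C r) * (1 / N))"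
      "\<gamma> ` J r \<in> sets borel" if r: "r < N" for r
    proof -
      have dl: "dist (\<gamma> s) (\<gamma> t) \<le> D / ((1 - \<eta>) * C r) * (t - s)"
        if st: "real r / N \<le> s" "s \<le> t" "t \<le> real (Suc r) / N" for s t
      proof -
        have sJ: "s \<in> J r" "t \<in> J r" using st by (auto simp: J_def)
        have "t - s \<le> 1 / N" using st Jlen[of r] by linarith
        then have "K' * (D * (t - s)) \<le> K' * (D * (1 / N))"
          using K' D by (intro mult_left_mono) auto
        also have "\<dots> \<le> A / N" using K D c0 N0 by (simp add: A_def field_simps)
        finally have "(1 - \<eta>) * C r \<le> c (\<gamma> s) - K' * (D * (t - s))"
          using osc[OF r sJ(1)] AC[of r] unfolding left_diff_distrib mult_1_left by linarith
        then have "(1 - \<eta>) * C r * dist (\<gamma> s) (\<gamma> t) \<le> (c (\<gamma> s) - K' * (D * (t - s))) * dist (\<gamma> s) (\<gamma> t)"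
          by (rule mult_right_mono) simp
        also have "\<dots> \<le> D * (t - s)" using J1[OF r sJ(1)] J1[OF r sJ(2)] st by (intro loc) auto
        finally show ?thesis using Cpos[of r] by (simp add: pos_le_divide_eq mult.commute)
      qed
      have "real r / N \<le> real (Suc r) / N" by (simp add: divide_right_mono)
      moreover have pos: "0 < D / ((1 - \<eta>) * C r)" using D Cpos[of r] by simp
      ultimately show "emeasure hausdorff1 (\<gamma> ` J r) \<le> ennreal (D / ((1 - \<eta>) * C r) * (1 / N))"
        "\<gamma> ` J r \<in> sets borel"
        using hausdorff1_lipschitz_curve[of "D / ((1 - \<eta>) * C r)" "real r / N" "real (Suc r) / N" \<gamma>, OF _ _ dl]
        unfolding J_def Jlen by blast+
    qed
    have piece: "emeasure M (\<gamma> ` J r) \<le> ennreal ((1 + \<eta>) / (1 - \<eta>) * (D / N))" if r: "r < N" for r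
    proof -
      have "emeasure M (\<gamma> ` J r) \<le> (\<integral>\<^sup>+z. ennreal ((1 + \<eta>) * C r) * indicator (\<gamma> ` J r) z \<partial>hausdorff1)"
        unfolding M[OF curve(2)[OF r]]
      proof (rule nn_integral_mono)
        fix z
        have "c z \<le> (1 + \<eta>) * C r" if "z \<in> \<gamma> ` J r"
        proof -
          from that obtain s where s: "s \<in> J r" "z = \<gamma> s" by blast
          have "0 \<le> A / N" using A0 by simp
          then show ?thesis using osc[OF r s(1)] AC[of r] unfolding s(2) distrib_right mult_1_left by linarith
        qed
        then show "ennreal (c z) * indicator (\<gamma> ` J r) z \<le> ennreal ((1 + \<eta>) * C r) * indicator (\<gamma> ` J r) z"
          by (auto simp: indicator_def intro!: ennreal_leI)
      qed
      also have "\<dots> = ennreal ((1 + \<eta>) * C r) * emeasure hausdorff1 (\<gamma> ` J r)"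
        using curve(2)[OF r] by (intro nn_integral_cmult_indicator) auto
      also have "\<dots> \<le> ennreal ((1 + \<eta>) * C r) * ennreal (D / ((1 - \<eta>) * C r) * (1 / N))"
        by (intro mult_left_mono curve(1)[OF r]) simp
      also have "\<dots> = ennreal ((1 + \<eta>) * C r * (D / ((1 - \<eta>) * C r) * (1 / N)))"
        using \<eta> c0(1) Cc0[of r] by (intro ennreal_mult[symmetric]) (auto simp: D less_imp_le)
      also have "(1 + \<eta>) * C r * (D / ((1 - \<eta>) * C r) * (1 / N)) = (1 + \<eta>) / (1 - \<eta>) * (D / N)"
      proof -
        have "C r \<noteq> 0" "1 - \<eta> \<noteq> 0" using c0(1) Cc0[of r] \<eta> by auto
        then show ?thesis using N0 by (simp add: divide_simps)
      qed
      finally show ?thesis .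
    qed
    have sub: "\<gamma> ` {0..1} \<subseteq> (\<Union>r<N. \<gamma> ` J r)"
    proof -
      have "\<exists>r<N. t \<in> J r" if t: "0 \<le> t" "t \<le> 1" for t
      proof (cases "t = 1")
        case True
        then show ?thesis using N0 by (intro exI[of _ "N - 1"]) (auto simp: J_def field_simps)
      next
        case False
        define r where "r = nat \<lfloor>N * t\<rfloor>"
        have "real r \<le> N * t" "N * t < real r + 1" using t by (auto simp: r_def of_nat_nat)
        moreover have "N * t < N" using False t N0 by simp
        ultimately have "r < N" by linarith
        moreover have "t \<in> J r" using \<open>real r \<le> N * t\<close> \<open>N * t < real r + 1\<close> N0 by (auto simp: J_def field_simps)
        ultimately show ?thesis by blast
      qed
      then show ?thesis by fastforce
    qed
    have "(\<integral>\<^sup>+z\<in>\<gamma> ` {0..1}. ennreal (c z) \<partial>hausdorff1) \<le> (\<integral>\<^sup>+z\<in>(\<Union>r<N. \<gamma> ` J r). ennreal (c z) \<partial>hausdorff1)"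
      by (intro nn_integral_mono mult_left_mono indicator_leI subsetD[OF sub]) auto
    also have "\<dots> = emeasure M (\<Union>r<N. \<gamma> ` J r)" using curve(2) by (intro M[symmetric]) auto
    also have "\<dots> \<le> (\<Sum>r<N. emeasure M (\<gamma> ` J r))"
      using curve(2) by (intro emeasure_subadditive_finite) (auto simp: M_def)
    also have "\<dots> \<le> (\<Sum>r<N. ennreal ((1 + \<eta>) / (1 - \<eta>) * (D / N)))" using piece by (intro sum_mono) auto
    also have "\<dots> = ennreal (\<Sum>r<N. (1 + \<eta>) / (1 - \<eta>) * (D / N))" using \<eta> D by (intro sum_ennreal) auto
    also have "(\<Sum>r<N. (1 + \<eta>) / (1 - \<eta>) * (D / N)) = (1 + \<eta>) / (1 - \<eta>) * D" using N0 by simp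
    finally show ?thesis .
  qed
  have "((\<lambda>\<eta>. ennreal ((1 + \<eta>) / (1 - \<eta>) * D)) \<longlongrightarrow> ennreal ((1 + 0) / (1 - 0) * D)) (at_right 0)"
    by (intro tendsto_ennrealI tendsto_intros) auto
  moreover have "eventually (\<lambda>\<eta>::real. (\<integral>\<^sup>+z\<in>\<gamma> ` {0..1}. ennreal (c z) \<partial>hausdorff1) \<le> ennreal ((1 + \<eta>) / (1 - \<eta>) * D)) (at_right 0)"
    using eventually_at_right_real[of 0 "1::real"] by (rule eventually_mono) (use approx in auto)
  ultimately show ?thesis using tendsto_lowerbound[of _ _ "at_right (0::real)"] by fastforce
qed

text \<open>A bound on all chain distances between \<open>x\<close> and \<open>y\<close> gives a geodesic of the limiting distance, that is, a
  genuine path. Its cost for each \<open>c k\<close> is at most \<open>D\<close>, and monotone convergence passes to the friction.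
  This is where lower semicontinuity of the path cost is obtained.\<close>

lemma urban_metric_le_limit:
  fixes S :: "'a::euclidean_space set"
  assumes S: "S \<in> sets borel" and lsc: "lower_semicontinuous_on UNIV (friction S a b)"
    and c: "\<And>k. chain_cost (c k) (h k) c0 (B k) (L k)"
    and mono: "\<And>j k x. j \<le> k \<Longrightarrow> c j x \<le> c k x" "\<And>j k. j \<le> k \<Longrightarrow> h k \<le> h j"
    and sup: "\<And>x. (SUP k. ennreal (c k x)) = friction S a b x"
    and Bh: "(\<lambda>k. B k * h k) \<longlonglongrightarrow> 0"
    and D: "0 < D" "\<And>k. chain_dist (c k) (h k) x y \<le> D"
  shows "urban_metric S a b x y \<le> ennreal D"
proof -
  define d where "d k = chain_dist (c k) (h k)" for k
  have c0: "0 < c0" using c[of 0] by (simp add: chain_cost_def)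
  have ge: "c0 * dist x y \<le> d k x y" for k x y
    unfolding d_def by (rule chain_cost.chain_dist_ge[OF c])
  have cont: "\<bar>d k x y - d k x' y'\<bar> \<le> B k * (dist x x' + dist y y')" for k x y x' y'
    unfolding d_def by (rule chain_cost.chain_dist_lipschitz[OF c])
  have dmono: "d j x y \<le> d k x y" if "j \<le> k" for j k x y
    unfolding d_def using mono that by (intro chain_dist_mono[OF c c]) auto
  have refl: "d k x x = 0" for k x
    using chain_cost.chain_dist_le_dist[OF c, of k x x] chain_cost.chain_dist_nonneg[OF c, of k x x] by (simp add: d_def)
  have inv0: "(\<lambda>k. inverse (real (Suc k)) + B k * h k) \<longlonglongrightarrow> 0"
    using tendsto_add[OF LIMSEQ_inverse_real_of_nat Bh] by simp
  have mid: "\<exists>m. \<forall>k. d k x m \<le> D / 2 \<and> d k m y \<le> D / 2" if "\<And>k. d k x y \<le> D" for x y D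
  proof (rule midpoint_of_limit[OF c0 ge cont dmono _ inv0 that])
    fix k x y D assume "d k x y \<le> D"
    then show "\<exists>m. d k x m \<le> D / 2 \<and> d k m y \<le> D / 2 + (inverse (real (Suc k)) + B k * h k)"
      unfolding d_def using chain_cost.chain_dist_midpoint[OF c, of k x y D "inverse (real (Suc k))"] by (simp add: add.assoc)
  qed
  have tri: "d k x z \<le> d k x y + d k y z" for k x y z
    unfolding d_def by (rule chain_cost.chain_dist_triangle[OF c])
  obtain \<gamma> where g: "\<gamma> 0 = x" "\<gamma> 1 = y" "\<And>k s t. 0 \<le> s \<Longrightarrow> s \<le> t \<Longrightarrow> t \<le> 1 \<Longrightarrow> d k (\<gamma> s) (\<gamma> t) \<le> D * (t - s)"
    using geodesic_from_midpoints[OF c0 ge cont tri refl mid D(2)[folded d_def]] by blast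
  have gl: "c0 * dist (\<gamma> s) (\<gamma> t) \<le> D * (t - s)" if "0 \<le> s" "s \<le> t" "t \<le> 1" for s t
    using g(3)[OF that, of 0] ge[of "\<gamma> s" "\<gamma> t" 0] by linarith
  have "(D / c0)-lipschitz_on {0..1} \<gamma>"
  proof (rule lipschitz_onI)
    show "0 \<le> D / c0" using D c0 by simp
    fix s t :: real assume st: "s \<in> {0..1}" "t \<in> {0..1}"
    show "dist (\<gamma> s) (\<gamma> t) \<le> D / c0 * dist s t"
    proof (cases "s \<le> t")
      case True
      then show ?thesis using gl[of s t] st c0 by (simp add: pos_le_divide_eq mult.commute dist_real_def)
    next
      case False
      then show ?thesis using gl[of t s] st c0 by (simp add: pos_le_divide_eq mult.commute dist_real_def dist_commute)
    qed
  qed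
  then have path: "\<gamma> \<in> lipschitz_paths x y" and K: "\<gamma> ` {0..1} \<in> sets borel"
    using g by (auto simp: lipschitz_paths_def intro!: borel_compact compact_continuous_image lipschitz_on_continuous_on)
  have ck: "(\<integral>\<^sup>+z\<in>\<gamma> ` {0..1}. ennreal (c k z) \<partial>hausdorff1) \<le> ennreal D" for k
  proof (rule hausdorff1_integral_le_length[OF D(1) c0])
    interpret chain_cost "c k" "h k" c0 "B k" "L k" by (rule c)
    show "c0 \<le> c k x" for x by (rule c_ge)
    show "0 \<le> L k" by (rule L)
    show "0 \<le> L k / c0" using L c0 by simp
    show "\<bar>c k x - c k y\<bar> \<le> L k * dist x y" for x y by (rule c_lip)
    fix s t :: real assume st: "0 \<le> s" "s \<le> t" "t \<le> 1"
    show "c0 * dist (\<gamma> s) (\<gamma> t) \<le> D * (t - s)" by (rule gl[OF st])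
    show "(c k (\<gamma> s) - L k / c0 * (D * (t - s))) * dist (\<gamma> s) (\<gamma> t) \<le> D * (t - s)"
      using g(3)[OF st, of k] unfolding d_def by (rule chain_dist_lower_bound)
  qed
  have cm: "c k \<in> borel_measurable borel" for k
  proof -
    interpret chain_cost "c k" "h k" c0 "B k" "L k" by (rule c)
    have "(L k)-lipschitz_on UNIV (c k)" using L c_lip by (intro lipschitz_onI) (auto simp: dist_real_def)
    then show ?thesis by (intro borel_measurable_continuous_onI lipschitz_on_continuous_on)
  qed
  have "urban_metric S a b x y \<le> (\<integral>\<^sup>+z\<in>\<gamma> ` {0..1} \<inter> S. ennreal (b z) \<partial>hausdorff1) + a * emeasure hausdorff1 (\<gamma> ` {0..1} - S)"
    unfolding urban_metric_def by (rule INF_lower[OF path])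
  also have "\<dots> = (\<integral>\<^sup>+z\<in>\<gamma> ` {0..1}. friction S a b z \<partial>hausdorff1)"
    by (rule urban_cost_eq_friction_integral[OF S lower_semicontinuous_borel_measurable[OF lsc] K])
  also have "\<dots> = (\<integral>\<^sup>+z. (SUP k. ennreal (c k z) * indicator (\<gamma> ` {0..1}) z) \<partial>hausdorff1)"
    unfolding sup[symmetric] by (simp add: SUP_mult_right_ennreal)
  also have "\<dots> = (SUP k. \<integral>\<^sup>+z\<in>\<gamma> ` {0..1}. ennreal (c k z) \<partial>hausdorff1)"
  proof (rule nn_integral_monotone_convergence_SUP)
    show "incseq (\<lambda>k z. ennreal (c k z) * indicator (\<gamma> ` {0..1}) z)"
      using mono(1) by (auto simp: incseq_def le_fun_def intro!: mult_right_mono ennreal_leI)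
    show "(\<lambda>z. ennreal (c k z) * indicator (\<gamma> ` {0..1}) z) \<in> borel_measurable hausdorff1" for k
      using cm[of k] K by measurable
  qed
  also have "\<dots> \<le> ennreal D" by (intro SUP_least ck)
  finally show ?thesis .
qed

section \<open>Optimal assignments and potentials\<close>

fun walk_weight :: "('i \<Rightarrow> 'i \<Rightarrow> real) \<Rightarrow> 'i list \<Rightarrow> real" where
  "walk_weight w (x # y # xs) = w x y + walk_weight w (y # xs)"
| "walk_weight w _ = 0"

lemma walk_weight_append: "walk_weight w (as @ y # bs) = walk_weight w (as @ [y]) + walk_weight w (y # bs)"
proof (induction as)
  case (Cons a as)
  then show ?case by (cases as) auto
qed simp

lemma walk_weight_eq_sum_list: "xs \<noteq> [] \<Longrightarrow> walk_weight w (xs @ [z]) = sum_list (map2 w xs (tl xs @ [z]))"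
proof (induction xs)
  case (Cons x xs)
  then show ?case by (cases xs) auto
qed simp

text \<open>A closed walk without repetitions is one cycle of a permutation that fixes everything else. A walk that
  visits a vertex twice splits there into two shorter closed walks.\<close>

lemma closed_walk_nonneg:
  assumes A: "finite A" and refl: "\<And>i. i \<in> A \<Longrightarrow> w i i = 0"
    and perm: "\<And>\<tau>. \<tau> permutes A \<Longrightarrow> 0 \<le> (\<Sum>i\<in>A. w i (\<tau> i))"
  shows "xs \<noteq> [] \<Longrightarrow> set xs \<subseteq> A \<Longrightarrow> 0 \<le> walk_weight w (xs @ [hd xs])"
proof (induction xs rule: length_induct)
  case (1 xs)
  show ?case
  proof (cases "distinct xs")
    case True
    define \<tau> where "\<tau> = cycle_of_list xs"
    have \<tau>: "\<tau> permutes set xs" unfolding \<tau>_def by (rule cycle_permutes)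
    have "map \<tau> xs = rotate1 xs"
      using cyclic_rotation[OF True, of 1] by (simp add: \<tau>_def)
    also have "\<dots> = tl xs @ [hd xs]" using 1(2) by (cases xs) auto
    finally have "walk_weight w (xs @ [hd xs]) = sum_list (map2 w xs (map \<tau> xs))"
      using walk_weight_eq_sum_list[OF 1(2), of w "hd xs"] by simp
    also have "map2 w xs (map \<tau> xs) = map (\<lambda>i. w i (\<tau> i)) xs"
      by (simp add: zip_map2 zip_same_conv_map)
    also have "sum_list \<dots> = (\<Sum>i\<in>set xs. w i (\<tau> i))" using True by (simp add: sum_list_distinct_conv_sum_set)
    also have "\<dots> = (\<Sum>i\<in>A. w i (\<tau> i))"
      using A 1(3) refl permutes_not_in[OF \<tau>] by (intro sum.mono_neutral_left) auto
    finally show ?thesis using perm[OF permutes_subset[OF \<tau> 1(3)]] by simp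
  next
    case False
    then obtain as y bs cs where xs: "xs = as @ [y] @ bs @ [y] @ cs"
      using not_distinct_decomp by blast
    have "0 \<le> walk_weight w ((y # bs) @ [hd (y # bs)])"
      using 1(1,3) xs by (intro 1(1)[rule_format]) auto
    moreover have "0 \<le> walk_weight w ((as @ y # cs) @ [hd (as @ y # cs)])"
      using 1(1,3) xs by (intro 1(1)[rule_format]) auto
    moreover have "hd (as @ y # cs) = hd xs" using xs by (cases as) auto
    moreover have "walk_weight w (xs @ [hd xs]) = walk_weight w (as @ [y]) + (walk_weight w (y # bs @ [y]) + walk_weight w (y # cs @ [hd xs]))"
      using walk_weight_append[of w as y "bs @ y # cs @ [hd xs]"] walk_weight_append[of w "y # bs" y "cs @ [hd xs]"] xs by simp
    ultimately show ?thesis using walk_weight_append[of w as y "cs @ [hd xs]"] by simp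
  qed
qed

text \<open>The potential is the least weight of a walk from a fixed root. It is bounded below because appending the
  edge back to the root closes the walk.\<close>

lemma potential_exists:
  fixes w :: "'i \<Rightarrow> 'i \<Rightarrow> real"
  assumes A: "finite A" and refl: "\<And>i. i \<in> A \<Longrightarrow> w i i = 0"
    and perm: "\<And>\<tau>. \<tau> permutes A \<Longrightarrow> 0 \<le> (\<Sum>i\<in>A. w i (\<tau> i))"
  obtains p where "\<And>i j. i \<in> A \<Longrightarrow> j \<in> A \<Longrightarrow> p j \<le> p i + w i j"
proof (cases "A = {}")
  case False
  then obtain r where r: "r \<in> A" by blast
  define W where "W j = {walk_weight w (r # xs @ [j]) | xs. set xs \<subseteq> A}" for j
  have ne: "W j \<noteq> {}" for j unfolding W_def using empty_subsetI[of A] by (metis (mono_tags, lifting) Collect_empty_eq set_empty)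
  have bdd: "bdd_below (W j)" if "j \<in> A" for j
  proof (rule bdd_belowI)
    fix u assume "u \<in> W j"
    then obtain xs where u: "u = walk_weight w (r # xs @ [j])" "set xs \<subseteq> A" by (auto simp: W_def)
    have "0 \<le> walk_weight w ((r # xs @ [j]) @ [hd (r # xs @ [j])])"
      using u(2) r that by (intro closed_walk_nonneg[of A w, OF A refl perm]) auto
    also have "\<dots> = u + w j r" using walk_weight_append[of w "r # xs" j "[r]"] u by simp
    finally show "- w j r \<le> u" by simp
  qed
  show ?thesis
  proof (rule that[of "\<lambda>j. Inf (W j)"])
    fix i j assume ij: "i \<in> A" "j \<in> A"
    have "Inf (W j) - w i j \<le> Inf (W i)"
    proof (rule cInf_greatest[OF ne])
      fix u assume "u \<in> W i"
      then obtain xs where u: "u = walk_weight w (r # xs @ [i])" "set xs \<subseteq> A" by (auto simp: W_def)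
      have "walk_weight w (r # (xs @ [i]) @ [j]) = u + w i j"
        using walk_weight_append[of w "r # xs" i "[j]"] u by simp
      moreover have "walk_weight w (r # (xs @ [i]) @ [j]) \<in> W j"
        unfolding W_def using u(2) ij(1) by (intro CollectI exI[of _ "xs @ [i]"]) auto
      ultimately have "Inf (W j) \<le> u + w i j" using cInf_lower[OF _ bdd[OF ij(2)]] by metis
      then show "Inf (W j) - w i j \<le> u" by simp
    qed
    then show "Inf (W j) \<le> Inf (W i) + w i j" by simp
  qed
qed (use that in blast)

text \<open>Kantorovich duality for equally weighted points, where couplings can be taken to be
  permutations, so that one of the finitely many is optimal. Optimality excludes negative cycles for the
  excess costs \<open>w\<close>. The resulting potential \<open>p\<close> lives on indices; its inf-convolution with \<open>d\<close> extends it
  to a function on the whole space that is 1-Lipschitz for \<open>d\<close> and pays the full cost along every optimal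
  pair.\<close>

lemma assignment_duality:
  fixes d :: "'a \<Rightarrow> 'a \<Rightarrow> real" and x y :: "'i \<Rightarrow> 'a"
  assumes A: "finite A" "A \<noteq> {}" and refl: "\<And>z. d z z = 0" and tri: "\<And>u v z. d u z \<le> d u v + d v z"
  obtains \<sigma> \<phi> where "\<sigma> permutes A" "\<And>z z'. \<phi> z - \<phi> z' \<le> d z z'"
    "\<And>i. i \<in> A \<Longrightarrow> d (x i) (y (\<sigma> i)) \<le> \<phi> (x i) - \<phi> (y (\<sigma> i))"
proof -
  have "finite {\<sigma>. \<sigma> permutes A}" using A(1) by (rule finite_permutations)
  moreover have "{\<sigma>. \<sigma> permutes A} \<noteq> {}" using permutes_id by blast
  ultimately obtain \<sigma> where \<sigma>: "\<sigma> permutes A"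
    and opt: "\<And>\<tau>. \<tau> permutes A \<Longrightarrow> (\<Sum>i\<in>A. d (x i) (y (\<sigma> i))) \<le> (\<Sum>i\<in>A. d (x i) (y (\<tau> i)))"
    using ex_is_arg_min_if_finite[of "{\<sigma>. \<sigma> permutes A}" "\<lambda>\<sigma>. \<Sum>i\<in>A. d (x i) (y (\<sigma> i))"]
    unfolding is_arg_min_linorder by blast
  define w where "w i j = d (x i) (y (\<sigma> j)) - d (x i) (y (\<sigma> i))" for i j
  have "0 \<le> (\<Sum>i\<in>A. w i (\<tau> i))" if "\<tau> permutes A" for \<tau>
    using opt[OF permutes_compose[OF that \<sigma>]] by (simp add: w_def sum_subtractf)
  then obtain p where p: "\<And>i j. i \<in> A \<Longrightarrow> j \<in> A \<Longrightarrow> p j \<le> p i + w i j"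
    using potential_exists[OF A(1), of w] by (auto simp: w_def)
  define \<phi> where "\<phi> z = Min ((\<lambda>j. d z (y (\<sigma> j)) - p j) ` A)" for z
  have le: "\<phi> z \<le> d z (y (\<sigma> j)) - p j" if "j \<in> A" for z j
    unfolding \<phi>_def using A that by (intro Min_le) auto
  have ge: "m \<le> \<phi> z" if "\<And>j. j \<in> A \<Longrightarrow> m \<le> d z (y (\<sigma> j)) - p j" for z m
    unfolding \<phi>_def using A that by (subst Min_ge_iff) auto
  show ?thesis
  proof (rule that[OF \<sigma>, of \<phi>])
    fix z z'
    have "\<phi> z - d z z' \<le> \<phi> z'"
    proof (rule ge)
      fix j assume "j \<in> A"
      then show "\<phi> z - d z z' \<le> d z' (y (\<sigma> j)) - p j" using le[of j z] tri[of z "y (\<sigma> j)" z'] by linarith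
    qed
    then show "\<phi> z - \<phi> z' \<le> d z z'" by linarith
  next
    fix i assume i: "i \<in> A"
    have "d (x i) (y (\<sigma> i)) - p i \<le> \<phi> (x i)"
      using p[OF i] by (intro ge) (auto simp: w_def algebra_simps)
    moreover have "\<phi> (y (\<sigma> i)) \<le> - p i" using le[OF i, of "y (\<sigma> i)"] refl by simp
    ultimately show "d (x i) (y (\<sigma> i)) \<le> \<phi> (x i) - \<phi> (y (\<sigma> i))" by linarith
  qed
qed

section \<open>Mollification\<close>

text \<open>Squaring removes the kink of the positive part. All configurations of signs are covered by a
  remainder of at most \<open>(s - t)\<^sup>2\<close>.\<close>

lemma DERIV_positive_part_square:
  "((\<lambda>t::real. (max 0 t)\<^sup>2) has_real_derivative 2 * max 0 t) (at t)"
proof -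
  have rem: "\<bar>(max 0 s)\<^sup>2 - (max 0 t)\<^sup>2 - 2 * max 0 t * (s - t)\<bar> \<le> (s - t)\<^sup>2" for s :: real
  proof -
    consider "0 \<le> s" "0 \<le> t" | "s \<le> 0" "t \<le> 0" | "0 \<le> s" "t \<le> 0" | "s \<le> 0" "0 \<le> t" by linarith
    then show ?thesis
    proof cases
      case 1
      then have "(max 0 s)\<^sup>2 - (max 0 t)\<^sup>2 - 2 * max 0 t * (s - t) = (s - t)\<^sup>2"
        by (simp add: power2_eq_square algebra_simps)
      then show ?thesis by simp
    next
      case 3
      then have "s * s \<le> (s - t) * (s - t)" by (intro mult_mono) auto
      with 3 show ?thesis by (simp add: power2_eq_square)
    next
      case 4
      have "\<bar>(max 0 s)\<^sup>2 - (max 0 t)\<^sup>2 - 2 * max 0 t * (s - t)\<bar> = \<bar>t\<^sup>2 + 2 * (t * (- s))\<bar>"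
        using 4 by (simp add: power2_eq_square algebra_simps)
      also have "\<dots> = t\<^sup>2 + 2 * (t * (- s))" using 4 by (intro abs_of_nonneg add_nonneg_nonneg mult_nonneg_nonneg) auto
      also have "\<dots> \<le> (s - t)\<^sup>2" by (simp add: power2_eq_square algebra_simps)
      finally show ?thesis .
    qed (simp add: max_def)
  qed
  have "((\<lambda>s. ((max 0 s)\<^sup>2 - (max 0 t)\<^sup>2) / (s - t) - 2 * max 0 t) \<longlongrightarrow> 0) (at t)"
  proof (rule tendsto_rabs_zero_cancel, rule tendsto_sandwich[OF _ _ tendsto_const])
    show "((\<lambda>s. \<bar>s - t\<bar>) \<longlongrightarrow> 0) (at t)"
      by (rule tendsto_eq_intros refl | simp)+
    show "\<forall>\<^sub>F s in at t. \<bar>((max 0 s)\<^sup>2 - (max 0 t)\<^sup>2) / (s - t) - 2 * max 0 t\<bar> \<le> \<bar>s - t\<bar>"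
    proof (rule eventually_at_topological[THEN iffD2], intro exI[of _ UNIV] conjI ballI impI)
      fix s assume "s \<noteq> t"
      then have "((max 0 s)\<^sup>2 - (max 0 t)\<^sup>2) / (s - t) - 2 * max 0 t = ((max 0 s)\<^sup>2 - (max 0 t)\<^sup>2 - 2 * max 0 t * (s - t)) / (s - t)"
        by (simp add: field_simps)
      also have "\<bar>\<dots>\<bar> \<le> (s - t)\<^sup>2 / \<bar>s - t\<bar>"
        unfolding abs_divide by (intro divide_right_mono rem) simp
      also have "(s - t)\<^sup>2 / \<bar>s - t\<bar> = \<bar>s - t\<bar>"
        using \<open>s \<noteq> t\<close> by (simp add: power2_eq_square field_simps)
      finally show "\<bar>((max 0 s)\<^sup>2 - (max 0 t)\<^sup>2) / (s - t) - 2 * max 0 t\<bar> \<le> \<bar>s - t\<bar>" .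
    qed auto
  qed simp
  then show ?thesis unfolding has_field_derivative_iff by (rule LIM_zero_cancel)
qed

text \<open>A nonnegative kernel supported in the ball of radius \<open>\<epsilon>\<close>. It is once continuously differentiable,
  with an explicit gradient. It is not normalised; averages are divided by its integral.\<close>

definition bump :: "real \<Rightarrow> 'a::real_inner \<Rightarrow> real" where
  "bump \<epsilon> z = (max 0 (\<epsilon>\<^sup>2 - inner z z))\<^sup>2"

lemma bump_has_derivative:
  "(bump \<epsilon> has_derivative (\<lambda>h. (- 4 * max 0 (\<epsilon>\<^sup>2 - inner z z)) * inner z h)) (at z)"
proof -
  have "((\<lambda>z. \<epsilon>\<^sup>2 - inner z z) has_derivative (\<lambda>h. - (2 * inner z h))) (at z)"
    by (rule derivative_eq_intros refl | simp add: inner_commute)+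
  from has_derivative_compose[OF this, of "\<lambda>t. (max 0 t)\<^sup>2", OF DERIV_positive_part_square[unfolded has_field_derivative_def]]
  show ?thesis unfolding bump_def[abs_def] by (simp add: o_def mult_ac)
qed

lemma continuous_on_bump [continuous_intros]:
  "continuous_on S f \<Longrightarrow> continuous_on S (\<lambda>x. bump \<epsilon> (f x))"
  unfolding bump_def by (intro continuous_intros)

lemma bump_nonneg: "0 \<le> bump \<epsilon> z" by (simp add: bump_def)

lemma bump_uminus: "bump \<epsilon> (- z) = bump \<epsilon> z" by (simp add: bump_def)

lemma bump_pos: "norm z < \<epsilon> \<Longrightarrow> 0 < bump \<epsilon> z"
  by (simp add: bump_def power2_norm_eq_inner[symmetric] power2_eq_square mult_strict_mono')

lemma bump_eq_0: "0 \<le> \<epsilon> \<Longrightarrow> \<epsilon> \<le> norm z \<Longrightarrow> bump \<epsilon> z = 0"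
  by (simp add: bump_def power2_norm_eq_inner[symmetric] power_mono)

text \<open>The derivative falls on the kernel, so continuity of \<open>\<phi>\<close> is enough. The vector \<open>g\<close> represents the
  derivative, which differentiation under the integral delivers as a linear form.\<close>

lemma bump_convolution_C1:
  fixes \<phi> :: "'a::euclidean_space \<Rightarrow> real"
  assumes \<phi>: "continuous_on UNIV \<phi>" and U: "open U" "convex U"
  obtains g where "continuous_on U g"
    "\<And>x. x \<in> U \<Longrightarrow> GDERIV (\<lambda>x. integral (cbox a b) (\<lambda>y. \<phi> y * bump \<epsilon> (x - y))) x :> g x"
proof -
  define F where "F x y = (\<phi> y * (- 4 * max 0 (\<epsilon>\<^sup>2 - inner (x - y) (x - y)))) *\<^sub>R blinfun_inner_right (x - y)" for x y :: 'a
  define D where "D x = integral (cbox a b) (F x)" for x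
  have contF: "continuous_on (U \<times> cbox a b) (\<lambda>(x, y). F x y)"
    unfolding F_def split_beta
    by (intro continuous_intros continuous_on_compose2[OF \<phi>]
        bounded_linear.continuous_on[OF bounded_linear_blinfun_inner_right]) auto
  have der: "((\<lambda>x. integral (cbox a b) (\<lambda>y. \<phi> y * bump \<epsilon> (x - y))) has_derivative blinfun_apply (D x)) (at x)"
    if x: "x \<in> U" for x
  proof -
    have "((\<lambda>x. integral (cbox a b) (\<lambda>y. \<phi> y * bump \<epsilon> (x - y))) has_derivative blinfun_apply (integral (cbox a b) (F x))) (at x within U)"
    proof (rule leibniz_rule[OF _ _ contF x U(2)])
      fix x y
      have "((\<lambda>x. bump \<epsilon> (x - y)) has_derivative (\<lambda>h. (- 4 * max 0 (\<epsilon>\<^sup>2 - inner (x - y) (x - y))) * inner (x - y) h)) (at x within U)"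
        by (rule has_derivative_compose[OF _ bump_has_derivative]) (auto intro!: derivative_eq_intros)
      then show "((\<lambda>x. \<phi> y * bump \<epsilon> (x - y)) has_derivative blinfun_apply (F x y)) (at x within U)"
        by (rule has_derivative_eq_rhs[OF has_derivative_mult_right]) (simp add: F_def fun_eq_iff scaleR_blinfun.rep_eq uminus_blinfun.rep_eq)
      show "(\<lambda>y. \<phi> y * bump \<epsilon> (x - y)) integrable_on cbox a b"
        by (intro integrable_continuous continuous_intros continuous_on_subset[OF \<phi>]) auto
    qed
    then show ?thesis using at_within_open[OF x U(1)] by (simp add: D_def)
  qed
  define g where "g x = (\<Sum>i\<in>Basis. blinfun_apply (D x) i *\<^sub>R i)" for x
  have "continuous_on U D"
    unfolding D_def using contF by (rule integral_continuous_on_param)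
  then have "continuous_on U g" unfolding g_def by (intro continuous_intros)
  moreover have "blinfun_apply (D x) = (\<lambda>h. inner h (g x))" for x
  proof
    fix h
    have "blinfun_apply (D x) h = blinfun_apply (D x) (\<Sum>i\<in>Basis. inner h i *\<^sub>R i)" by (simp add: euclidean_representation)
    also have "\<dots> = (\<Sum>i\<in>Basis. inner h i * blinfun_apply (D x) i)" by (simp add: blinfun.sum_right blinfun.scaleR_right)
    also have "\<dots> = inner h (g x)" by (simp add: g_def inner_sum_right mult.commute)
    finally show "blinfun_apply (D x) h = inner h (g x)" .
  qed
  ultimately show ?thesis using der by (intro that[of g]) (auto simp: gderiv_def)
qed

lemma norm_gradient_le:
  assumes g: "GDERIV f x :> g" and K: "\<forall>\<^sub>F y in nhds x. \<bar>f y - f x\<bar> \<le> K * dist y x" and K0: "0 \<le> K"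
  shows "norm g \<le> K"
proof (cases "g = 0")
  case False
  define u where "u t = x + t *\<^sub>R g" for t :: real
  have "((\<lambda>t. f (u t)) has_derivative (\<lambda>t. inner (t *\<^sub>R g) g)) (at 0)"
    by (rule has_derivative_compose[where g = f]) (use g in \<open>auto simp: u_def gderiv_def intro!: derivative_eq_intros\<close>)
  then have "((\<lambda>t. f (u t)) has_real_derivative inner g g) (at 0)"
    by (rule has_derivative_imp_has_field_derivative) simp
  then have lim: "((\<lambda>t. (f (u t) - f x) / t) \<longlongrightarrow> inner g g) (at_right 0)"
    unfolding has_field_derivative_iff by (auto simp: u_def intro: tendsto_within_subset)
  have "(u \<longlongrightarrow> x + 0 *\<^sub>R g) (at_right 0)" unfolding u_def by (intro tendsto_intros)
  then have "filterlim u (nhds x) (at_right 0)" by simp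
  from filterlim_iff[THEN iffD1, OF this, rule_format, OF K]
  have "\<forall>\<^sub>F t in at_right 0. \<bar>f (u t) - f x\<bar> \<le> K * dist (u t) x" .
  then have "\<forall>\<^sub>F t in at_right 0. (f (u t) - f x) / t \<le> K * norm g"
    using eventually_at_right_less
  proof eventually_elim
    case (elim t)
    then show ?case by (simp add: u_def dist_norm divide_le_eq abs_le_iff mult_ac)
  qed
  then have "inner g g \<le> K * norm g"
    by (rule tendsto_upperbound[OF lim]) simp
  then show ?thesis using False by (simp add: power2_norm_eq_inner[symmetric] power2_eq_square)
qed (use K0 in simp)

text \<open>The mollified function, in the form in which it is used: it is C1, and every oscillation bound that holds
  uniformly under translations by at most \<open>\<epsilon>\<close> passes from \<open>\<phi>\<close> to the average. Gradient bounds follow from the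
  third property by \<open>norm_gradient_le\<close>.\<close>

lemma bump_average:
  fixes \<phi> :: "'a::euclidean_space \<Rightarrow> real"
  assumes \<phi>: "continuous_on UNIV \<phi>" and \<epsilon>: "0 < \<epsilon>"
  obtains g \<psi> where "continuous_on (ball 0 R) g" "\<And>x. x \<in> ball 0 R \<Longrightarrow> GDERIV \<psi> x :> g x"
    "\<And>x x' K. (\<And>z. norm z \<le> \<epsilon> \<Longrightarrow> \<bar>\<phi> (x + z) - \<phi> (x' + z)\<bar> \<le> K) \<Longrightarrow> \<bar>\<psi> x - \<psi> x'\<bar> \<le> K"
    "\<And>x K. (\<And>z. norm z \<le> \<epsilon> \<Longrightarrow> \<bar>\<phi> (x + z) - \<phi> x\<bar> \<le> K) \<Longrightarrow> \<bar>\<psi> x - \<phi> x\<bar> \<le> K"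
proof -
  have intg: "integrable lborel (\<lambda>z. f z * bump \<epsilon> z)" if "continuous_on UNIV f" for f :: "'a \<Rightarrow> real"
  proof -
    have "integrable lborel (\<lambda>z. indicator (cball 0 \<epsilon>) z *\<^sub>R (f z * bump \<epsilon> z))"
      by (intro borel_integrable_compact continuous_intros continuous_on_subset[OF that]) auto
    also have "(\<lambda>z. indicator (cball 0 \<epsilon>) z *\<^sub>R (f z * bump \<epsilon> z)) = (\<lambda>z. f z * bump \<epsilon> z)"
      by (intro ext) (use \<epsilon> in \<open>auto simp: indicator_def not_le less_imp_le intro!: bump_eq_0\<close>)
    finally show ?thesis .
  qed
  define Z where "Z = (LINT z|lborel. bump \<epsilon> (z::'a))"
  have intb: "integrable lborel (bump \<epsilon> :: 'a \<Rightarrow> real)" using intg[of "\<lambda>_. 1"] by simp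
  have Z: "0 < Z"
  proof -
    have "Z \<noteq> 0"
    proof
      assume "Z = 0"
      then have "AE z in lborel. bump \<epsilon> (z::'a) = 0"
        unfolding Z_def using intb by (subst (asm) integral_nonneg_eq_0_iff_AE) (auto simp: bump_nonneg)
      then have "AE z in lborel. z \<notin> ball (0::'a) \<epsilon>"
        by (rule AE_mp) (auto intro!: AE_I2 dest: bump_pos)
      then have "emeasure lborel (ball (0::'a) \<epsilon>) = 0"
        by (subst (asm) AE_iff_measurable[of "ball 0 \<epsilon>"]) auto
      then show False using \<epsilon> unit_ball_vol_pos[of "real DIM('a)"] by (auto simp: emeasure_ball zero_less_mult_iff not_le[symmetric])
    qed
    moreover have "0 \<le> Z" unfolding Z_def by (intro integral_nonneg_AE AE_I2 bump_nonneg)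
    ultimately show ?thesis by simp
  qed
  define \<psi> where "\<psi> x = (LINT z|lborel. \<phi> (x + z) * bump \<epsilon> z) / Z" for x
  have sh: "continuous_on UNIV (\<lambda>z. \<phi> (x + z))" for x
    by (intro continuous_on_compose2[OF \<phi>] continuous_intros) auto
  have avg: "\<bar>(LINT z|lborel. f z * bump \<epsilon> z) / Z\<bar> \<le> K"
    if f: "continuous_on UNIV f" and K: "\<And>z. norm z \<le> \<epsilon> \<Longrightarrow> \<bar>f z\<bar> \<le> K" for f :: "'a \<Rightarrow> real" and K
  proof -
    have "\<bar>LINT z|lborel. f z * bump \<epsilon> z\<bar> \<le> (LINT z|lborel. \<bar>f z * bump \<epsilon> z\<bar>)"
      by (rule integral_abs_bound)
    also have "\<dots> \<le> (LINT z|lborel. K * bump \<epsilon> (z::'a))"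
    proof (rule Bochner_Integration.integral_mono)
      show "integrable lborel (\<lambda>z. \<bar>f z * bump \<epsilon> z\<bar>)" using intg[OF f] by (rule integrable_abs)
      show "integrable lborel (\<lambda>z. K * bump \<epsilon> (z::'a))" using intb by simp
      fix z :: 'a
      show "\<bar>f z * bump \<epsilon> z\<bar> \<le> K * bump \<epsilon> z"
      proof (cases "norm z \<le> \<epsilon>")
        case True
        then show ?thesis using K[OF True] bump_nonneg[of \<epsilon> z] by (simp add: abs_mult mult_right_mono)
      next
        case False
        then show ?thesis using bump_eq_0[of \<epsilon> z] \<epsilon> by simp
      qed
    qed
    also have "\<dots> = K * Z" by (simp add: Z_def)
    finally show ?thesis using Z by (simp add: abs_divide divide_le_eq)
  qed
  have p3: "\<bar>\<psi> x - \<psi> x'\<bar> \<le> K" if "\<And>z. norm z \<le> \<epsilon> \<Longrightarrow> \<bar>\<phi> (x + z) - \<phi> (x' + z)\<bar> \<le> K" for x x' K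
  proof -
    have "\<psi> x - \<psi> x' = (LINT z|lborel. (\<phi> (x + z) - \<phi> (x' + z)) * bump \<epsilon> z) / Z"
      using intg[OF sh] by (simp add: \<psi>_def left_diff_distrib diff_divide_distrib)
    then show ?thesis using avg[OF continuous_on_diff[OF sh sh], of x x' K] that by simp
  qed
  have p4: "\<bar>\<psi> x - \<phi> x\<bar> \<le> K" if "\<And>z. norm z \<le> \<epsilon> \<Longrightarrow> \<bar>\<phi> (x + z) - \<phi> x\<bar> \<le> K" for x K
  proof -
    have "(LINT z|lborel. (\<phi> (x + z) - \<phi> x) * bump \<epsilon> z) = (LINT z|lborel. \<phi> (x + z) * bump \<epsilon> z) - \<phi> x * Z"
      using intg[OF sh] intb by (simp add: Z_def left_diff_distrib)
    then have "\<psi> x - \<phi> x = (LINT z|lborel. (\<phi> (x + z) - \<phi> x) * bump \<epsilon> z) / Z"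
      using Z by (simp add: \<psi>_def diff_divide_distrib)
    then show ?thesis using avg[OF continuous_on_diff[OF sh continuous_on_const], of x "\<phi> x" K] that by simp
  qed
  obtain a :: 'a where a: "cball 0 (R + \<epsilon>) \<subseteq> cbox (- a) a"
    using bounded_subset_cbox_symmetric[OF bounded_cball] by blast
  define f where "f x = integral (cbox (- a) a) (\<lambda>y. \<phi> y * bump \<epsilon> (x - y))" for x
  obtain g where g: "continuous_on (ball 0 R) g" "\<And>x. x \<in> ball 0 R \<Longrightarrow> GDERIV f x :> g x"
    using bump_convolution_C1[OF \<phi> open_ball convex_ball] unfolding f_def by blast
  have \<psi>f: "\<psi> x = f x / Z" if x: "x \<in> ball 0 R" for x
  proof -
    have "(LINT z|lborel. \<phi> (x + z) * bump \<epsilon> z) = (LINT z|lborel. (\<lambda>y. \<phi> y * bump \<epsilon> (x - y)) (x + z))"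
      by (simp add: bump_uminus)
    also have "\<dots> = (LINT y|distr lborel borel ((+) x). \<phi> y * bump \<epsilon> (x - y))"
      by (rule integral_distr[symmetric]) (auto intro!: borel_measurable_continuous_onI continuous_intros \<phi>)
    also have "\<dots> = (LINT y|lborel. \<phi> y * bump \<epsilon> (x - y))" by (simp add: lborel_distr_plus)
    also have "\<dots> = (LINT y:cbox (- a) a|lborel. \<phi> y * bump \<epsilon> (x - y))"
      unfolding set_lebesgue_integral_def
    proof (intro Bochner_Integration.integral_cong refl)
      fix y
      show "\<phi> y * bump \<epsilon> (x - y) = indicator (cbox (- a) a) y *\<^sub>R (\<phi> y * bump \<epsilon> (x - y))"
      proof (cases "y \<in> cbox (- a) a")
        case False
        then have "R + \<epsilon> \<le> norm y" using a by (metis linear mem_cball_0 subsetD)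
        then have "\<epsilon> \<le> norm (x - y)" using x norm_triangle_sub[of y x] by (simp add: norm_minus_commute)
        then show ?thesis using bump_eq_0[of \<epsilon> "x - y"] \<epsilon> by simp
      qed simp
    qed
    also have "\<dots> = f x" unfolding f_def
      by (intro set_borel_integral_eq_integral, unfold set_integrable_def, intro borel_integrable_compact continuous_intros continuous_on_subset[OF \<phi>]) auto
    finally show ?thesis by (simp add: \<psi>_def)
  qed
  have "GDERIV \<psi> x :> (1 / Z) *\<^sub>R g x" if x: "x \<in> ball 0 R" for x
  proof -
    have "((\<lambda>x. 1 / Z * f x) has_derivative (\<lambda>h. 1 / Z * inner h (g x))) (at x)"
      using g(2)[OF x] unfolding gderiv_def by (rule has_derivative_mult_right)
    then have "((\<lambda>x. f x / Z) has_derivative (\<lambda>h. inner h ((1 / Z) *\<^sub>R g x))) (at x)" by simp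
    then show ?thesis unfolding gderiv_def
      using has_derivative_transform_within_open[OF _ open_ball x, of "\<lambda>x. f x / Z"] \<psi>f by auto
  qed
  moreover have "continuous_on (ball 0 R) (\<lambda>x. (1 / Z) *\<^sub>R g x)" using g(1) by (intro continuous_intros)
  ultimately show ?thesis using p3 p4 by (intro that[of "\<lambda>x. (1 / Z) *\<^sub>R g x" \<psi>]) auto
qed

section \<open>Approximation by equally weighted points\<close>

lemma sum_list_replicate_concat:
  fixes f :: "'a \<Rightarrow> real"
  shows "sum_list (map f (concat (map (\<lambda>i. replicate (k i) (p i)) [0..<n]))) = (\<Sum>i<n. real (k i) * f (p i))"
  by (induction n) (auto simp: sum_list_replicate)

lemma length_replicate_concat:
  "length (concat (map (\<lambda>i. replicate (k i) (p i)) [0..<n])) = (\<Sum>i<n. k i)"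
  by (induction n) auto

text \<open>Uniformity over all 1-Lipschitz functions is what allows a test function that itself depends on the points.\<close>

definition samples :: "'a::metric_space measure \<Rightarrow> 'a set \<Rightarrow> nat \<Rightarrow> (nat \<Rightarrow> 'a) \<Rightarrow> real \<Rightarrow> bool" where
  "samples \<rho> K N x \<epsilon> \<longleftrightarrow> (\<forall>f. (\<forall>y\<in>K. \<forall>z\<in>K. \<bar>f y - f z\<bar> \<le> dist y z) \<longrightarrow>
     \<bar>(\<Sum>i<N. f (x i)) / real N - (LINT z:K|\<rho>. f z)\<bar> \<le> \<epsilon>)"

text \<open>Round the masses \<open>N * \<mu> (A i)\<close> of small pieces down to integers and place that many points at \<open>p i\<close>; the fewer
  than \<open>n\<close> points left over go to \<open>p 0\<close>. The error is uniform over 1-Lipschitz functions, and every large \<open>N\<close> is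
  possible, so that two measures can be sampled with the same number of points.\<close>

lemma empirical_approximation:
  fixes \<mu> :: "'a::euclidean_space measure"
  assumes prob: "prob_space \<mu>" and sets: "sets \<mu> = sets borel" and K: "compact K" and \<mu>K: "measure \<mu> K = 1" and \<epsilon>: "0 < \<epsilon>"
  obtains N0 :: nat where "\<And>N. N0 \<le> N \<Longrightarrow> \<exists>x. x ` {..<N} \<subseteq> K \<and> samples \<mu> K N x \<epsilon>"
proof -
  interpret prob_space \<mu> by (rule prob)
  note sets [measurable_cong]
  have half: "0 < \<epsilon> / 2" using \<epsilon> by simp
  obtain n :: nat and A p where KA: "K = (\<Union>i<n. A i)" and disj: "disjoint_family_on A {..<n}"
    and Ab: "\<And>i. A i \<in> sets borel" and pK: "\<And>i. i < n \<Longrightarrow> p i \<in> K" and pd: "\<And>i z. z \<in> A i \<Longrightarrow> dist (p i) z < \<epsilon> / 2"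
    using compact_borel_partition[OF K half] by metis
  have Kb: "K \<in> sets borel" using K by (rule borel_compact)
  have n0: "0 < n" using \<mu>K KA by (cases n) auto
  obtain \<Delta> where \<Delta>: "\<And>y z. y \<in> K \<Longrightarrow> z \<in> K \<Longrightarrow> dist y z \<le> \<Delta>" "0 \<le> \<Delta>"
    using compact_imp_bounded[OF K] pK[OF n0] unfolding bounded_two_points by (metis dist_self)
  define w where "w i = measure \<mu> (A i)" for i
  have w0: "0 \<le> w i" for i by (simp add: w_def)
  have wsum: "(\<Sum>i<n. w i) = 1"
    using \<mu>K finite_measure_finite_Union[OF _ _ disj] Ab sets unfolding KA w_def by (auto simp: image_subset_iff)
  obtain N0 :: nat where N0: "2 * n * \<Delta> / \<epsilon> + 1 < N0" using reals_Archimedean2 by blast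
  show ?thesis
  proof (rule that[of N0])
    fix N assume "N0 \<le> N"
    then have N: "2 * n * \<Delta> / \<epsilon> + 1 < N" using N0 by linarith
    have "0 \<le> 2 * n * \<Delta> / \<epsilon>" using \<epsilon> \<Delta>(2) by simp
    then have Npos: "0 < real N" using N by linarith
    have N\<Delta>: "n * (1 / N * \<Delta>) \<le> \<epsilon> / 2" using N Npos \<epsilon> by (simp add: field_simps)
    define k where "k i = nat \<lfloor>N * w i\<rfloor>" for i
    have k: "real (k i) \<le> N * w i" "N * w i < real (k i) + 1" for i
      using w0[of i] by (auto simp: k_def of_nat_nat)
    have "real (\<Sum>i<n. k i) \<le> (\<Sum>i<n. N * w i)" unfolding of_nat_sum by (intro sum_mono k)
    also have "\<dots> = N" using wsum by (simp add: sum_distrib_left[symmetric])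
    finally have kN: "(\<Sum>i<n. k i) \<le> N" by (simp only: of_nat_le_iff)
    define xs where "xs = concat (map (\<lambda>i. replicate (k i) (p i)) [0..<n]) @ replicate (N - (\<Sum>i<n. k i)) (p 0)"
    have len: "length xs = N" using kN by (simp add: xs_def length_replicate_concat)
    have setxs: "set xs \<subseteq> K" using pK n0 by (auto simp: xs_def)
    show "\<exists>x. x ` {..<N} \<subseteq> K \<and> samples \<mu> K N x \<epsilon>"
      unfolding samples_def
    proof (intro exI[of _ "\<lambda>i. xs ! i"] conjI allI impI)
      show "(\<lambda>i. xs ! i) ` {..<N} \<subseteq> K" using setxs len nth_mem[of _ xs] by auto
    next
      fix f :: "'a \<Rightarrow> real" assume f: "\<forall>y\<in>K. \<forall>z\<in>K. \<bar>f y - f z\<bar> \<le> dist y z"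
      define F where "F z = f z - f (p 0)" for z
      have F\<Delta>: "\<bar>F z\<bar> \<le> \<Delta>" if "z \<in> K" for z
        using f[rule_format, OF that pK[OF n0]] \<Delta>(1)[OF that pK[OF n0]] by (simp add: F_def)
      have "1-lipschitz_on K f" using f by (intro lipschitz_onI) (auto simp: dist_real_def)
      then have "continuous_on K F" unfolding F_def by (intro continuous_intros lipschitz_on_continuous_on)
      then have Fm: "(\<lambda>z. indicator K z * F z) \<in> borel_measurable \<mu>"
        using borel_measurable_continuous_on_indicator[OF Kb, of F] by (simp cong: measurable_cong_sets[OF sets refl])
      have FI: "integrable \<mu> (\<lambda>z. indicator K z * F z)"
        using Fm F\<Delta> \<Delta>(2) by (intro integrable_const_bound[of _ \<Delta>]) (auto simp: indicator_def)
      have KI: "integrable \<mu> (\<lambda>z. indicator K z :: real)" using Kb sets by (simp add: less_top[symmetric])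
      have int_f: "(LINT z:K|\<mu>. f z) = (LINT z|\<mu>. indicator K z * F z) + f (p 0)"
      proof -
        have "(LINT z:K|\<mu>. f z) = (LINT z|\<mu>. indicator K z * F z + indicator K z * f (p 0))"
          unfolding set_lebesgue_integral_def F_def by (simp add: algebra_simps)
        also have "\<dots> = (LINT z|\<mu>. indicator K z * F z) + (LINT z|\<mu>. indicator K z * f (p 0))"
          using FI KI by (intro Bochner_Integration.integral_add) auto
        finally show ?thesis using \<mu>K Kb sets by simp
      qed
      have sum_f: "(\<Sum>i<N. f (xs ! i)) / N = (\<Sum>i<n. k i / N * F (p i)) + f (p 0)"
      proof -
        have "(\<Sum>i<N. F (xs ! i)) = sum_list (map F xs)"
          by (simp add: sum_list_sum_nth len atLeast0LessThan)
        also have "\<dots> = (\<Sum>i<n. k i * F (p i))"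
          by (simp add: xs_def sum_list_replicate_concat sum_list_replicate F_def)
        finally have "(\<Sum>i<N. F (xs ! i)) / N = (\<Sum>i<n. k i / N * F (p i))"
          by (simp add: sum_divide_distrib)
        moreover have "(\<Sum>i<N. F (xs ! i)) = (\<Sum>i<N. f (xs ! i)) - N * f (p 0)" by (simp add: F_def sum_subtractf)
        ultimately show ?thesis using Npos by (simp add: diff_divide_distrib)
      qed
      have AI: "integrable \<mu> (\<lambda>z. \<Sum>i<n. F (p i) * indicator (A i) z)"
        using Ab sets by (intro Bochner_Integration.integrable_sum integrable_mult_right) (simp add: less_top[symmetric])
      have int_s: "(LINT z|\<mu>. (\<Sum>i<n. F (p i) * indicator (A i) z)) = (\<Sum>i<n. w i * F (p i))"
        using Ab sets by (subst Bochner_Integration.integral_sum) (auto simp: less_top[symmetric] w_def mult.commute)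
      have close: "\<bar>indicator K z * F z - (\<Sum>i<n. F (p i) * indicator (A i) z)\<bar> \<le> \<epsilon> / 2" for z
      proof (cases "z \<in> K")
        case True
        then obtain i where i: "i < n" "z \<in> A i" using KA by blast
        have "(\<Sum>j<n. F (p j) * indicator (A j) z) = (\<Sum>j\<in>{i}. F (p j) * indicator (A j) z)"
          using i disj by (intro sum.mono_neutral_right) (auto simp: disjoint_family_on_def indicator_def)
        also have "\<dots> = F (p i)" using i by simp
        finally show ?thesis
          using f[rule_format, OF True pK[OF i(1)]] pd[OF i(2)] True by (simp add: F_def dist_commute)
      next
        case False
        then have "(\<Sum>j<n. F (p j) * indicator (A j) z) = 0" using KA by (intro sum.neutral) (auto simp: indicator_def)
        then show ?thesis using False \<epsilon> by simp
      qed
      have "\<bar>(LINT z|\<mu>. indicator K z * F z) - (\<Sum>i<n. w i * F (p i))\<bar>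
          = \<bar>LINT z|\<mu>. indicator K z * F z - (\<Sum>i<n. F (p i) * indicator (A i) z)\<bar>"
        unfolding int_s[symmetric] Bochner_Integration.integral_diff[OF FI AI] ..
      also have "\<dots> \<le> (LINT z|\<mu>. \<bar>indicator K z * F z - (\<Sum>i<n. F (p i) * indicator (A i) z)\<bar>)"
        by (rule integral_abs_bound)
      also have "\<dots> \<le> (LINT z|\<mu>. \<epsilon> / 2)"
        using FI AI close by (intro Bochner_Integration.integral_mono) auto
      finally have e1: "\<bar>(LINT z|\<mu>. indicator K z * F z) - (\<Sum>i<n. w i * F (p i))\<bar> \<le> \<epsilon> / 2" by (simp add: prob_space)
      have "\<bar>(\<Sum>i<n. w i * F (p i)) - (\<Sum>i<n. k i / N * F (p i))\<bar> \<le> (\<Sum>i<n. \<bar>(w i - k i / N) * F (p i)\<bar>)"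
        unfolding sum_subtractf[symmetric] left_diff_distrib[symmetric] by (rule sum_abs)
      also have "\<dots> \<le> (\<Sum>i<n. 1 / N * \<Delta>)"
      proof (intro sum_mono)
        fix i assume "i \<in> {..<n}"
        moreover have "\<bar>w i - k i / N\<bar> \<le> 1 / N"
        proof -
          have "w i - k i / N = (N * w i - k i) / N" using Npos by (simp add: diff_divide_distrib)
          moreover have "\<bar>N * w i - k i\<bar> \<le> 1" using k[of i] by linarith
          ultimately show ?thesis using Npos by (simp add: divide_right_mono)
        qed
        ultimately show "\<bar>(w i - k i / N) * F (p i)\<bar> \<le> 1 / N * \<Delta>"
          unfolding abs_mult using F\<Delta>[OF pK] by (intro mult_mono) auto
      qed
      also have "\<dots> \<le> \<epsilon> / 2" using N\<Delta> by simp
      finally show "\<bar>(\<Sum>i<N. f (xs ! i)) / N - (LINT z:K|\<mu>. f z)\<bar> \<le> \<epsilon>"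
        using e1 unfolding int_f sum_f by linarith
    qed
  qed
qed

section \<open>Compactness of empirical measures\<close>

text \<open>The continuous 2-periodic profile of Schoenberg's space-filling curve: it vanishes on \<open>[0, 1/3]\<close> and equals \<open>1\<close> on
  \<open>[2/3, 1]\<close>, so that it reads off ternary digits \<open>0\<close> and \<open>2\<close>.\<close>

definition switch :: "real \<Rightarrow> real" where
  "switch u = max 0 (min 1 (1 / 2 - cos (pi * u)))"

lemma continuous_on_switch [continuous_intros]:
  fixes f :: "'a::t2_space \<Rightarrow> real"
  shows "continuous_on S f \<Longrightarrow> continuous_on S (\<lambda>x. switch (f x))"
  unfolding switch_def by (intro continuous_intros)

lemma switch_range: "0 \<le> switch u" "switch u \<le> 1" by (auto simp: switch_def)

lemma switch_even_shift: "switch (2 * real n + u) = switch u"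
proof -
  have "pi * (2 * real n + u) = pi * u + real n * (2 * pi)" by (simp add: algebra_simps)
  then show ?thesis using cos.plus_of_nat[of "pi * u" n] by (simp add: switch_def mult_ac)
qed

lemma switch_low: "0 \<le> u \<Longrightarrow> u \<le> 1 / 3 \<Longrightarrow> switch u = 0"
proof -
  assume u: "0 \<le> u" "u \<le> 1 / 3"
  have "cos (pi / 3) \<le> cos (pi * u)" using u by (intro cos_monotone_0_pi_le) auto
  then show ?thesis by (simp add: switch_def cos_60)
qed

lemma switch_high: "2 / 3 \<le> u \<Longrightarrow> u \<le> 1 \<Longrightarrow> switch u = 1"
proof -
  assume u: "2 / 3 \<le> u" "u \<le> 1"
  have "cos (pi * u) \<le> cos (2 * pi / 3)" using u by (intro cos_monotone_0_pi_le) auto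
  then show ?thesis by (simp add: switch_def cos_120)
qed

text \<open>The number \<open>t 0\<close> has ternary digits \<open>2 * d i\<close>. Multiplying it by \<open>3 ^ i\<close> yields an even integer plus the shifted
  expansion \<open>t i\<close>, which lies in \<open>[0, 1/3]\<close> or \<open>[2/3, 1]\<close> according to its leading digit.\<close>

lemma switch_cantor_point:
  fixes d :: "nat \<Rightarrow> nat"
  assumes d: "\<And>i. d i \<le> 1"
  defines "t \<equiv> \<lambda>i. \<Sum>l. 2 * real (d (l + i)) / 3 ^ Suc l"
  shows "0 \<le> t i" "t i \<le> 1" "switch (3 ^ i * t 0) = d i"
proof -
  have geo: "(\<lambda>l. 2 / 3 ^ Suc l) sums (1::real)"
  proof -
    have "(\<lambda>l. 2 / 3 * (1 / 3) ^ l) sums (2 / 3 * (1 / (1 - 1 / 3 :: real)))" by (intro sums_mult geometric_sums) simp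
    moreover have "2 / 3 * (1 / 3) ^ l = (2 / 3 ^ Suc l :: real)" for l by (simp add: power_one_over)
    ultimately show ?thesis by (simp add: mult.commute)
  qed
  have le: "2 * real (d j) / 3 ^ Suc l \<le> 2 / 3 ^ Suc l" for j l using d[of j] by (intro divide_right_mono) auto
  have sm: "summable (\<lambda>l. 2 * real (d (l + i)) / 3 ^ Suc l)" for i
    by (rule summable_comparison_test'[OF sums_summable[OF geo], of 0]) (use le in auto)
  have t0: "0 \<le> t i" for i unfolding t_def by (intro suminf_nonneg sm) auto
  have t1: "t i \<le> 1" for i
  proof -
    have "t i \<le> (\<Sum>l. 2 / 3 ^ Suc l)" unfolding t_def by (intro suminf_le le sm sums_summable[OF geo])
    then show ?thesis using sums_unique[OF geo] by simp
  qed
  show "0 \<le> t i" "t i \<le> 1" by (rule t0, rule t1)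
  have step: "3 * t i = 2 * real (d i) + t (Suc i)" for i
  proof -
    have "t i = (\<Sum>l. 2 * real (d (Suc l + i)) / 3 ^ Suc (Suc l)) + 2 * real (d i) / 3"
      unfolding t_def using suminf_split_head[OF sm[of i]] by simp
    also have "(\<Sum>l. 2 * real (d (Suc l + i)) / 3 ^ Suc (Suc l)) = (\<Sum>l. 1 / 3 * (2 * real (d (l + Suc i)) / 3 ^ Suc l))"
      by (simp add: mult_ac)
    also have "\<dots> = 1 / 3 * t (Suc i)" unfolding t_def by (rule suminf_mult[OF sm])
    finally show ?thesis by simp
  qed
  have "\<exists>n::nat. 3 ^ i * t 0 = 2 * real n + t i" for i
  proof (induction i)
    case 0
    show ?case by (intro exI[of _ 0]) simp
  next
    case (Suc i)
    then obtain n :: nat where n: "3 ^ i * t 0 = 2 * real n + t i" by blast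
    have "3 ^ Suc i * t 0 = 3 * (2 * real n + t i)" using n by simp
    also have "\<dots> = 2 * real (3 * n + d i) + t (Suc i)" using step[of i] by simp
    finally show ?case by blast
  qed
  then obtain n :: nat where "3 ^ i * t 0 = 2 * real n + t i" by blast
  then have "switch (3 ^ i * t 0) = switch (t i)" by (simp add: switch_even_shift)
  also have "\<dots> = d i"
  proof (cases "d i = 0")
    case True
    then have "t i \<le> 1 / 3" using step[of i] t1[of "Suc i"] by simp
    then show ?thesis using switch_low[OF t0] True by simp
  next
    case False
    then have "d i = 1" using d[of i] by simp
    moreover from this have "2 / 3 \<le> t i" using step[of i] t0[of "Suc i"] by simp
    ultimately show ?thesis using switch_high[OF _ t1] by simp
  qed
  finally show "switch (3 ^ i * t 0) = d i" .
qed

lemma binary_expansion: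
  fixes x :: real
  assumes x: "0 \<le> x" "x < 1"
  obtains D :: "nat \<Rightarrow> nat" where "\<And>k. D k \<le> 1" "(\<lambda>k. real (D k) / 2 ^ Suc k) sums x"
proof -
  define a where "a k = nat \<lfloor>2 ^ k * x\<rfloor>" for k
  define D where "D k = a (Suc k) - 2 * a k" for k
  have a: "real (a k) \<le> 2 ^ k * x" "2 ^ k * x < real (a k) + 1" for k
    using x(1) by (auto simp: a_def of_nat_nat)
  have "real (2 * a k) \<le> 2 ^ Suc k * x" "2 ^ Suc k * x < real (2 * a k + 2)" for k using a[of k] by auto
  then have "real (2 * a k) < real (a (Suc k) + 1)" "real (a (Suc k)) < real (2 * a k + 2)" for k
    using a[of "Suc k"] by (smt (verit) of_nat_1 of_nat_add)+
  then have cmp: "2 * a k < a (Suc k) + 1" "a (Suc k) < 2 * a k + 2" for k by (simp_all only: of_nat_less_iff)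
  have D1: "D k \<le> 1" and aS: "a (Suc k) = 2 * a k + D k" for k
    using cmp[of k] by (auto simp: D_def)
  have ps: "(\<Sum>k<K. real (D k) / 2 ^ Suc k) = real (a K) / 2 ^ K" for K
  proof (induction K)
    case 0
    have "a 0 = 0" using a(1)[of 0] x by simp
    then show ?case by simp
  qed (simp add: aS field_simps)
  have "(\<lambda>K. real (a K) / 2 ^ K) \<longlonglongrightarrow> x"
  proof (rule tendsto_sandwich[OF _ _ _ tendsto_const])
    have "(\<lambda>K. x - (1 / 2) ^ K) \<longlonglongrightarrow> x - 0" by (intro tendsto_intros LIMSEQ_power_zero) simp
    then show "(\<lambda>K. x - (1 / 2) ^ K) \<longlonglongrightarrow> x" by simp
    show "\<forall>\<^sub>F K in sequentially. x - (1 / 2) ^ K \<le> real (a K) / 2 ^ K"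
    proof (intro always_eventually allI)
      fix K
      have "x \<le> (real (a K) + 1) / 2 ^ K" using a(2)[of K] by (simp add: pos_le_divide_eq mult.commute)
      then show "x - (1 / 2) ^ K \<le> real (a K) / 2 ^ K" by (simp add: add_divide_distrib power_one_over)
    qed
    show "\<forall>\<^sub>F K in sequentially. real (a K) / 2 ^ K \<le> x"
      using a(1) by (intro always_eventually allI) (simp add: pos_divide_le_eq mult.commute)
  qed
  then have "(\<lambda>k. real (D k) / 2 ^ Suc k) sums x" unfolding sums_def ps .
  with D1 show ?thesis by (rule that)
qed

text \<open>Schoenberg's construction: at a parameter with ternary digits \<open>0\<close> and \<open>2\<close>, the \<open>j\<close>-th of \<open>m\<close> coordinates
  reads as its binary digits every \<open>m\<close>-th of these digits, starting from the \<open>j\<close>-th. Interleaving the binary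
  expansions of prescribed coordinates produces a parameter that is mapped to the given point.\<close>

lemma space_filling_unit_cube:
  obtains F :: "real \<Rightarrow> 'a::euclidean_space" where "continuous_on UNIV F" "bounded (range F)"
    "\<And>z. (\<And>b. b \<in> Basis \<Longrightarrow> 0 \<le> inner z b \<and> inner z b < 1) \<Longrightarrow> z \<in> F ` {0..1}"
proof -
  define m where "m = DIM('a)"
  have m0: "0 < m" by (simp add: m_def)
  obtain e where e: "bij_betw e {..<m} (Basis :: 'a set)"
    using ex_bij_betw_nat_finite[of "Basis :: 'a set"] by (auto simp: m_def atLeast0LessThan)
  define X where "X j t = (\<Sum>k. switch (3 ^ (m * k + j) * t) / 2 ^ Suc k)" for j t
  have half: "(\<lambda>k. 1 / 2 ^ Suc k) sums (1::real)" using power_half_series by (simp add: power_one_over)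
  have dom: "norm (switch u / 2 ^ Suc k) \<le> 1 / 2 ^ Suc k" for u k
    using switch_range[of u] by (auto simp: divide_right_mono)
  have Xcont: "continuous_on UNIV (X j)" for j
    unfolding X_def
  proof (rule uniform_limit_theorem[OF _ Weierstrass_m_test[OF dom sums_summable[OF half]]])
    show "\<forall>\<^sub>F n in sequentially. continuous_on UNIV (\<lambda>t. \<Sum>k<n. switch (3 ^ (m * k + j) * t) / 2 ^ Suc k)"
      by (intro always_eventually allI continuous_intros) auto
  qed simp
  have Xbd: "\<bar>X j t\<bar> \<le> 1" for j t
  proof -
    have sm: "summable (\<lambda>k. switch (3 ^ (m * k + j) * t) / 2 ^ Suc k)"
      by (rule summable_comparison_test'[OF sums_summable[OF half], of 0]) (rule dom)
    have "X j t \<le> (\<Sum>k. 1 / 2 ^ Suc k)"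
      unfolding X_def using switch_range by (intro suminf_le sm sums_summable[OF half] divide_right_mono) auto
    moreover have "0 \<le> X j t" unfolding X_def using switch_range by (intro suminf_nonneg sm) auto
    ultimately show ?thesis using sums_unique[OF half] by simp
  qed
  define F where "F t = (\<Sum>j<m. X j t *\<^sub>R e j)" for t
  have eB: "e j \<in> Basis" if "j < m" for j using bij_betwE[OF e] that by blast
  show ?thesis
  proof (rule that[of F])
    show "continuous_on UNIV F" unfolding F_def by (intro continuous_intros Xcont)
    have "norm (F t) \<le> (\<Sum>j<m. 1)" for t
      unfolding F_def by (rule sum_norm_le) (use Xbd eB in auto)
    then show "bounded (range F)" unfolding bounded_iff by blast
    fix z :: 'a assume z: "\<And>b. b \<in> Basis \<Longrightarrow> 0 \<le> inner z b \<and> inner z b < 1"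
    have "\<exists>D :: nat \<Rightarrow> nat. (\<forall>k. D k \<le> 1) \<and> (\<lambda>k. real (D k) / 2 ^ Suc k) sums (inner z (e j))" if "j < m" for j
      using binary_expansion[of "inner z (e j)"] z[OF eB[OF that]] by metis
    then obtain D :: "nat \<Rightarrow> nat \<Rightarrow> nat" where D: "\<And>j k. j < m \<Longrightarrow> D j k \<le> 1"
      "\<And>j. j < m \<Longrightarrow> (\<lambda>k. real (D j k) / 2 ^ Suc k) sums (inner z (e j))" by metis
    define d where "d i = D (i mod m) (i div m)" for i
    have d1: "d i \<le> 1" for i using D(1)[of "i mod m"] m0 by (simp add: d_def)
    define t where "t = (\<Sum>l. 2 * real (d (l + 0)) / 3 ^ Suc l)"
    have "X j t = inner z (e j)" if "j < m" for j
    proof -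
      have "switch (3 ^ (m * k + j) * t) = D j k" for k
        using switch_cantor_point(3)[of d "m * k + j", OF d1] that by (simp add: t_def d_def)
      then show ?thesis unfolding X_def using sums_unique[OF D(2)[OF that]] by simp
    qed
    then have "F t = (\<Sum>j<m. inner z (e j) *\<^sub>R e j)" by (simp add: F_def)
    also have "\<dots> = (\<Sum>b\<in>Basis. inner z b *\<^sub>R b)" by (rule sum.reindex_bij_betw[OF e])
    also have "\<dots> = z" by (rule euclidean_representation)
    finally show "z \<in> F ` {0..1}"
      using switch_cantor_point(1,2)[of d 0, OF d1] by (intro image_eqI[of _ _ t]) (auto simp: t_def)
  qed
qed

text \<open>Rescaling by \<open>4 * s\<close> places a copy of \<open>C\<close> in \<open>[0, 1/2]\<close> in each coordinate, away from \<open>1\<close>, where the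
  floor-based binary expansion would fail.\<close>

lemma space_filling_curve:
  fixes C :: "'a::euclidean_space set"
  assumes "bounded C"
  obtains F :: "real \<Rightarrow> 'a" where "continuous_on UNIV F" "bounded (range F)" "C \<subseteq> F ` {0..1}"
proof -
  obtain s where s: "0 < s" "\<And>z. z \<in> C \<Longrightarrow> norm z \<le> s"
    using assms by (auto simp: bounded_pos)
  obtain F :: "real \<Rightarrow> 'a" where F: "continuous_on UNIV F" "bounded (range F)"
    "\<And>z. (\<And>b. b \<in> Basis \<Longrightarrow> 0 \<le> inner z b \<and> inner z b < 1) \<Longrightarrow> z \<in> F ` {0..1}"
    using space_filling_unit_cube by blast
  define G where "G t = (4 * s) *\<^sub>R F t - s *\<^sub>R One" for t
  show ?thesis
  proof (rule that[of G])
    show "continuous_on UNIV G" unfolding G_def by (intro continuous_intros F(1))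
    have "range G = (\<lambda>x. x - s *\<^sub>R One) ` ((\<lambda>x. (4 * s) *\<^sub>R x) ` range F)" by (auto simp: G_def image_image)
    then show "bounded (range G)" using F(2) by (simp add: bounded_scaling bounded_translation_minus)
    show "C \<subseteq> G ` {0..1}"
    proof
      fix z assume z: "z \<in> C"
      define u where "u = (1 / (4 * s)) *\<^sub>R (z + s *\<^sub>R One)"
      have "0 \<le> inner u b \<and> inner u b < 1" if b: "b \<in> Basis" for b
      proof -
        have "\<bar>inner z b\<bar> \<le> s" using Basis_le_norm[OF b, of z] s(2)[OF z] by linarith
        moreover have "inner u b = (inner z b + s) / (4 * s)" using b by (simp add: u_def inner_add_left)
        moreover have "0 \<le> (inner z b + s) / (4 * s)" "(inner z b + s) / (4 * s) < 1"
          using \<open>\<bar>inner z b\<bar> \<le> s\<close> s(1) by (auto simp: divide_less_eq_1_pos)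
        ultimately show ?thesis by simp
      qed
      then obtain t where t: "t \<in> {0..1}" "u = F t" using F(3)[of u] by blast
      have "(4 * s) *\<^sub>R u = z + s *\<^sub>R One" using s(1) by (simp add: u_def)
      then have "z = G t" using t(2) by (simp add: G_def)
      with t(1) show "z \<in> G ` {0..1}" by blast
    qed
  qed
qed

text \<open>Weak compactness in several dimensions is reduced to Helly's selection theorem on the line: the points
  are lifted to parameters of a space-filling curve, a subsequence of the lifted measures converges weakly,
  and the limit is pushed forward. Since the curve is continuous and bounded, every continuous function on
  the space becomes a bounded continuous function of the parameter.\<close>

lemma empirical_measures_compact:
  fixes z :: "nat \<Rightarrow> nat \<Rightarrow> 'a::euclidean_space" and N :: "nat \<Rightarrow> nat"
  assumes C: "bounded C" and zC: "\<And>k. z k ` {..<N k} \<subseteq> C" and N: "\<And>k. 0 < N k"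
  shows "\<exists>r \<pi>. strict_mono r \<and> prob_space \<pi> \<and> sets \<pi> = sets borel \<and>
    (\<forall>f :: 'a \<Rightarrow> real. continuous_on UNIV f \<longrightarrow> integrable \<pi> f \<and>
      (\<lambda>k. (\<Sum>i<N (r k). f (z (r k) i)) / N (r k)) \<longlonglongrightarrow> (LINT x|\<pi>. f x))"
proof -
  obtain F :: "real \<Rightarrow> 'a" where F: "continuous_on UNIV F" "bounded (range F)" "C \<subseteq> F ` {0..1}"
    using space_filling_curve[OF C] by blast
  have "\<exists>t. t \<in> {0..1} \<and> F t = z k i" if "i < N k" for k i
  proof -
    have "z k i \<in> F ` {0..1}" using that zC[of k] F(3) by blast
    then show ?thesis by (metis imageE)
  qed
  then have "\<exists>t. \<forall>k i. i < N k \<longrightarrow> t k i \<in> {0..1} \<and> F (t k i) = z k i"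
    by (intro exI[of _ "\<lambda>k i. SOME t. t \<in> {0..1} \<and> F t = z k i"] allI impI) (rule someI_ex)
  then obtain t where t: "\<And>k i. i < N k \<Longrightarrow> t k i \<in> {0..1} \<and> F (t k i) = z k i" by blast
  define M where "M k = distr (measure_pmf (pmf_of_set {..<N k})) borel (t k)" for k
  have ne: "{..<N k} \<noteq> {}" for k using N[of k] by auto
  have M: "real_distribution (M k)" for k
    unfolding M_def by (intro prob_space.real_distribution_distr measure_pmf.prob_space_axioms) simp
  have integral_M: "(LINT x|M k. g x) = (\<Sum>i<N k. g (t k i)) / N k" if "g \<in> borel_measurable borel" for g :: "real \<Rightarrow> real" and k
    unfolding M_def using that ne[of k] by (subst integral_distr) (auto simp: integral_pmf_of_set)
  have "tight M"
    unfolding tight_def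
  proof (intro conjI allI impI M)
    fix \<epsilon> :: real assume "0 < \<epsilon>"
    have "measure (M k) {-1<..1} = 1" for k
    proof -
      have "measure (M k) {-1<..1} = (LINT x|M k. indicator {-1<..1} x)" by (simp add: M_def)
      also have "\<dots> = (\<Sum>i<N k. indicator {-1<..1} (t k i)) / N k" by (rule integral_M) simp
      also have "(\<Sum>i<N k. indicator {-1<..1} (t k i)) = (\<Sum>i<N k. 1 :: real)"
        using t by (intro sum.cong) (auto simp: indicator_def intro: less_le_trans[of "-1" 0])
      finally show ?thesis using N[of k] by simp
    qed
    with \<open>0 < \<epsilon>\<close> show "\<exists>a b. a < b \<and> (\<forall>n. 1 - \<epsilon> < measure (M n) {a<..b})"
      by (intro exI[of _ "-1"] exI[of _ 1]) simp
  qed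
  then obtain r \<rho> where r: "strict_mono r" "real_distribution \<rho>" "weak_conv_m (M \<circ> id \<circ> r) \<rho>"
    using tight_imp_convergent_subsubsequence[OF _ strict_mono_id] by blast
  interpret \<rho>: real_distribution \<rho> by (rule r)
  define \<pi> where "\<pi> = distr \<rho> borel F"
  have Fm: "F \<in> borel_measurable borel" using F(1) by (rule borel_measurable_continuous_onI)
  have Fm': "F \<in> measurable \<rho> borel" using Fm by simp
  have bound: "\<exists>B. \<forall>x. norm (f (F x)) \<le> B" if f: "continuous_on UNIV f" for f :: "'a \<Rightarrow> real"
  proof -
    have "compact (closure (range F))" using F(2) by simp
    then have "bounded (f ` closure (range F))"
      by (intro compact_imp_bounded compact_continuous_image continuous_on_subset[OF f]) auto
    then obtain B where "\<And>y. y \<in> f ` closure (range F) \<Longrightarrow> norm y \<le> B" by (auto simp: bounded_iff)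
    then have "norm (f (F x)) \<le> B" for x using closure_subset[of "range F"] by blast
    then show ?thesis by blast
  qed
  show ?thesis
  proof (intro exI[of _ r] exI[of _ \<pi>] conjI allI impI r(1))
    show "prob_space \<pi>" unfolding \<pi>_def by (rule \<rho>.prob_space_distr[OF Fm'])
    show "sets \<pi> = sets borel" by (simp add: \<pi>_def)
    fix f :: "'a \<Rightarrow> real" assume f: "continuous_on UNIV f"
    have fm: "f \<in> borel_measurable borel" using f by (rule borel_measurable_continuous_onI)
    obtain B where B: "\<And>x. norm (f (F x)) \<le> B" using bound[OF f] by blast
    have fF: "continuous_on UNIV (\<lambda>x. f (F x))" using continuous_on_compose2[OF f F(1)] by simp
    have fFm: "(\<lambda>x. f (F x)) \<in> borel_measurable borel" using fF by (rule borel_measurable_continuous_onI)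
    have "integrable \<rho> (\<lambda>x. f (F x))"
      using B fFm by (intro \<rho>.integrable_const_bound[of _ B]) auto
    then show "integrable \<pi> f" unfolding \<pi>_def using Fm' fm by (simp add: integrable_distr_eq)
    have "(\<lambda>n. integral\<^sup>L ((M \<circ> id \<circ> r) n) (\<lambda>x. f (F x))) \<longlonglongrightarrow> integral\<^sup>L \<rho> (\<lambda>x. f (F x))"
    proof (rule weak_conv_imp_integral_bdd_continuous_conv[OF _ r(2,3) _ B])
      show "real_distribution ((M \<circ> id \<circ> r) n)" for n using M by simp
      show "isCont (\<lambda>x. f (F x)) x" for x using fF by (simp add: continuous_on_eq_continuous_at)
    qed
    moreover have "integral\<^sup>L ((M \<circ> id \<circ> r) n) (\<lambda>x. f (F x)) = (\<Sum>i<N (r n). f (z (r n) i)) / N (r n)" for n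
    proof -
      have "(\<Sum>i<N (r n). f (F (t (r n) i))) = (\<Sum>i<N (r n). f (z (r n) i))" using t by (intro sum.cong) auto
      then show ?thesis using integral_M[OF fFm, of "r n"] by simp
    qed
    moreover have "integral\<^sup>L \<rho> (\<lambda>x. f (F x)) = (LINT x|\<pi>. f x)"
      unfolding \<pi>_def using Fm' fm by (subst integral_distr) auto
    ultimately show "(\<lambda>k. (\<Sum>i<N (r k). f (z (r k) i)) / N (r k)) \<longlonglongrightarrow> (LINT x|\<pi>. f x)" by simp
  qed
qed

section \<open>Marginals and weak duality\<close>

text \<open>Each point off the support has a null neighbourhood, and countably many of these cover the complement by the Lindelof property.\<close>

lemma measure_complement_support:
  fixes \<mu> :: "'a::second_countable_topology measure"
  assumes sets: "sets \<mu> = sets borel" and supp: "measure_support \<mu> \<subseteq> C" and C: "closed C"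
  shows "emeasure \<mu> (- C) = 0"
proof -
  define \<U> where "\<U> = {U. open U \<and> emeasure \<mu> U = 0}"
  obtain \<V> where V: "\<V> \<subseteq> \<U>" "countable \<V>" "\<Union>\<V> = \<Union>\<U>"
    using Lindelof[of \<U>] by (auto simp: \<U>_def)
  have "(\<Union>U\<in>\<V>. U) \<in> null_sets \<mu>"
    using V(1,2) sets by (intro null_sets_UN') (auto simp: \<U>_def null_sets_def)
  moreover have "- C \<subseteq> \<Union>\<V>"
  proof
    fix x assume "x \<in> - C"
    then have "x \<notin> measure_support \<mu>" using supp by blast
    then obtain U where "open U" "x \<in> U" "emeasure \<mu> U = 0" by (auto simp: measure_support_def)
    then show "x \<in> \<Union>\<V>" unfolding V(3) by (auto simp: \<U>_def)
  qed
  moreover have "- C \<in> sets \<mu>" using C sets by auto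
  ultimately have "- C \<in> null_sets \<mu>" by (metis image_ident null_sets_subset)
  then show ?thesis by (rule null_setsD1)
qed

text \<open>The Lipschitz functions \<open>max 0 (1 - n * infdist x F)\<close> decrease to the indicator of a nonempty closed set \<open>F\<close>, and closed
  sets generate the Borel sets.\<close>

lemma measure_eqI_lipschitz:
  fixes M N :: "'a::metric_space measure"
  assumes M: "prob_space M" "sets M = sets borel" and N: "prob_space N" "sets N = sets borel"
    and eq: "\<And>f :: 'a \<Rightarrow> real. (\<And>x y. \<bar>f x - f y\<bar> \<le> dist x y) \<Longrightarrow> (\<And>x. 0 \<le> f x \<and> f x \<le> 1) \<Longrightarrow> (LINT x|M. f x) = (LINT x|N. f x)"
  shows "M = N"
proof -
  interpret M: prob_space M by (rule M)
  interpret N: prob_space N by (rule N)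
  note M(2) [measurable_cong] note N(2) [measurable_cong]
  have closed_eq: "emeasure M F = emeasure N F" if F: "closed F" for F
  proof (cases "F = {}")
    case False
    define g where "g n x = max 0 (1 - real (Suc n) * infdist x F)" for n x
    have gm [measurable]: "g n \<in> borel_measurable borel" for n
      unfolding g_def[abs_def] by (intro borel_measurable_continuous_onI continuous_intros)
    have g01: "0 \<le> g n x" "g n x \<le> 1" for n x by (auto simp: g_def infdist_nonneg)
    have lip: "\<bar>g n x / real (Suc n) - g n y / real (Suc n)\<bar> \<le> dist x y" for n x y
    proof -
      have "\<bar>g n x - g n y\<bar> \<le> \<bar>real (Suc n) * infdist x F - real (Suc n) * infdist y F\<bar>"
        unfolding g_def by linarith
      also have "\<dots> = real (Suc n) * \<bar>infdist x F - infdist y F\<bar>"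
        unfolding right_diff_distrib[symmetric] abs_mult by simp
      also have "\<dots> \<le> real (Suc n) * dist x y"
        using infdist_triangle_abs[of x F y] by (intro mult_left_mono) auto
      finally show ?thesis
        unfolding diff_divide_distrib[symmetric] abs_divide by (simp add: pos_divide_le_eq mult.commute del: of_nat_Suc)
    qed
    have "(LINT x|M. g n x) = (LINT x|N. g n x)" for n
    proof -
      have "0 \<le> g n x / real (Suc n) \<and> g n x / real (Suc n) \<le> 1" for x
      proof -
        have "g n x \<le> real (Suc n)" using g01[of n x] by simp
        then show ?thesis using g01[of n x] by (simp del: of_nat_Suc)
      qed
      from eq[OF lip this] show ?thesis by (simp del: of_nat_Suc)
    qed
    moreover have lim: "(\<lambda>n. g n x) \<longlonglongrightarrow> indicator F x" for x
    proof (cases "x \<in> F")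
      case True
      then show ?thesis by (simp add: g_def)
    next
      case x: False
      then have pos: "0 < infdist x F"
        using in_closed_iff_infdist_zero[OF F \<open>F \<noteq> {}\<close>, of x] infdist_nonneg[of x F] by simp
      obtain m :: nat where m: "1 / infdist x F < m" using reals_Archimedean2 by blast
      have "g n x = 0" if "m \<le> n" for n
      proof -
        have "1 / infdist x F \<le> real (Suc n)" using m that by simp
        then show ?thesis using pos by (simp add: g_def pos_divide_le_eq del: of_nat_Suc)
      qed
      then have "\<forall>\<^sub>F n in sequentially. g n x = indicator F x"
        using x by (auto simp: eventually_sequentially)
      then show ?thesis by (rule tendsto_eventually)
    qed
    have [measurable]: "F \<in> sets borel" using F by (rule borel_closed)
    have "(\<lambda>n. LINT x|M. g n x) \<longlonglongrightarrow> (LINT x|M. indicator F x)"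
      using g01 lim by (intro integral_dominated_convergence[where w = "\<lambda>_. 1"]) auto
    moreover have "(\<lambda>n. LINT x|N. g n x) \<longlonglongrightarrow> (LINT x|N. indicator F x)"
      using g01 lim by (intro integral_dominated_convergence[where w = "\<lambda>_. 1"]) auto
    ultimately have "(LINT x|M. indicator F x :: real) = (LINT x|N. indicator F x)"
      by (simp add: LIMSEQ_unique)
    then have "measure M F = measure N F" using F M(2) N(2) by simp
    then show ?thesis by (simp add: M.emeasure_eq_measure N.emeasure_eq_measure)
  qed simp
  show ?thesis
  proof (rule measure_eqI_generator_eq[where E = "Collect closed" and \<Omega> = UNIV and A = "\<lambda>_. UNIV"])
    show "Int_stable (Collect closed :: 'a set set)" by (auto simp: Int_stable_def)
    show "emeasure M X = emeasure N X" if "X \<in> Collect closed" for X using closed_eq that by simp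
    show "sets M = sigma_sets UNIV (Collect closed)" "sets N = sigma_sets UNIV (Collect closed)"
      unfolding M(2) N(2) borel_eq_closed by simp_all
    show "emeasure M UNIV \<noteq> \<infinity>" for i :: nat by simp
  qed auto
qed

definition admissible_potentials ::
    "(real ^ 'n) set \<Rightarrow> ennreal \<Rightarrow> (real ^ 'n \<Rightarrow> real) \<Rightarrow> (real ^ 'n \<Rightarrow> real) set" where
  "admissible_potentials S a b = {\<phi> \<in> C1_cube. (\<forall>x\<in>S. norm (cube_gradient \<phi> x) \<le> b x) \<and>
     (\<forall>x\<in>cube - S. ennreal (norm (cube_gradient \<phi> x)) \<le> a)}"

lemma prob_cube:
  fixes \<mu> :: "(real ^ 'n) measure"
  assumes "borel_prob \<mu>" "measure_support \<mu> \<subseteq> cube"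
  shows "measure \<mu> cube = 1" "AE x in \<mu>. x \<in> cube"
proof -
  have sets: "sets \<mu> = sets borel" and "prob_space \<mu>" using assms(1) by (auto simp: borel_prob_def)
  interpret prob_space \<mu> by fact
  have closed: "closed (cube :: (real ^ 'n) set)" by (rule compact_imp_closed[OF compact_cube])
  then have ev: "- cube \<in> sets \<mu>" "cube \<in> sets \<mu>" using sets by auto
  have null: "emeasure \<mu> (- cube) = 0" by (rule measure_complement_support[OF sets assms(2) closed])
  then show AE: "AE x in \<mu>. x \<in> cube"
    using ev sets_eq_imp_space_eq[OF sets] by (intro AE_I[of _ _ "- cube"]) auto
  show "measure \<mu> cube = 1" using AE ev by (simp add: prob_eq_1)
qed

lemma cube_integrable:
  fixes \<mu> :: "(real ^ 'n) measure"
  assumes "borel_prob \<mu>" "continuous_on cube f"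
  shows "integrable \<mu> (\<lambda>x. indicator cube x * f x :: real)"
proof -
  have sets: "sets \<mu> = sets borel" and "prob_space \<mu>" using assms(1) by (auto simp: borel_prob_def)
  interpret prob_space \<mu> by fact
  have "bounded (f ` cube)" using compact_imp_bounded[OF compact_continuous_image[OF assms(2) compact_cube]] .
  then obtain B where B: "\<And>x. x \<in> cube \<Longrightarrow> \<bar>f x\<bar> \<le> B" by (auto simp: bounded_iff)
  then have "0 \<le> B" using zero_in_cube by (metis abs_ge_zero order_trans)
  have "(\<lambda>x. indicator cube x *\<^sub>R f x) \<in> borel_measurable borel"
    by (rule borel_measurable_continuous_on_indicator[OF borel_compact[OF compact_cube] assms(2)])
  then have "(\<lambda>x. indicator cube x * f x) \<in> borel_measurable \<mu>" by (simp cong: measurable_cong_sets[OF sets refl])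
  then show ?thesis using B \<open>0 \<le> B\<close> by (intro integrable_const_bound[of _ B]) (auto simp: indicator_def)
qed

lemma couplings_distr:
  fixes \<mu> \<nu> :: "'a::second_countable_topology measure"
  assumes "\<pi> \<in> couplings \<mu> \<nu>" "borel_prob \<mu>" "borel_prob \<nu>"
  shows "distr \<pi> borel fst = \<mu>" "distr \<pi> borel snd = \<nu>"
proof -
  have sets: "sets \<pi> = sets borel" using assms(1) by (auto simp: couplings_def borel_prob_def)
  have space: "space \<pi> = UNIV" using sets_eq_imp_space_eq[OF sets] by simp
  have m: "fst \<in> measurable \<pi> borel" "snd \<in> measurable \<pi> borel"
    unfolding measurable_cong_sets[OF sets refl]
    by (rule borel_measurable_continuous_onI, intro continuous_intros)+
  have pre: "fst -` B = B \<times> UNIV" "snd -` B = UNIV \<times> B" for B :: "'a set" by auto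
  show "distr \<pi> borel fst = \<mu>"
  proof (rule measure_eqI)
    show "sets (distr \<pi> borel fst) = sets \<mu>" using assms(2) by (simp add: borel_prob_def)
    fix B assume "B \<in> sets (distr \<pi> borel fst)"
    then show "emeasure (distr \<pi> borel fst) B = emeasure \<mu> B"
      using assms(1) m(1) by (simp add: emeasure_distr space pre couplings_def)
  qed
  show "distr \<pi> borel snd = \<nu>"
  proof (rule measure_eqI)
    show "sets (distr \<pi> borel snd) = sets \<nu>" using assms(3) by (simp add: borel_prob_def)
    fix B assume "B \<in> sets (distr \<pi> borel snd)"
    then show "emeasure (distr \<pi> borel snd) B = emeasure \<nu> B"
      using assms(1) m(2) by (simp add: emeasure_distr space pre couplings_def)
  qed
qed

text \<open>Integrate the pointwise inequality against the coupling. The positive part is inserted because the cost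
  is a nonnegative extended integral.\<close>

lemma potential_difference_le_transport_cost:
  fixes \<mu> \<nu> :: "(real ^ 'n) measure"
  assumes \<mu>: "borel_prob \<mu>" "measure_support \<mu> \<subseteq> cube" and \<nu>: "borel_prob \<nu>" "measure_support \<nu> \<subseteq> cube"
    and \<pi>: "\<pi> \<in> couplings \<mu> \<nu>" and \<phi>: "continuous_on cube \<phi>"
    and le: "\<And>x y. x \<in> cube \<Longrightarrow> y \<in> cube \<Longrightarrow> ennreal (\<phi> x - \<phi> y) \<le> d x y"
  shows "ennreal ((LINT x:cube|\<mu>. \<phi> x) - (LINT x:cube|\<nu>. \<phi> x)) \<le> (\<integral>\<^sup>+z. d (fst z) (snd z) \<partial>\<pi>)"
proof -
  define \<Phi> where "\<Phi> x = indicator cube x * \<phi> x" for x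
  note dst = couplings_distr[OF \<pi> \<mu>(1) \<nu>(1)]
  have sets: "sets \<pi> = sets borel" using \<pi> by (auto simp: couplings_def borel_prob_def)
  have m: "fst \<in> measurable \<pi> borel" "snd \<in> measurable \<pi> borel"
    unfolding measurable_cong_sets[OF sets refl]
    by (rule borel_measurable_continuous_onI, intro continuous_intros)+
  have \<Phi>m: "\<Phi> \<in> borel_measurable borel"
    using borel_measurable_continuous_on_indicator[OF borel_compact[OF compact_cube] \<phi>] by (simp add: \<Phi>_def[abs_def])
  have I: "integrable \<mu> \<Phi>" "integrable \<nu> \<Phi>" unfolding \<Phi>_def using cube_integrable \<mu>(1) \<nu>(1) \<phi> by blast+
  then have I': "integrable \<pi> (\<lambda>z. \<Phi> (fst z))" "integrable \<pi> (\<lambda>z. \<Phi> (snd z))"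
    using \<Phi>m m dst by (auto simp: integrable_distr_eq[symmetric])
  have eqs: "(LINT x:cube|\<mu>. \<phi> x) = (LINT z|\<pi>. \<Phi> (fst z))" "(LINT x:cube|\<nu>. \<phi> x) = (LINT z|\<pi>. \<Phi> (snd z))"
    using integral_distr[OF m(1) \<Phi>m] integral_distr[OF m(2) \<Phi>m] dst
    by (simp_all add: set_lebesgue_integral_def \<Phi>_def[abs_def])
  have "(LINT x:cube|\<mu>. \<phi> x) - (LINT x:cube|\<nu>. \<phi> x) = (LINT z|\<pi>. \<Phi> (fst z) - \<Phi> (snd z))"
    using I' eqs by simp
  also have "\<dots> \<le> (LINT z|\<pi>. max 0 (\<Phi> (fst z) - \<Phi> (snd z)))"
    using I' by (intro Bochner_Integration.integral_mono) auto
  finally have "ennreal ((LINT x:cube|\<mu>. \<phi> x) - (LINT x:cube|\<nu>. \<phi> x)) \<le> ennreal (LINT z|\<pi>. max 0 (\<Phi> (fst z) - \<Phi> (snd z)))"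
    by (rule ennreal_leI)
  also have "\<dots> = (\<integral>\<^sup>+z. ennreal (max 0 (\<Phi> (fst z) - \<Phi> (snd z))) \<partial>\<pi>)"
    using I' by (intro nn_integral_eq_integral[symmetric]) auto
  also have "\<dots> \<le> (\<integral>\<^sup>+z. d (fst z) (snd z) \<partial>\<pi>)"
  proof (rule nn_integral_mono_AE)
    have "AE x in distr \<pi> borel fst. x \<in> cube" "AE x in distr \<pi> borel snd. x \<in> cube"
      unfolding dst by (rule prob_cube(2)[OF \<mu>], rule prob_cube(2)[OF \<nu>])
    from AE_distrD[OF m(1) this(1)] AE_distrD[OF m(2) this(2)]
    have "AE z in \<pi>. fst z \<in> cube" "AE z in \<pi>. snd z \<in> cube" .
    then show "AE z in \<pi>. ennreal (max 0 (\<Phi> (fst z) - \<Phi> (snd z))) \<le> d (fst z) (snd z)"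
    proof eventually_elim
      case (elim z)
      then show ?case using le[OF elim] by (simp add: \<Phi>_def max_def ennreal_neg)
    qed
  qed
  finally show ?thesis .
qed

section \<open>Nearly optimal discrete couplings\<close>

text \<open>By \<open>chain_dist_le_local\<close>, a function that is 1-Lipschitz for the chain distance has slope at most \<open>c\<close>. Averaging at
  scale \<open>\<delta>\<close> replaces \<open>c u\<close> by values of \<open>c\<close> within distance \<open>2 * \<delta>\<close> of \<open>u\<close>, hence by at most \<open>c u + 2 * L * \<delta>\<close>. As \<open>c \<ge> c0\<close>, this is at
  most \<open>s * c u\<close>, and dividing by \<open>s\<close> restores admissibility.\<close>

lemma chain_potential_smoothing:
  fixes \<phi> :: "real ^ 'n \<Rightarrow> real"
  assumes S: "S \<subseteq> cube" and b: "\<And>x. x \<in> S \<Longrightarrow> 0 \<le> b x"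
    and c: "chain_cost c h c0 B L" and cf: "\<And>x. ennreal (c x) \<le> friction S a b x"
    and \<phi>d: "\<And>z z'. \<phi> z - \<phi> z' \<le> chain_dist c h z z'" and \<delta>: "0 < \<delta>" and s_def: "s = 1 + 2 * L * \<delta> / c0"
  obtains \<psi> where "(\<lambda>u. 1 / s * \<psi> u) \<in> admissible_potentials S a b"
    "\<And>u v. \<bar>\<psi> u - \<psi> v\<bar> \<le> B * dist u v" "\<And>u. \<bar>\<psi> u - \<phi> u\<bar> \<le> B * \<delta>"
proof -
  interpret chain_cost c h c0 B L by (rule c)
  define d where "d = chain_dist c h"
  note \<phi>d = \<phi>d[folded d_def]
  have \<phi>B: "\<bar>\<phi> z - \<phi> z'\<bar> \<le> B * dist z z'" for z z'
    using \<phi>d[of z z'] \<phi>d[of z' z] chain_dist_le_dist[of z z'] chain_dist_le_dist[of z' z]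
    by (simp add: d_def dist_commute abs_le_iff)
  then have "B-lipschitz_on UNIV \<phi>" using B_pos by (intro lipschitz_onI) (auto simp: dist_real_def)
  then have \<phi>c: "continuous_on UNIV \<phi>" by (rule lipschitz_on_continuous_on)
  obtain R where R: "cube \<subseteq> ball (0 :: real ^ 'n) R"
    using compact_imp_bounded[OF compact_cube] bounded_subset_ballD[of cube 0] by metis
  obtain g \<psi> where gc: "continuous_on (ball 0 R) g" and gd: "\<And>x. x \<in> ball 0 R \<Longrightarrow> GDERIV \<psi> x :> g x"
    and \<psi>1: "\<And>x x' K. (\<And>z. norm z \<le> \<delta> \<Longrightarrow> \<bar>\<phi> (x + z) - \<phi> (x' + z)\<bar> \<le> K) \<Longrightarrow> \<bar>\<psi> x - \<psi> x'\<bar> \<le> K"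
    and \<psi>2: "\<And>x K. (\<And>z. norm z \<le> \<delta> \<Longrightarrow> \<bar>\<phi> (x + z) - \<phi> x\<bar> \<le> K) \<Longrightarrow> \<bar>\<psi> x - \<phi> x\<bar> \<le> K"
  proof (rule bump_average[OF \<phi>c \<delta>, where R = R])
    fix g \<psi>
    assume "continuous_on (ball 0 R) g" "\<And>x. x \<in> ball 0 R \<Longrightarrow> GDERIV \<psi> x :> g x"
      "\<And>x x' K. (\<And>z. norm z \<le> \<delta> \<Longrightarrow> \<bar>\<phi> (x + z) - \<phi> (x' + z)\<bar> \<le> K) \<Longrightarrow> \<bar>\<psi> x - \<psi> x'\<bar> \<le> K"
      "\<And>x K. (\<And>z. norm z \<le> \<delta> \<Longrightarrow> \<bar>\<phi> (x + z) - \<phi> x\<bar> \<le> K) \<Longrightarrow> \<bar>\<psi> x - \<phi> x\<bar> \<le> K"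
    then show thesis by (rule that)
  qed
  have \<psi>B: "\<bar>\<psi> u - \<psi> v\<bar> \<le> B * dist u v" for u v
  proof (rule \<psi>1)
    fix z show "\<bar>\<phi> (u + z) - \<phi> (v + z)\<bar> \<le> B * dist u v" using \<phi>B[of "u + z" "v + z"] by simp
  qed
  have \<psi>\<phi>: "\<bar>\<psi> u - \<phi> u\<bar> \<le> B * \<delta>" for u
  proof (rule \<psi>2)
    fix z :: "real ^ 'n" assume "norm z \<le> \<delta>"
    then have "B * norm z \<le> B * \<delta>" using B_pos by (intro mult_left_mono) auto
    then show "\<bar>\<phi> (u + z) - \<phi> u\<bar> \<le> B * \<delta>" using \<phi>B[of "u + z" u] by (simp add: dist_norm)
  qed
  have gbound: "norm (g u) \<le> c u + L * (2 * \<delta>)" if u: "u \<in> ball 0 R" for u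
  proof (rule norm_gradient_le[OF gd[OF u]])
    have nn: "0 \<le> L * (2 * \<delta>)" using L \<delta> by simp
    then show "0 \<le> c u + L * (2 * \<delta>)" using c_ge[of u] c0 by linarith
    have "\<forall>\<^sub>F v in nhds u. dist v u < min h \<delta>" using h \<delta> unfolding eventually_nhds_metric by (intro exI[of _ "min h \<delta>"]) auto
    then show "\<forall>\<^sub>F v in nhds u. \<bar>\<psi> v - \<psi> u\<bar> \<le> (c u + L * (2 * \<delta>)) * dist v u"
    proof eventually_elim
      case (elim v)
      show ?case
      proof (rule \<psi>1)
        fix z :: "real ^ 'n" assume z: "norm z \<le> \<delta>"
        have cw: "c w \<le> c u + L * (2 * \<delta>)" if "dist w u \<le> 2 * \<delta>" for w
          using c_lip[of w u] mult_left_mono[OF that L] by linarith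
        have "c (v + z) \<le> c u + L * (2 * \<delta>)"
        proof (rule cw)
          have "dist (v + z) u \<le> dist v u + norm z"
            using norm_triangle_ineq[of "v - u" z] by (simp add: dist_norm algebra_simps)
          then show "dist (v + z) u \<le> 2 * \<delta>" using elim z by simp
        qed
        moreover have "c (u + z) \<le> c u + L * (2 * \<delta>)" using z \<delta> by (intro cw) (simp add: dist_norm)
        moreover have "dist (v + z) (u + z) \<le> h" "dist (u + z) (v + z) \<le> h" using elim by (simp_all add: dist_commute)
        note chain_dist_le_local[OF this(1)] chain_dist_le_local[OF this(2)]
        moreover have "\<phi> (v + z) - \<phi> (u + z) \<le> d (v + z) (u + z)" "\<phi> (u + z) - \<phi> (v + z) \<le> d (u + z) (v + z)"
          by (rule \<phi>d)+
        ultimately show "\<bar>\<phi> (v + z) - \<phi> (u + z)\<bar> \<le> (c u + L * (2 * \<delta>)) * dist v u"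
          unfolding d_def by (smt (verit, best) dist_add_cancel2 dist_commute mult_right_mono zero_le_dist)
      qed
    qed
  qed
  have s: "1 \<le> s" using L \<delta> c0 by (simp add: s_def)
  have gs: "norm (g u) \<le> s * c u" if "u \<in> ball 0 R" for u
  proof -
    have "L * (2 * \<delta>) = 2 * L * \<delta> / c0 * c0" using c0 by simp
    also have "\<dots> \<le> 2 * L * \<delta> / c0 * c u" using L \<delta> c0 c_ge[of u] by (intro mult_left_mono) auto
    finally have "c u + L * (2 * \<delta>) \<le> s * c u" by (simp add: s_def distrib_right)
    then show ?thesis using gbound[OF that] by linarith
  qed
  have \<psi>c: "continuous_on cube \<psi>"
  proof -
    have "B-lipschitz_on cube \<psi>" using B_pos \<psi>B by (intro lipschitz_onI) (auto simp: dist_real_def)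
    then show ?thesis by (rule lipschitz_on_continuous_on)
  qed
  define \<zeta> where "\<zeta> u = 1 / s * \<psi> u" for u
  have grad: "is_gradient_on_cube \<zeta> (\<lambda>u. (1 / s) *\<^sub>R g u)"
    unfolding is_gradient_on_cube_def
  proof (intro conjI ballI)
    show "continuous_on cube (\<lambda>u. (1 / s) *\<^sub>R g u)"
      by (intro continuous_intros continuous_on_subset[OF gc R])
    fix u :: "real ^ 'n" assume "u \<in> open_cube"
    then have "u \<in> ball 0 R" using R by (auto simp: open_cube_def cube_def less_imp_le subset_iff)
    from gd[OF this] have "((\<lambda>u. 1 / s * \<psi> u) has_derivative (\<lambda>h. 1 / s * inner h (g u))) (at u)"
      unfolding gderiv_def by (rule has_derivative_mult_right)
    then show "GDERIV \<zeta> u :> (1 / s) *\<^sub>R g u" unfolding gderiv_def \<zeta>_def by simp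
  qed
  have \<zeta>grad: "norm (cube_gradient \<zeta> u) \<le> c u" if "u \<in> cube" for u
    using gs[of u] subsetD[OF R that] s cube_gradient_eq[OF grad that] by (simp add: pos_divide_le_eq mult.commute)
  have "\<zeta> \<in> admissible_potentials S a b"
    unfolding admissible_potentials_def C1_cube_def
  proof (intro CollectI conjI ballI)
    show "continuous_on cube \<zeta>" unfolding \<zeta>_def by (intro continuous_intros \<psi>c)
    show "\<exists>g. is_gradient_on_cube \<zeta> g" using grad by blast
    show "norm (cube_gradient \<zeta> u) \<le> b u" if "u \<in> S" for u
    proof -
      have "ennreal (c u) \<le> ennreal (b u)" using cf[of u] that by (simp add: friction_def)
      then have "c u \<le> b u" using b[OF that] by (simp add: ennreal_le_iff)
      then show ?thesis using \<zeta>grad[of u] that S by (meson order_trans subsetD)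
    qed
    show "ennreal (norm (cube_gradient \<zeta> u)) \<le> a" if "u \<in> cube - S" for u
    proof -
      have "ennreal (norm (cube_gradient \<zeta> u)) \<le> ennreal (c u)" using \<zeta>grad that by (intro ennreal_leI) auto
      also have "\<dots> \<le> a" using cf[of u] that by (simp add: friction_def)
      finally show ?thesis .
    qed
  qed
  then show ?thesis using \<psi>B \<psi>\<phi> unfolding \<zeta>_def by (rule that)
qed

text \<open>Sample both measures with the same number of points and match them optimally for the chain distance. The
  dual potential of the matching, smoothed and rescaled, is admissible, so the hypothesis on \<open>M\<close> bounds
  the cost of the matching. The two sources of error are smoothing, at most \<open>Q * \<delta>\<close>, and sampling, at most \<open>2 * B * \<epsilon>'\<close>;
  each is made at most \<open>\<epsilon> / 2\<close>.\<close>

lemma discrete_coupling: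
  fixes \<mu> \<nu> :: "(real ^ 'n) measure"
  assumes \<mu>: "borel_prob \<mu>" "measure_support \<mu> \<subseteq> cube" and \<nu>: "borel_prob \<nu>" "measure_support \<nu> \<subseteq> cube"
    and S: "S \<subseteq> cube" and b: "\<And>x. x \<in> S \<Longrightarrow> 0 \<le> b x"
    and c: "chain_cost c h c0 B L" and cf: "\<And>x. ennreal (c x) \<le> friction S a b x"
    and M: "0 \<le> M" "\<And>\<phi>. \<phi> \<in> admissible_potentials S a b \<Longrightarrow> (LINT x:cube|\<mu>. \<phi> x) - (LINT x:cube|\<nu>. \<phi> x) \<le> M"
    and \<epsilon>: "0 < \<epsilon>"
  shows "\<exists>N z. 0 < N \<and> (\<forall>i<N. z i \<in> cube \<times> cube) \<and>
    (\<Sum>i<N. chain_dist c h (fst (z i)) (snd (z i))) / real N \<le> M + \<epsilon> \<and>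
    samples \<mu> cube N (\<lambda>i. fst (z i)) \<epsilon> \<and> samples \<nu> cube N (\<lambda>i. snd (z i)) \<epsilon>"
proof -
  interpret chain_cost c h c0 B L by (rule c)
  define d where "d = chain_dist c h"
  \<comment> \<open>Smoothing at scale \<open>\<delta>\<close> costs \<open>2 * L * \<delta> / c0 * M\<close> through the rescaling and \<open>2 * B * \<delta>\<close> through the change of the potential.\<close>
  define Q where "Q = 2 * L * M / c0 + 2 * B"
  have Q: "0 < Q" using B_pos L M(1) c0 by (simp add: Q_def add_nonneg_pos)
  define \<delta> where "\<delta> = \<epsilon> / (2 * Q)"
  have \<delta>: "0 < \<delta>" "Q * \<delta> = \<epsilon> / 2" using \<epsilon> Q by (auto simp: \<delta>_def)
  define \<epsilon>' where "\<epsilon>' = min \<epsilon> (\<epsilon> / (4 * B))"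
  have \<epsilon>': "0 < \<epsilon>'" "\<epsilon>' \<le> \<epsilon>" "2 * B * \<epsilon>' \<le> \<epsilon> / 2"
  proof -
    show "0 < \<epsilon>'" "\<epsilon>' \<le> \<epsilon>" using \<epsilon> B_pos by (auto simp: \<epsilon>'_def)
    have "2 * B * \<epsilon>' \<le> 2 * B * (\<epsilon> / (4 * B))" using B_pos by (intro mult_left_mono) (auto simp: \<epsilon>'_def)
    then show "2 * B * \<epsilon>' \<le> \<epsilon> / 2" using B_pos by simp
  qed
  have p\<mu>: "prob_space \<mu>" "sets \<mu> = sets borel" and p\<nu>: "prob_space \<nu>" "sets \<nu> = sets borel"
    using \<mu>(1) \<nu>(1) by (auto simp: borel_prob_def)
  obtain N1 where N1: "\<And>N. N1 \<le> N \<Longrightarrow> \<exists>x. x ` {..<N} \<subseteq> cube \<and> samples \<mu> cube N x \<epsilon>'"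
    using empirical_approximation[OF p\<mu> compact_cube prob_cube(1)[OF \<mu>] \<epsilon>'(1)] by metis
  obtain N2 where N2: "\<And>N. N2 \<le> N \<Longrightarrow> \<exists>x. x ` {..<N} \<subseteq> cube \<and> samples \<nu> cube N x \<epsilon>'"
    using empirical_approximation[OF p\<nu> compact_cube prob_cube(1)[OF \<nu>] \<epsilon>'(1)] by metis
  define N where "N = Suc (max N1 N2)"
  have N0: "0 < N" and N12: "N1 \<le> N" "N2 \<le> N" by (simp_all add: N_def)
  obtain x where x: "x ` {..<N} \<subseteq> cube" and xf: "samples \<mu> cube N x \<epsilon>'" using N1[OF N12(1)] by blast
  obtain y where y: "y ` {..<N} \<subseteq> cube" and yf: "samples \<nu> cube N y \<epsilon>'" using N2[OF N12(2)] by blast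
  have drefl: "d z z = 0" for z
    using chain_dist_le_dist[of z z] chain_dist_nonneg[of z z] by (simp add: d_def)
  have A: "finite {..<N}" "{..<N} \<noteq> {}" using N0 by auto
  obtain \<sigma> \<phi> where \<sigma>: "\<sigma> permutes {..<N}" and \<phi>d: "\<And>z z'. \<phi> z - \<phi> z' \<le> d z z'"
    and opt: "\<And>i. i < N \<Longrightarrow> d (x i) (y (\<sigma> i)) \<le> \<phi> (x i) - \<phi> (y (\<sigma> i))"
    using assignment_duality[of "{..<N}" d x y, OF A drefl chain_dist_triangle[folded d_def]] by (metis lessThan_iff)
  have \<sigma>N: "\<sigma> i < N" if "i < N" for i using permutes_in_image[OF \<sigma>, of i] that by simp
  have reindex: "(\<Sum>i<N. f (y (\<sigma> i))) = (\<Sum>i<N. f (y i))" for f :: "real ^ 'n \<Rightarrow> real"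
    using sum.permute[OF \<sigma>, of "\<lambda>i. f (y i)"] by (simp add: o_def)
  define s where "s = 1 + 2 * L * \<delta> / c0"
  have s: "1 \<le> s" using L \<delta>(1) c0 by (simp add: s_def)
  obtain \<psi> where adm: "(\<lambda>u. 1 / s * \<psi> u) \<in> admissible_potentials S a b"
    and \<psi>B: "\<And>u v. \<bar>\<psi> u - \<psi> v\<bar> \<le> B * dist u v" and \<psi>\<phi>: "\<And>u. \<bar>\<psi> u - \<phi> u\<bar> \<le> B * \<delta>"
    using chain_potential_smoothing[OF S b c cf \<phi>d[unfolded d_def] \<delta>(1) s_def] by metis
  from M(2)[OF adm] have "(LINT u:cube|\<mu>. \<psi> u) / s - (LINT u:cube|\<nu>. \<psi> u) / s \<le> M" by simp
  then have \<psi>M: "(LINT u:cube|\<mu>. \<psi> u) - (LINT u:cube|\<nu>. \<psi> u) \<le> s * M"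
    using s by (simp add: diff_divide_distrib[symmetric] pos_divide_le_eq mult.commute)
  have \<psi>lip: "\<bar>\<psi> u / B - \<psi> v / B\<bar> \<le> dist u v" for u v
    using \<psi>B[of u v] B_pos by (simp add: diff_divide_distrib[symmetric] abs_divide pos_divide_le_eq mult.commute)
  have x\<psi>: "\<bar>(\<Sum>i<N. \<psi> (x i)) / N - (LINT u:cube|\<mu>. \<psi> u)\<bar> \<le> B * \<epsilon>'"
  proof -
    have "\<bar>((\<Sum>i<N. \<psi> (x i)) / N - (LINT u:cube|\<mu>. \<psi> u)) / B\<bar> \<le> \<epsilon>'"
      using xf[unfolded samples_def, rule_format, of "\<lambda>u. \<psi> u / B"] \<psi>lip by (simp add: sum_divide_distrib[symmetric] diff_divide_distrib mult.commute)
    then show ?thesis using B_pos by (simp add: abs_divide pos_divide_le_eq mult.commute)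
  qed
  have y\<psi>: "\<bar>(\<Sum>i<N. \<psi> (y i)) / N - (LINT u:cube|\<nu>. \<psi> u)\<bar> \<le> B * \<epsilon>'"
  proof -
    have "\<bar>((\<Sum>i<N. \<psi> (y i)) / N - (LINT u:cube|\<nu>. \<psi> u)) / B\<bar> \<le> \<epsilon>'"
      using yf[unfolded samples_def, rule_format, of "\<lambda>u. \<psi> u / B"] \<psi>lip by (simp add: sum_divide_distrib[symmetric] diff_divide_distrib mult.commute)
    then show ?thesis using B_pos by (simp add: abs_divide pos_divide_le_eq mult.commute)
  qed
  define z where "z i = (x i, y (\<sigma> i))" for i
  have "(\<Sum>i<N. d (fst (z i)) (snd (z i))) \<le> (\<Sum>i<N. \<psi> (x i) - \<psi> (y (\<sigma> i)) + 2 * (B * \<delta>))"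
  proof (rule sum_mono)
    fix i assume "i \<in> {..<N}"
    then show "d (fst (z i)) (snd (z i)) \<le> \<psi> (x i) - \<psi> (y (\<sigma> i)) + 2 * (B * \<delta>)"
      using opt[of i] \<psi>\<phi>[of "x i"] \<psi>\<phi>[of "y (\<sigma> i)"] unfolding z_def fst_conv snd_conv lessThan_iff by linarith
  qed
  also have "\<dots> = (\<Sum>i<N. \<psi> (x i)) - (\<Sum>i<N. \<psi> (y i)) + N * (2 * (B * \<delta>))"
    by (simp add: sum.distrib sum_subtractf reindex)
  finally have "(\<Sum>i<N. d (fst (z i)) (snd (z i))) / N \<le> ((\<Sum>i<N. \<psi> (x i)) - (\<Sum>i<N. \<psi> (y i)) + N * (2 * (B * \<delta>))) / N"
    by (rule divide_right_mono) simp
  also have "\<dots> = (\<Sum>i<N. \<psi> (x i)) / N - (\<Sum>i<N. \<psi> (y i)) / N + 2 * (B * \<delta>)"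
    using N0 by (simp add: add_divide_distrib diff_divide_distrib)
  also have "\<dots> \<le> s * M + 2 * B * \<epsilon>' + 2 * (B * \<delta>)" using x\<psi> y\<psi> \<psi>M by linarith
  also have "s * M + 2 * (B * \<delta>) = M + Q * \<delta>" by (simp add: s_def Q_def algebra_simps)
  then have "s * M + 2 * B * \<epsilon>' + 2 * (B * \<delta>) \<le> M + \<epsilon>" using \<epsilon>'(3) \<delta>(2) by linarith
  finally have cost: "(\<Sum>i<N. d (fst (z i)) (snd (z i))) / N \<le> M + \<epsilon>" .
  show ?thesis
  proof (intro exI[of _ N] exI[of _ z] conjI allI impI)
    show "0 < N" by (rule N0)
    show "z i \<in> cube \<times> cube" if "i < N" for i using x y \<sigma>N[OF that] that by (auto simp: z_def)
    show "(\<Sum>i<N. chain_dist c h (fst (z i)) (snd (z i))) / real N \<le> M + \<epsilon>" using cost by (simp add: d_def)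
    show "samples \<mu> cube N (\<lambda>i. fst (z i)) \<epsilon>" "samples \<nu> cube N (\<lambda>i. snd (z i)) \<epsilon>"
      using xf yf \<epsilon>'(2) unfolding samples_def z_def fst_conv snd_conv reindex by (meson order_trans)+
  qed
qed

section \<open>Strong duality\<close>

lemma couplingsI:
  fixes \<mu> \<nu> :: "'a::second_countable_topology measure"
  assumes \<pi>: "borel_prob \<pi>" and m: "distr \<pi> borel fst = \<mu>" "distr \<pi> borel snd = \<nu>"
  shows "\<pi> \<in> couplings \<mu> \<nu>"
proof -
  have sets: "sets \<pi> = sets borel" using \<pi> by (auto simp: borel_prob_def)
  have space: "space \<pi> = UNIV" using sets_eq_imp_space_eq[OF sets] by simp
  have meas: "fst \<in> measurable \<pi> borel" "snd \<in> measurable \<pi> borel"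
    unfolding measurable_cong_sets[OF sets refl]
    by (rule borel_measurable_continuous_onI, intro continuous_intros)+
  have pre: "fst -` B = B \<times> UNIV" "snd -` B = UNIV \<times> B" for B :: "'a set" by auto
  have "emeasure \<mu> B = emeasure \<pi> (B \<times> UNIV)" "emeasure \<nu> B = emeasure \<pi> (UNIV \<times> B)" if "B \<in> sets borel" for B
    using that meas unfolding m[symmetric] by (simp_all add: emeasure_distr space pre)
  then show ?thesis using \<pi> by (simp add: couplings_def)
qed

text \<open>The product measure, needed in the degenerate case where all distances vanish.\<close>

lemma couplings_nonempty:
  fixes \<mu> \<nu> :: "'a::second_countable_topology measure"
  assumes "borel_prob \<mu>" "borel_prob \<nu>"
  shows "couplings \<mu> \<nu> \<noteq> {}"
proof -
  have s: "sets \<mu> = sets borel" "sets \<nu> = sets borel" and p: "prob_space \<mu>" "prob_space \<nu>"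
    using assms by (auto simp: borel_prob_def)
  interpret P: pair_prob_space \<mu> \<nu> using p by (simp add: pair_prob_space_def pair_sigma_finite_def prob_space_imp_sigma_finite)
  have "sets (\<mu> \<Otimes>\<^sub>M \<nu>) = sets (borel :: ('a \<times> 'a) measure)"
    unfolding borel_prod[symmetric] by (intro sets_pair_measure_cong s)
  then have b: "borel_prob (\<mu> \<Otimes>\<^sub>M \<nu>)" using P.prob_space_axioms by (simp add: borel_prob_def)
  have sp: "space \<mu> = UNIV" "space \<nu> = UNIV" using s[THEN sets_eq_imp_space_eq] by simp_all
  have "emeasure (\<mu> \<Otimes>\<^sub>M \<nu>) (B \<times> UNIV) = emeasure \<mu> B" "emeasure (\<mu> \<Otimes>\<^sub>M \<nu>) (UNIV \<times> B) = emeasure \<nu> B"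
    if "B \<in> sets borel" for B
    using that s sp P.M1.emeasure_space_1 P.M2.emeasure_space_1
    by (simp_all add: P.M2.emeasure_pair_measure_Times)
  with b have "\<mu> \<Otimes>\<^sub>M \<nu> \<in> couplings \<mu> \<nu>" by (simp add: couplings_def)
  then show ?thesis by blast
qed

lemma urban_metric_zero:
  fixes x y :: "'a::euclidean_space"
  shows "urban_metric {} 0 b x y = 0"
proof -
  define \<gamma> where "\<gamma> t = x + t *\<^sub>R (y - x)" for t :: real
  have "(norm (y - x))-lipschitz_on {0..1} \<gamma>"
  proof (rule lipschitz_onI)
    fix s t :: real
    have "\<gamma> s - \<gamma> t = (s - t) *\<^sub>R (y - x)" by (simp add: \<gamma>_def scaleR_diff_left)
    then show "dist (\<gamma> s) (\<gamma> t) \<le> norm (y - x) * dist s t" by (simp add: dist_norm mult.commute)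
  qed simp
  then have "\<gamma> \<in> lipschitz_paths x y" by (auto simp: lipschitz_paths_def \<gamma>_def)
  then have "urban_metric {} 0 b x y \<le> 0" unfolding urban_metric_def by (rule INF_lower2) simp
  then show ?thesis by simp
qed

text \<open>A subsequence of the approximate couplings has a weak limit \<open>\<pi>\<close>. Its marginals are determined by Lipschitz functions. Since
  \<open>d j \<le> d k\<close> for \<open>j \<le> k\<close>, the limit satisfies \<open>\<integral> d j \<le> M\<close> for each fixed continuous \<open>d j\<close>, and monotone convergence
  gives the supremum.\<close>

lemma coupling_of_limit:
  fixes \<mu> \<nu> :: "(real ^ 'n) measure" and d :: "nat \<Rightarrow> real ^ 'n \<Rightarrow> real ^ 'n \<Rightarrow> real"
  assumes \<mu>: "borel_prob \<mu>" "measure_support \<mu> \<subseteq> cube" and \<nu>: "borel_prob \<nu>" "measure_support \<nu> \<subseteq> cube"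
    and d0: "\<And>k x y. 0 \<le> d k x y"
    and cont: "\<And>k x y x' y'. \<bar>d k x y - d k x' y'\<bar> \<le> B k * (dist x x' + dist y y')"
    and mono: "\<And>j k x y. j \<le> k \<Longrightarrow> d j x y \<le> d k x y"
    and approx: "\<And>k \<epsilon>. 0 < \<epsilon> \<Longrightarrow> \<exists>N z. 0 < N \<and> (\<forall>i<N. z i \<in> cube \<times> cube) \<and>
    (\<Sum>i<N. d k (fst (z i)) (snd (z i))) / real N \<le> M + \<epsilon> \<and>
    samples \<mu> cube N (\<lambda>i. fst (z i)) \<epsilon> \<and> samples \<nu> cube N (\<lambda>i. snd (z i)) \<epsilon>"
  shows "\<exists>\<pi>\<in>couplings \<mu> \<nu>. (\<integral>\<^sup>+z. (SUP k. ennreal (d k (fst z) (snd z))) \<partial>\<pi>) \<le> ennreal M"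
proof -
  define e where "e k = inverse (real (Suc k))" for k
  have e: "0 < e k" for k by (simp add: e_def)
  have elim0: "e \<longlonglongrightarrow> 0" unfolding e_def[abs_def] by (rule LIMSEQ_inverse_real_of_nat)
  define good where "good k N z \<longleftrightarrow> 0 < N \<and> (\<forall>i<N. z i \<in> cube \<times> cube) \<and>
    (\<Sum>i<N. d k (fst (z i)) (snd (z i))) / real N \<le> M + e k \<and>
    samples \<mu> cube N (\<lambda>i. fst (z i)) (e k) \<and> samples \<nu> cube N (\<lambda>i. snd (z i)) (e k)" for k N and z :: "nat \<Rightarrow> (real ^ 'n) \<times> (real ^ 'n)"
  have "\<exists>N z. good k N z" for k unfolding good_def by (rule approx[OF e])
  then obtain N z where good: "\<And>k. good k (N k) (z k)" by metis
  have Nz: "\<And>k. 0 < N k" "\<And>k i. i < N k \<Longrightarrow> z k i \<in> cube \<times> cube"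
    and cost: "\<And>k. (\<Sum>i<N k. d k (fst (z k i)) (snd (z k i))) / real (N k) \<le> M + e k"
    using good unfolding good_def by blast+
  have marg: "\<bar>(\<Sum>i<N k. f (fst (z k i))) / N k - (LINT x:cube|\<mu>. f x)\<bar> \<le> e k"
    "\<bar>(\<Sum>i<N k. f (snd (z k i))) / N k - (LINT x:cube|\<nu>. f x)\<bar> \<le> e k"
    if "\<And>x y. \<bar>f x - f y\<bar> \<le> dist x y" for k f
    using good[of k] that unfolding good_def samples_def by simp_all
  have "bounded (cube \<times> cube :: ((real ^ 'n) \<times> (real ^ 'n)) set)"
    using compact_imp_bounded[OF compact_cube] by (intro bounded_Times)
  moreover have "z k ` {..<N k} \<subseteq> cube \<times> cube" for k using Nz(2) by blast
  ultimately have "\<exists>r \<pi>. strict_mono r \<and> prob_space \<pi> \<and> sets \<pi> = sets borel \<and>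
    (\<forall>f :: (real ^ 'n) \<times> (real ^ 'n) \<Rightarrow> real. continuous_on UNIV f \<longrightarrow> integrable \<pi> f \<and>
      (\<lambda>k. (\<Sum>i<N (r k). f (z (r k) i)) / N (r k)) \<longlonglongrightarrow> (LINT x|\<pi>. f x))"
    using Nz(1) by (rule empirical_measures_compact)
  then
  obtain r \<pi> where r: "strict_mono r" and \<pi>: "prob_space \<pi>" "sets \<pi> = sets borel"
    and conv: "\<forall>f :: (real ^ 'n) \<times> (real ^ 'n) \<Rightarrow> real. continuous_on UNIV f \<longrightarrow> integrable \<pi> f \<and>
      (\<lambda>k. (\<Sum>i<N (r k). f (z (r k) i)) / N (r k)) \<longlonglongrightarrow> (LINT x|\<pi>. f x)"
    by (elim exE conjE)
  have I: "integrable \<pi> f"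
    and L: "(\<lambda>k. (\<Sum>i<N (r k). f (z (r k) i)) / N (r k)) \<longlonglongrightarrow> (LINT x|\<pi>. f x)"
    if "continuous_on UNIV f" for f :: "(real ^ 'n) \<times> (real ^ 'n) \<Rightarrow> real"
    using conv that by blast+
  have er: "(\<lambda>k. e (r k)) \<longlonglongrightarrow> 0" using LIMSEQ_subseq_LIMSEQ[OF elim0 r] by (simp add: o_def)
  have bp: "borel_prob \<pi>" using \<pi> by (simp add: borel_prob_def)
  have meas: "fst \<in> measurable \<pi> borel" "snd \<in> measurable \<pi> borel"
    unfolding measurable_cong_sets[OF \<pi>(2) refl]
    by (rule borel_measurable_continuous_onI, intro continuous_intros)+
  have cube_full: "(LINT x:cube|\<rho>. f x) = (LINT x|\<rho>. f x)"
    if \<rho>: "borel_prob \<rho>" "measure_support \<rho> \<subseteq> cube" and f: "f \<in> borel_measurable borel"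
    for \<rho> and f :: "real ^ 'n \<Rightarrow> real"
    unfolding set_lebesgue_integral_def
  proof (rule integral_cong_AE)
    have sets: "sets \<rho> = sets borel" using \<rho>(1) by (simp add: borel_prob_def)
    have cm: "cube \<in> sets (borel :: (real ^ 'n) measure)" by (rule borel_compact[OF compact_cube])
    show "(\<lambda>x. indicator cube x *\<^sub>R f x) \<in> borel_measurable \<rho>" "f \<in> borel_measurable \<rho>"
      unfolding measurable_cong_sets[OF sets refl] using f cm by (auto intro!: borel_measurable_scaleR borel_measurable_indicator)
    show "AE x in \<rho>. indicator cube x *\<^sub>R f x = f x"
      using prob_cube(2)[OF \<rho>] by eventually_elim simp
  qed
  have avg_lim: "(\<lambda>k. (\<Sum>i<N (r k). g (z (r k) i)) / N (r k)) \<longlonglongrightarrow> m"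
    if "\<And>k. \<bar>(\<Sum>i<N k. g (z k i)) / N k - m\<bar> \<le> e k" for g m
  proof -
    have "(\<lambda>k. (\<Sum>i<N (r k). g (z (r k) i)) / N (r k) - m) \<longlonglongrightarrow> 0"
      by (rule Lim_null_comparison[OF _ er]) (use that in simp)
    then show ?thesis by (rule LIM_zero_cancel)
  qed
  have lipc: "continuous_on UNIV f" if "\<And>x y. \<bar>f x - f y\<bar> \<le> dist x y" for f :: "real ^ 'n \<Rightarrow> real"
  proof -
    have "1-lipschitz_on UNIV f" using that by (intro lipschitz_onI) (auto simp: dist_real_def)
    then show ?thesis by (rule lipschitz_on_continuous_on)
  qed
  have m1: "distr \<pi> borel fst = \<mu>"
  proof (rule measure_eqI_lipschitz)
    show "prob_space (distr \<pi> borel fst)" by (rule prob_space.prob_space_distr[OF \<pi>(1) meas(1)])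
    show "prob_space \<mu>" "sets \<mu> = sets borel" using \<mu>(1) by (auto simp: borel_prob_def)
    fix f :: "real ^ 'n \<Rightarrow> real" assume f: "\<And>x y. \<bar>f x - f y\<bar> \<le> dist x y"
    have fc: "continuous_on UNIV f" by (rule lipc[OF f])
    have fm: "f \<in> borel_measurable borel" by (rule borel_measurable_continuous_onI[OF fc])
    have "continuous_on UNIV (\<lambda>w :: (real ^ 'n) \<times> (real ^ 'n). f (fst w))"
      by (rule continuous_on_compose2[OF fc]) (auto intro: continuous_intros)
    from L[OF this] avg_lim[OF marg(1)[OF f]]
    have "(LINT w|\<pi>. f (fst w)) = (LINT x:cube|\<mu>. f x)" by (rule LIMSEQ_unique)
    then show "(LINT x|distr \<pi> borel fst. f x) = (LINT x|\<mu>. f x)"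
      using cube_full[OF \<mu> fm] by (simp add: integral_distr[OF meas(1) fm])
  qed simp
  have m2: "distr \<pi> borel snd = \<nu>"
  proof (rule measure_eqI_lipschitz)
    show "prob_space (distr \<pi> borel snd)" by (rule prob_space.prob_space_distr[OF \<pi>(1) meas(2)])
    show "prob_space \<nu>" "sets \<nu> = sets borel" using \<nu>(1) by (auto simp: borel_prob_def)
    fix f :: "real ^ 'n \<Rightarrow> real" assume f: "\<And>x y. \<bar>f x - f y\<bar> \<le> dist x y"
    have fc: "continuous_on UNIV f" by (rule lipc[OF f])
    have fm: "f \<in> borel_measurable borel" by (rule borel_measurable_continuous_onI[OF fc])
    have "continuous_on UNIV (\<lambda>w :: (real ^ 'n) \<times> (real ^ 'n). f (snd w))"
      by (rule continuous_on_compose2[OF fc]) (auto intro: continuous_intros)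
    from L[OF this] avg_lim[OF marg(2)[OF f]]
    have "(LINT w|\<pi>. f (snd w)) = (LINT x:cube|\<nu>. f x)" by (rule LIMSEQ_unique)
    then show "(LINT x|distr \<pi> borel snd. f x) = (LINT x|\<nu>. f x)"
      using cube_full[OF \<nu> fm] by (simp add: integral_distr[OF meas(2) fm])
  qed simp
  have dc: "continuous_on UNIV (\<lambda>w. d k (fst w) (snd w))" for k
  proof -
    have "(2 * \<bar>B k\<bar>)-lipschitz_on UNIV (\<lambda>w. d k (fst w) (snd w))"
    proof (rule lipschitz_onI)
      fix v w :: "(real ^ 'n) \<times> (real ^ 'n)"
      have "\<bar>d k (fst v) (snd v) - d k (fst w) (snd w)\<bar> \<le> B k * (dist (fst v) (fst w) + dist (snd v) (snd w))"
        by (rule cont)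
      also have "\<dots> \<le> \<bar>B k\<bar> * (dist v w + dist v w)"
        using dist_fst_le[of v w] dist_snd_le[of v w] by (intro mult_mono add_mono) auto
      finally show "dist (d k (fst v) (snd v)) (d k (fst w) (snd w)) \<le> 2 * \<bar>B k\<bar> * dist v w"
        by (simp add: dist_real_def)
    qed simp
    then show ?thesis by (rule lipschitz_on_continuous_on)
  qed
  have int_d: "(LINT w|\<pi>. d j (fst w) (snd w)) \<le> M" for j
  proof (rule tendsto_le[OF _ _ L[OF dc]])
    show "(\<lambda>k. M + e (r k)) \<longlonglongrightarrow> M" using tendsto_add[OF tendsto_const er, of M] by simp
    have "\<forall>\<^sub>F k in sequentially. j \<le> r k"
      using seq_suble[OF r] by (auto simp: eventually_sequentially intro: order_trans)
    then show "\<forall>\<^sub>F k in sequentially. (\<Sum>i<N (r k). d j (fst (z (r k) i)) (snd (z (r k) i))) / N (r k) \<le> M + e (r k)"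
    proof eventually_elim
      case (elim k)
      have "(\<Sum>i<N (r k). d j (fst (z (r k) i)) (snd (z (r k) i))) / N (r k) \<le> (\<Sum>i<N (r k). d (r k) (fst (z (r k) i)) (snd (z (r k) i))) / N (r k)"
        by (intro divide_right_mono sum_mono mono elim) simp
      also have "\<dots> \<le> M + e (r k)" by (rule cost)
      finally show ?case .
    qed
  qed simp
  have "(\<integral>\<^sup>+w. (SUP k. ennreal (d k (fst w) (snd w))) \<partial>\<pi>) = (SUP k. \<integral>\<^sup>+w. ennreal (d k (fst w) (snd w)) \<partial>\<pi>)"
  proof (rule nn_integral_monotone_convergence_SUP)
    show "incseq (\<lambda>k w. ennreal (d k (fst w) (snd w)))"
      using mono by (auto simp: incseq_def le_fun_def intro!: ennreal_leI)
    show "(\<lambda>w. ennreal (d k (fst w) (snd w))) \<in> borel_measurable \<pi>" for k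
      using borel_measurable_integrable[OF I[OF dc]] by simp
  qed
  also have "\<dots> \<le> ennreal M"
  proof (rule SUP_least)
    fix k
    have "(\<integral>\<^sup>+w. ennreal (d k (fst w) (snd w)) \<partial>\<pi>) = ennreal (LINT w|\<pi>. d k (fst w) (snd w))"
      by (rule nn_integral_eq_integral[OF I[OF dc]]) (simp add: d0)
    also have "\<dots> \<le> ennreal M" by (intro ennreal_leI int_d)
    finally show "(\<integral>\<^sup>+w. ennreal (d k (fst w) (snd w)) \<partial>\<pi>) \<le> ennreal M" .
  qed
  finally show ?thesis using couplingsI[OF bp m1 m2] by blast
qed

text \<open>The jump size \<open>1 / (k + 1)\<^sup>2\<close> is chosen against the weight bound \<open>k + 1\<close>: a single jump then costs at most
  \<open>1 / (k + 1)\<close>, so the midpoint error of the chain distances vanishes in the limit.\<close>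

lemma wasserstein_le_potentials:
  fixes \<mu> \<nu> :: "(real ^ 'n) measure"
  assumes \<mu>: "borel_prob \<mu>" "measure_support \<mu> \<subseteq> cube" and \<nu>: "borel_prob \<nu>" "measure_support \<nu> \<subseteq> cube"
    and S: "S \<subseteq> cube" "S \<in> sets borel" and b: "\<And>x. x \<in> S \<Longrightarrow> 0 \<le> b x"
    and lsc: "lower_semicontinuous_on UNIV (friction S a b)"
    and c0: "0 < c0" "c0 \<le> 1" "\<And>x. ennreal c0 \<le> friction S a b x"
    and M: "0 \<le> M" "\<And>\<phi>. \<phi> \<in> admissible_potentials S a b \<Longrightarrow> (LINT x:cube|\<mu>. \<phi> x) - (LINT x:cube|\<nu>. \<phi> x) \<le> M"
  shows "wasserstein (urban_metric S a b) \<mu> \<nu> \<le> ennreal M"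
proof -
  define c where "c = lipschitz_envelope (friction S a b)"
  define h where "h k = 1 / (real (Suc k))\<^sup>2" for k
  have cc: "chain_cost (c k) (h k) c0 (real (Suc k)) (real (Suc k))" for k
    unfolding chain_cost_def c_def
    using c0 lipschitz_envelope_ge[of c0 "friction S a b"] lipschitz_envelope_le_Suc lipschitz_envelope_lipschitz
    by (auto simp: h_def simp del: of_nat_Suc)
  have cf: "ennreal (c k x) \<le> friction S a b x" for k x unfolding c_def by (rule lipschitz_envelope_le_self)
  have cmono: "c j x \<le> c k x" if "j \<le> k" for j k x unfolding c_def using that by (rule lipschitz_envelope_mono)
  have hmono: "h k \<le> h j" if "j \<le> k" for j k
    unfolding h_def using that by (intro divide_left_mono power_mono) auto
  have "(\<lambda>k. real (Suc k) * h k) = (\<lambda>k. inverse (real (Suc k)))"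
    by (auto simp: h_def power2_eq_square field_simps simp del: of_nat_Suc)
  then have Bh: "(\<lambda>k. real (Suc k) * h k) \<longlonglongrightarrow> 0" using LIMSEQ_inverse_real_of_nat by simp
  have sup: "(SUP k. ennreal (c k x)) = friction S a b x" for x
    unfolding c_def by (rule SUP_lipschitz_envelope[OF lsc])
  define d where "d k = chain_dist (c k) (h k)" for k
  have "\<exists>\<pi>\<in>couplings \<mu> \<nu>. (\<integral>\<^sup>+z. (SUP k. ennreal (d k (fst z) (snd z))) \<partial>\<pi>) \<le> ennreal M"
  proof (rule coupling_of_limit[OF \<mu> \<nu>])
    show "0 \<le> d k x y" for k x y unfolding d_def by (rule chain_cost.chain_dist_nonneg[OF cc])
    show "\<bar>d k x y - d k x' y'\<bar> \<le> real (Suc k) * (dist x x' + dist y y')" for k x y x' y'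
      unfolding d_def by (rule chain_cost.chain_dist_lipschitz[OF cc])
    show "d j x y \<le> d k x y" if "j \<le> k" for j k x y
      unfolding d_def using cmono hmono that by (intro chain_dist_mono[OF cc cc]) auto
  qed (unfold d_def, rule discrete_coupling[OF \<mu> \<nu> S(1) b cc cf M])
  then obtain \<pi> where \<pi>: "\<pi> \<in> couplings \<mu> \<nu>"
    and le: "(\<integral>\<^sup>+z. (SUP k. ennreal (d k (fst z) (snd z))) \<partial>\<pi>) \<le> ennreal M" by blast
  have urban: "urban_metric S a b x y \<le> (SUP k. ennreal (d k x y))" for x y
  proof (rule ennreal_le_epsilon)
    fix e :: real assume fin: "(SUP k. ennreal (d k x y)) < top" and e: "0 < e"
    define D where "D = enn2real (SUP k. ennreal (d k x y))"
    have D: "(SUP k. ennreal (d k x y)) = ennreal D" "0 \<le> D" using fin by (auto simp: D_def)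
    have dD: "d k x y \<le> D + e" for k
    proof -
      have "ennreal (d k x y) \<le> ennreal D" unfolding D(1)[symmetric] by (rule SUP_upper) simp
      then have "d k x y \<le> D" using D(2) by (simp add: ennreal_le_iff)
      then show ?thesis using e by simp
    qed
    have "urban_metric S a b x y \<le> ennreal (D + e)"
      using D(2) e by (intro urban_metric_le_limit[OF S(2) lsc cc cmono hmono sup Bh _ dD[unfolded d_def]]) auto
    then show "urban_metric S a b x y \<le> (SUP k. ennreal (d k x y)) + ennreal e"
      unfolding D(1) using D(2) e by simp
  qed
  have "wasserstein (urban_metric S a b) \<mu> \<nu> \<le> (\<integral>\<^sup>+z. urban_metric S a b (fst z) (snd z) \<partial>\<pi>)"
    unfolding wasserstein_def by (rule INF_lower[OF \<pi>])
  also have "\<dots> \<le> (\<integral>\<^sup>+z. (SUP k. ennreal (d k (fst z) (snd z))) \<partial>\<pi>)" by (intro nn_integral_mono urban)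
  finally show ?thesis using le by (rule order_trans)
qed

lemma zero_admissible:
  assumes "\<And>x. x \<in> S \<Longrightarrow> 0 \<le> b x" "S \<subseteq> cube"
  shows "(\<lambda>_. 0) \<in> admissible_potentials S a (b :: real ^ 'n \<Rightarrow> real)"
proof -
  have g: "is_gradient_on_cube (\<lambda>_ :: real ^ 'n. 0) (\<lambda>_. 0)"
    by (simp add: is_gradient_on_cube_def gderiv_def)
  then have "cube_gradient (\<lambda>_. 0) x = 0" if "x \<in> cube" for x :: "real ^ 'n" using cube_gradient_eq[OF g that] by simp
  then show ?thesis using g assms by (auto simp: admissible_potentials_def C1_cube_def)
qed

theorem theorem1p3p2:
  fixes \<mu> \<nu> :: "(real ^ 'n) measure"
    and S :: "(real ^ 'n) set"
    and a :: ennreal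
    and b :: "real ^ 'n \<Rightarrow> real"
  assumes "borel_prob \<mu>" and "borel_prob \<nu>"
    and "measure_support \<mu> \<subseteq> cube" and "measure_support \<nu> \<subseteq> cube"
    and "city S a b" and "S \<subseteq> cube"
    and "\<exists>c>0. \<forall>x\<in>S. c \<le> b x"
    and "lower_semicontinuous_on UNIV (friction S a b)"
  shows "enn2ereal (wasserstein (urban_metric S a b) \<mu> \<nu>) =
    (SUP \<phi> \<in> {\<phi> \<in> C1_cube. (\<forall>x\<in>S. norm (cube_gradient \<phi> x) \<le> b x) \<and>
                          (\<forall>x\<in>cube - S. ennreal (norm (cube_gradient \<phi> x)) \<le> a)}.
       ereal ((LINT x:cube|\<mu>. \<phi> x) - (LINT x:cube|\<nu>. \<phi> x)))"
  (is "?W = ?R")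
proof -
  define J where "J \<phi> = (LINT x:cube|\<mu>. \<phi> x) - (LINT x:cube|\<nu>. \<phi> x)" for \<phi> :: "real ^ 'n \<Rightarrow> real"
  have R: "?R = (SUP \<phi> \<in> admissible_potentials S a b. ereal (J \<phi>))"
    by (simp add: admissible_potentials_def J_def)
  have S: "S \<in> sets borel" "\<And>x. x \<in> S \<Longrightarrow> 0 \<le> b x" "\<And>x. x \<in> S \<Longrightarrow> ennreal (b x) \<le> a"
    using assms(5) by (auto simp: city_def)
  have "ereal (J \<phi>) \<le> ?W" if \<phi>: "\<phi> \<in> admissible_potentials S a b" for \<phi>
  proof -
    have \<phi>': "\<phi> \<in> C1_cube" "\<And>x. x \<in> S \<Longrightarrow> norm (cube_gradient \<phi> x) \<le> b x"
      "\<And>x. x \<in> cube - S \<Longrightarrow> ennreal (norm (cube_gradient \<phi> x)) \<le> a"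
      using \<phi> by (auto simp: admissible_potentials_def)
    have "ennreal (J \<phi>) \<le> wasserstein (urban_metric S a b) \<mu> \<nu>"
      unfolding wasserstein_def J_def
    proof (rule INF_greatest)
      fix \<pi> assume \<pi>: "\<pi> \<in> couplings \<mu> \<nu>"
      show "ennreal ((LINT x:cube|\<mu>. \<phi> x) - (LINT x:cube|\<nu>. \<phi> x)) \<le> (\<integral>\<^sup>+z. urban_metric S a b (fst z) (snd z) \<partial>\<pi>)"
        using \<phi>'(1) by (intro potential_difference_le_transport_cost[OF assms(1,3) assms(2,4) \<pi>]
            increment_le_urban_metric[OF S(1) assms(6) S(3) lower_semicontinuous_borel_measurable[OF assms(8)] \<phi>'])
          (auto simp: C1_cube_def)
    qed
    then have "enn2ereal (ennreal (J \<phi>)) \<le> ?W" by (simp add: less_eq_ennreal.rep_eq)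
    moreover have "ereal (J \<phi>) \<le> enn2ereal (ennreal (J \<phi>))"
      by (cases "0 \<le> J \<phi>") (auto simp: enn2ereal_ennreal ennreal_neg zero_ennreal.rep_eq)
    ultimately show ?thesis by (rule order_trans[rotated])
  qed
  then have ge: "?R \<le> ?W" unfolding R by (rule SUP_least)
  have "?W \<le> ?R"
  proof (cases "?R = \<infinity>")
    case False
    have z: "(\<lambda>_. 0) \<in> admissible_potentials S a b" by (rule zero_admissible[OF S(2) assms(6)])
    have R0: "0 \<le> ?R" unfolding R using SUP_upper[OF z, of "\<lambda>\<phi>. ereal (J \<phi>)"] by (simp add: J_def zero_ereal_def)
    then obtain M where M: "?R = ereal M" "0 \<le> M" using False by (cases "?R") auto
    have JM: "J \<phi> \<le> M" if "\<phi> \<in> admissible_potentials S a b" for \<phi>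
      using SUP_upper[OF that, of "\<lambda>\<phi>. ereal (J \<phi>)"] M(1) unfolding R by simp
    have "wasserstein (urban_metric S a b) \<mu> \<nu> \<le> ennreal M"
    proof (cases "a = 0")
      case True
      obtain c where c: "0 < c" "\<And>x. x \<in> S \<Longrightarrow> c \<le> b x" using assms(7) by blast
      have "S = {}" using S(3) c True by (force simp: ennreal_eq_0_iff)
      obtain \<pi> where "\<pi> \<in> couplings \<mu> \<nu>" using couplings_nonempty[OF assms(1,2)] by blast
      then have "wasserstein (urban_metric S a b) \<mu> \<nu> \<le> (\<integral>\<^sup>+z. urban_metric S a b (fst z) (snd z) \<partial>\<pi>)"
        unfolding wasserstein_def by (rule INF_lower)
      also have "\<dots> = 0" by (simp add: True \<open>S = {}\<close> urban_metric_zero)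
      finally show ?thesis by simp
    next
      case False
      obtain c where c: "0 < c" "\<And>x. x \<in> S \<Longrightarrow> c \<le> b x" using assms(7) by blast
      obtain a' where a': "0 < a'" "ennreal a' \<le> a"
      proof (cases "a = top")
        case True
        then show ?thesis by (intro that[of 1]) auto
      next
        case ft: False
        then have "a = ennreal (enn2real a)" by (simp add: less_top)
        moreover have "0 < enn2real a" using False ft by (simp add: enn2real_positive_iff less_top zero_less_iff_neq_zero)
        ultimately show ?thesis by (intro that[of "enn2real a"]) auto
      qed
      \<comment> \<open>The lowest truncation height is \<open>1\<close>, so only constants up to \<open>1\<close> bound all envelopes from below.\<close>
      define c0 where "c0 = min 1 (min c a')"
      have "ennreal c0 \<le> friction S a b x" for x
      proof (cases "x \<in> S")
        case True
        have "c0 \<le> b x" using c(2)[OF True] by (simp add: c0_def)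
        then show ?thesis using True by (simp add: friction_def ennreal_leI)
      next
        case False
        have "ennreal c0 \<le> ennreal a'" by (intro ennreal_leI) (simp add: c0_def)
        then show ?thesis using False a'(2) by (simp add: friction_def)
      qed
      moreover have "0 < c0" "c0 \<le> 1" using c(1) a'(1) by (auto simp: c0_def)
      ultimately show ?thesis
        using wasserstein_le_potentials[OF assms(1,3) assms(2,4) assms(6) S(1,2) assms(8) _ _ _ M(2) JM[unfolded J_def]] by blast
    qed
    then have "?W \<le> enn2ereal (ennreal M)" by (simp add: less_eq_ennreal.rep_eq)
    then show ?thesis using M by (simp add: enn2ereal_ennreal)
  qed simp
  with ge show ?thesis by (rule antisym[rotated])
qed

end
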